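(* Fix an integer $k\ge1$ (known). Let $X_1,\ldots,X_n$ be i.i.d. from a density $g_0$ on $(0,1)$ of the form $$g_0(x)=\sum_{j=0}^{k-1}\beta_{0,j}\psi_{j+1}(x,1)+\beta_{0,k}\int\psi_k(x,\theta)\,dQ_0(\theta),$$ with $(\beta_{0,0},\ldots,\beta_{0,k})\in\Delta_{k+1}$, $Q_0$ a probability measure on $(0,1)$, $\beta_{0,0}>0$ and $|g_0^{(k-1)}(0+)|<\infty$. Put the prior on densities $g(x)=\sum_{j=0}^{k-1}\beta_j\psi_{j+1}(x,1)+\beta_k\int\psi_k(x,\theta)\,dQ(\theta)$ given by $\bm\beta=(\beta_0,\ldots,\beta_k)\sim\mathrm{Dir}(a_0,\ldots,a_k)$ with fixed constants $a_0,\ldots,a_k>0$, and independently $Q\sim\mathrm{DP}_{aH}$ (Dirichlet process with precision $a>0$ and center measure $H$ on $(0,1)$), where $H$ satisfies conditions (C1) and (C2). Then with $\epsilon_n=(n/\log n)^{-k/(2k+1)}$, for every sequence $M_n\to\infty$, $$\mathrm{E}_{g_0}\bigl[\Pi\bigl(g:d_H(g,g_0)\ge M_n\epsilon_n\mid X_1,\ldots,X_n\bigr)\bigr]\to0.$$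
   Context: $\psi_k(x,\theta)=\frac{k}{\theta}(1-\frac{x}{\theta})_+^{k-1}$ for $x,\theta>0$. $\Delta_J=\{(w_1,\ldots,w_J)\in[0,1]^J:\sum_i w_i=1\}$. For $k\ge2$, $g_0^{(k-1)}$ is the right derivative of $g_0^{(k-2)}$ and $g_0^{(k-1)}(0+)$ its right limit at $0$ (for $k=1$, $g_0^{(0)}=g_0$). Hellinger distance: $d_H(p_1,p_2)=\|\sqrt{p_1}-\sqrt{p_2}\|_2$. Condition (C1): $H$ has a Lebesgue density $p_H$ on $(0,1)$ with $p_H(\theta)\lesssim\theta^{t_1}$ for all $\theta$ in a neighborhood of $0$, for some $t_1>0$. Condition (C2): for some $t_2>0$ and all intervals $(u,v)\subset(0,1)$, $H((u,v))\gtrsim(v-u)^{t_2}$. Here $\lesssim$ means inequality up to a positive constant not depending on the variables. $\Pi(\cdot\mid X_1,\ldots,X_n)$ denotes the posterior distribution. *)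

theory Defs
  imports "HOL-Probability.Probability"
begin

text \<open>psi_k(x,theta) = k/theta (1 - x/theta)_+^(k-1), for x, theta > 0 (and 0 otherwise).
  The positive part power (t)_+^(k-1) is read as indicator(t > 0) * t^(k-1), so that
  psi_1(., theta) is the uniform density on (0, theta).\<close>
definition psi :: "nat \<Rightarrow> real \<Rightarrow> real \<Rightarrow> real" where
  "psi k x \<theta> = (if 0 < x \<and> 0 < \<theta> \<and> x < \<theta> then real k / \<theta> * (1 - x / \<theta>) ^ (k - 1) else 0)"

definition unit_simplex :: "nat \<Rightarrow> (nat \<Rightarrow> real) set" where
  "unit_simplex J = {w. (\<forall>i<J. 0 \<le> w i \<and> w i \<le> 1) \<and> (\<Sum>i<J. w i) = 1}"

definition M01 :: "real measure" where
  "M01 = restrict_space borel {0<..<1}"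

definition gmix :: "nat \<Rightarrow> (nat \<Rightarrow> real) \<Rightarrow> real measure \<Rightarrow> real \<Rightarrow> real" where
  "gmix k \<beta> Q x = (\<Sum>j<k. \<beta> j * psi (j + 1) x 1) + \<beta> k * (\<integral>\<theta>. psi k x \<theta> \<partial>Q)"

definition rderiv :: "(real \<Rightarrow> real) \<Rightarrow> real \<Rightarrow> real" where
  "rderiv f x = Lim (at_right 0) (\<lambda>h. (f (x + h) - f x) / h)"

fun iter_rderiv :: "nat \<Rightarrow> (real \<Rightarrow> real) \<Rightarrow> real \<Rightarrow> real" where
  "iter_rderiv 0 f = f"
| "iter_rderiv (Suc j) f = rderiv (iter_rderiv j f)"

definition hellinger :: "(real \<Rightarrow> real) \<Rightarrow> (real \<Rightarrow> real) \<Rightarrow> real" where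
  "hellinger p1 p2 = sqrt (enn2real (\<integral>\<^sup>+ x. ennreal ((sqrt (p1 x) - sqrt (p2 x))\<^sup>2) \<partial>lborel))"

definition gamma_measure :: "real \<Rightarrow> real measure" where
  "gamma_measure \<alpha> = (if \<alpha> = 0 then return borel 0
     else density lborel (\<lambda>x. ennreal (if 0 < x then x powr (\<alpha> - 1) * exp (- x) / Gamma \<alpha> else 0)))"

definition dirichlet :: "nat \<Rightarrow> (nat \<Rightarrow> real) \<Rightarrow> (nat \<Rightarrow> real) measure" where
  "dirichlet m \<alpha> = distr (PiM {..<m} (\<lambda>i. gamma_measure (\<alpha> i))) (PiM {..<m} (\<lambda>_. borel))
     (\<lambda>y. \<lambda>i\<in>{..<m}. y i / (\<Sum>j<m. y j))"

definition is_DP :: "real measure measure \<Rightarrow> real \<Rightarrow> real measure \<Rightarrow> bool" where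
  "is_DP P a H \<longleftrightarrow> prob_space P \<and> sets P = sets (prob_algebra M01) \<and>
     (\<forall>m (A :: nat \<Rightarrow> real set). 1 \<le> m \<longrightarrow> (\<forall>i<m. A i \<in> sets M01) \<longrightarrow>
        disjoint_family_on A {..<m} \<longrightarrow> (\<Union>i<m. A i) = {0<..<1} \<longrightarrow>
        distr P (PiM {..<m} (\<lambda>_. borel)) (\<lambda>Q. \<lambda>i\<in>{..<m}. measure Q (A i))
          = dirichlet m (\<lambda>i. a * measure H (A i)))"

definition likelihood :: "nat \<Rightarrow> nat \<Rightarrow> (nat \<Rightarrow> real) \<times> real measure \<Rightarrow> (nat \<Rightarrow> real) \<Rightarrow> ennreal" where
  "likelihood k n p X = (\<Prod>i<n. ennreal (gmix k (fst p) (snd p) (X i)))"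

definition posterior ::
  "((nat \<Rightarrow> real) \<times> real measure) measure \<Rightarrow> nat \<Rightarrow> nat \<Rightarrow>
     ((nat \<Rightarrow> real) \<times> real measure) set \<Rightarrow> (nat \<Rightarrow> real) \<Rightarrow> ennreal" where
  "posterior Prior k n B X =
     (\<integral>\<^sup>+ p. indicator B p * likelihood k n p X \<partial>Prior) / (\<integral>\<^sup>+ p. likelihood k n p X \<partial>Prior)"

end

theory Submission
  imports Defs "HOL-Computational_Algebra.Polynomial"
begin

text \<open>Put \<open>T = (n / ln n)^(1/(2k+1))\<close>. Then \<open>\<epsilon>\<^sub>n = T^(-k)\<close> and \<open>n \<epsilon>\<^sub>n^2 = T ln n\<close>, which leaves room for
  \<open>O(T)\<close> free parameters, each discretised polynomially in \<open>n\<close>.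

  Numerator: a mixture \<open>g\<close> is non-increasing, so it exceeds a fixed level \<open>K\<close> only on an initial interval
  \<open>(0, a0)\<close>. To the right of \<open>a0\<close> it is within \<open>O(T^(-k))\<close> in \<open>L\<^sup>2\<close> of a piecewise polynomial \<open>u\<close> with \<open>O(T)\<close>
  pieces; to the left put \<open>u = K\<close>. The linear statistic with summand \<open>u - g0\<close> is bounded and separates
  \<open>g\<close> from \<open>g0\<close> with errors exponentially small in \<open>n h(g, g0)^2\<close>, since a spike of \<open>g\<close> near \<open>0\<close> only helps.
  As \<open>u\<close> ranges over a set of cardinality \<open>exp (O(T ln n))\<close>, no sieve is needed.

  Denominator: the limit of the right derivative of order \<open>k - 1\<close> at \<open>0\<close> makes \<open>\<theta>^(-k)\<close> integrable with
  respect to \<open>Q0\<close>. Cut \<open>(0, 1)\<close> into \<open>O(T)\<close> groups and match in every group the moments of order up to \<open>k\<close>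
  of the measure \<open>\<theta>^(-k) dQ0\<close>; this replaces \<open>Q0\<close> by \<open>O(T)\<close> atoms at an \<open>L\<^sup>2\<close> cost of \<open>O(\<epsilon>\<^sub>n)\<close>. A draw that puts
  almost the right mass just to the right of every atom dominates a fixed function close to \<open>g0\<close>, which
  bounds the chi-square divergence whatever the remaining mass does.\<close>

section \<open>The mixture densities\<close>

text \<open>Prior draws have no common bound: near \<open>0\<close> a draw may be arbitrarily large
  and its measure \<open>\<theta>^(-k) dQ\<close> arbitrarily heavy. To the right of the point
  \<open>a0\<close> where a draw falls to the level \<open>K\<close>, the only uniform information
  is its value at \<open>a0\<close>. That value controls \<open>\<theta>^(-k) dQ\<close> weighted by
  \<open>(\<theta> - a0)^(k-1)\<close>, which degenerates at \<open>a0\<close>. The breakpoints of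
  the approximating polynomial therefore follow the scale \<open>(x - a0)^(1/(2k))\<close>; the
  squared error then has the integrable singularity \<open>(x - a0)^(-(k-1)/k)\<close>.

  Both approximations use one device for their partitions: a monotone function adding a length and a
  mass is cut at integer levels on a fine grid, and a grid cell over which it jumps stands alone and
  is paid for by its length. With grid step \<open>1/n\<close> such losses are
  \<open>O(T/n)\<close>.

  The means of the linear statistic under \<open>g\<close> and \<open>g0\<close> have no definite
  sign separately, so the two exponential moments are estimated jointly and the test is normalised
  afterwards. The moment of order \<open>k\<close> is matched because it is the mass of
  \<open>Q0\<close> itself.\<close>

lemma psi_nonneg: "0 \<le> psi k x \<theta>"
  by (auto simp: psi_def field_simps)

lemma psi_eq:
  assumes "0 < x" "x < \<theta>" "1 \<le> k"
  shows "psi k x \<theta> = real k * (\<theta> - x) ^ (k - 1) / \<theta> ^ k"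
proof -
  have "1 - x / \<theta> = (\<theta> - x) / \<theta>" using assms by (simp add: field_simps)
  moreover have "\<theta> ^ k = \<theta> * \<theta> ^ (k - 1)" using assms by (cases k) auto
  ultimately show ?thesis using assms by (simp add: psi_def power_divide)
qed

lemma psi_eq_0: "\<theta> \<le> x \<or> x \<le> 0 \<Longrightarrow> psi k x \<theta> = 0"
  by (auto simp: psi_def)

lemma psi_one: "0 < x \<Longrightarrow> x < 1 \<Longrightarrow> psi (j + 1) x 1 = (real j + 1) * (1 - x) ^ j"
  by (simp add: psi_def)

lemma psi_antimono:
  assumes "0 < x" "x \<le> y"
  shows "psi k y \<theta> \<le> psi k x \<theta>"
proof (cases "y < \<theta>")
  case True
  then have "(1 - y / \<theta>) ^ (k - 1) \<le> (1 - x / \<theta>) ^ (k - 1)"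
    using assms by (intro power_mono) (auto simp: field_simps)
  then show ?thesis using assms True by (auto simp: psi_def intro!: divide_right_mono mult_left_mono)
qed (simp add: psi_eq_0 psi_nonneg)

lemma psi_le:
  assumes "0 < x"
  shows "psi k x \<theta> \<le> real k / x"
proof (cases "x < \<theta>")
  case True
  have "(1 - x / \<theta>) ^ (k - 1) \<le> 1" using assms True by (intro power_le_one) (auto simp: field_simps)
  then have "real k / \<theta> * (1 - x / \<theta>) ^ (k - 1) \<le> real k / \<theta> * 1"
    using assms True by (intro mult_left_mono) auto
  also have "\<dots> \<le> real k / x" using assms True by (simp add: frac_le)
  finally show ?thesis using assms True by (simp add: psi_def)
qed (use assms in \<open>simp add: psi_eq_0\<close>)

lemma psi_le_moment:
  assumes "0 < \<theta>" "\<theta> \<le> 1" "1 \<le> k"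
  shows "psi k x \<theta> \<le> real k / \<theta> ^ k"
proof (cases "0 < x \<and> x < \<theta>")
  case True
  have "(\<theta> - x) ^ (k - 1) \<le> 1" using assms True by (intro power_le_one) auto
  then show ?thesis using assms True
    by (auto simp: psi_eq divide_simps mult_left_le)
qed (use assms in \<open>auto simp: psi_eq_0\<close>)

text \<open>Enlarging the scale from \<open>z\<close> to \<open>\<theta>\<close> increases
  \<open>1 - x / \<theta>\<close>, so only the factor \<open>k / \<theta>\<close> can lose, by at
  most \<open>1 + \<rho>\<close>. No such bound holds for a scale below \<open>z\<close>, whose
  kernel vanishes between that scale and \<open>z\<close>; this is why draws are asked to put mass
  to the right of an atom.\<close>

lemma psi_ge_right:
  assumes "0 < z" "z \<le> \<theta>" "\<theta> \<le> (1 + \<rho>) * z"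
  shows "psi k x z / (1 + \<rho>) \<le> psi k x \<theta>"
proof (cases "0 < x \<and> x < z")
  case True
  have r: "1 + \<rho> > 0" using assms by (metis dual_order.strict_trans1 order_less_le_trans zero_less_mult_pos2)
  have "(1 - x / z) ^ (k - 1) \<le> (1 - x / \<theta>) ^ (k - 1)"
    using assms True by (intro power_mono) (auto simp: frac_le)
  moreover have "real k / ((1 + \<rho>) * z) \<le> real k / \<theta>" using assms by (intro divide_left_mono) auto
  ultimately have "real k / ((1 + \<rho>) * z) * (1 - x / z) ^ (k - 1) \<le> real k / \<theta> * (1 - x / \<theta>) ^ (k - 1)"
    using assms True by (intro mult_mono) auto
  then show ?thesis using assms True r by (simp add: psi_def mult.commute)
qed (use assms in \<open>auto simp: psi_eq_0 psi_nonneg\<close>)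

lemma measurable_psi[measurable (raw)]:
  assumes [measurable]: "f \<in> borel_measurable M" "g \<in> borel_measurable M"
  shows "(\<lambda>w. psi k (f w) (g w)) \<in> borel_measurable M"
  unfolding psi_def by measurable

lemma nn_integral_psi:
  assumes "0 < \<theta>" "1 \<le> k"
  shows "(\<integral>\<^sup>+ x. ennreal (psi k x \<theta>) \<partial>lborel) = 1"
proof -
  have "(\<integral>\<^sup>+ x. ennreal (psi k x \<theta>) \<partial>lborel)
      = (\<integral>\<^sup>+ x. ennreal (real k / \<theta> * (1 - x / \<theta>) ^ (k - 1)) * indicator {0..\<theta>} x \<partial>lborel)"
  proof (rule nn_integral_cong_AE)
    \<comment> \<open>The endpoints have to be removed: the formula is nonzero at \<open>0\<close>,
      and at \<open>\<theta>\<close> too when \<open>k = 1\<close>, while \<open>psi\<close> is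
      \<open>0\<close> at both.\<close>
    have "AE x in lborel. x \<noteq> 0" "AE x in lborel. x \<noteq> \<theta>" by (rule AE_lborel_singleton)+
    then show "AE x in lborel. ennreal (psi k x \<theta>)
        = ennreal (real k / \<theta> * (1 - x / \<theta>) ^ (k - 1)) * indicator {0..\<theta>} x"
      by eventually_elim (auto simp: psi_def indicator_def)
  qed
  also have "\<dots> = - ((1 - \<theta> / \<theta>) ^ k) - (- ((1 - 0 / \<theta>) ^ k))"
  proof (rule nn_integral_FTC_Icc[where F="\<lambda>x. - ((1 - x / \<theta>) ^ k)"])
    show "((\<lambda>x. - ((1 - x / \<theta>) ^ k)) has_real_derivative real k / \<theta> * (1 - x / \<theta>) ^ (k - 1)) (at x)" for x
      using assms by (auto intro!: derivative_eq_intros)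
  qed (use assms in \<open>auto simp: field_simps\<close>)
  also have "\<dots> = 1" using assms by (auto simp: power_0_left)
  finally show ?thesis .
qed

lemma sets_M01: "sets M01 = sets (restrict_space borel {0<..<1})" by (simp add: M01_def)
lemma space_M01: "space M01 = {0<..<1}" by (simp add: M01_def space_restrict_space)

lemma measurable_M01: "f \<in> borel_measurable borel \<Longrightarrow> f \<in> borel_measurable M01"
  by (simp add: M01_def measurable_restrict_space1)

text \<open>The requirements shared by the true density and by almost every draw of the prior, so
  that each estimate below applies to either.\<close>

locale mixing =
  fixes k :: nat and \<beta> :: "nat \<Rightarrow> real" and Q :: "real measure"
  assumes k1: "1 \<le> k" and beta: "\<beta> \<in> unit_simplex (k + 1)"
    and Qp: "prob_space Q" and Qs: "sets Q = sets M01"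
begin

sublocale Q: prob_space Q by (rule Qp)

lemma space_Q: "space Q = {0<..<1}"
  using sets_eq_imp_space_eq[OF Qs] by (simp add: space_M01)

lemma Q_measurable: "f \<in> borel_measurable borel \<Longrightarrow> f \<in> borel_measurable Q"
  using measurable_M01[of f] measurable_cong_sets[OF Qs refl, of borel] by blast

lemma measurable_snd_Q: "snd \<in> borel_measurable (M \<Otimes>\<^sub>M Q)"
  and measurable_fst_Q: "fst \<in> borel_measurable (Q \<Otimes>\<^sub>M M)"
  using measurable_compose[OF measurable_snd Q_measurable[OF measurable_ident]]
    measurable_compose[OF measurable_fst Q_measurable[OF measurable_ident]]
  by (auto simp only: o_def id_def)

lemma beta_nonneg: "j \<le> k \<Longrightarrow> 0 \<le> \<beta> j" and beta_le: "j \<le> k \<Longrightarrow> \<beta> j \<le> 1"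
  using beta by (auto simp: unit_simplex_def)

lemma beta_sum: "(\<Sum>j<k. \<beta> j) + \<beta> k = 1"
  using beta by (simp add: unit_simplex_def)

lemma integrable_bounded_Q:
  assumes "f \<in> borel_measurable borel" "\<And>\<theta>. 0 < \<theta> \<Longrightarrow> \<theta> < 1 \<Longrightarrow> \<bar>f \<theta>\<bar> \<le> B"
  shows "integrable Q (f :: real \<Rightarrow> real)"
  by (rule Q.integrable_const_bound[where B=B])
     (use assms in \<open>auto simp: space_Q intro!: AE_I2 Q_measurable\<close>)

text \<open>For fixed \<open>x > 0\<close> the kernel is at most \<open>k / x\<close> uniformly in
  the scale, so a mixture is finite at every positive point although it may be unbounded near
  \<open>0\<close>.\<close>

lemma integrable_psi: "integrable Q (psi k x)"
proof (rule integrable_bounded_Q)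
  show "\<bar>psi k x \<theta>\<bar> \<le> (if 0 < x then real k / x else 0)" for \<theta>
    by (simp add: psi_le psi_nonneg psi_eq_0)
qed measurable

lemma integral_psi_nonneg: "0 \<le> (\<integral>\<theta>. psi k x \<theta> \<partial>Q)"
  by (simp add: psi_nonneg integral_nonneg_AE)

lemma gmix_nonneg: "0 \<le> gmix k \<beta> Q x"
  unfolding gmix_def
  by (intro add_nonneg_nonneg sum_nonneg mult_nonneg_nonneg beta_nonneg integral_psi_nonneg psi_nonneg) auto

lemma gmix_eq_0: "x \<notin> {0<..<1} \<Longrightarrow> gmix k \<beta> Q x = 0"
proof -
  assume x: "x \<notin> {0<..<1}"
  have "(\<integral>\<theta>. psi k x \<theta> \<partial>Q) = (\<integral>\<theta>. 0 \<partial>Q)"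
    using x by (intro Bochner_Integration.integral_cong) (auto simp: space_Q psi_def)
  then show ?thesis using x by (auto simp: gmix_def psi_def intro!: sum.neutral)
qed

lemma gmix_antimono: "0 < x \<Longrightarrow> x \<le> y \<Longrightarrow> gmix k \<beta> Q y \<le> gmix k \<beta> Q x"
  unfolding gmix_def
  by (intro add_mono sum_mono mult_left_mono psi_antimono beta_nonneg integral_mono integrable_psi) auto

text \<open>\<open>psi 1 x 1\<close> equals \<open>1\<close> on the unit interval, so the first
  weight is a floor for the density. For the truth, this floor lets Hellinger and chi-square
  distances be compared with \<open>L^2\<close> errors.\<close>

lemma gmix_ge_beta0:
  assumes "0 < x" "x < 1"
  shows "\<beta> 0 \<le> gmix k \<beta> Q x"
proof -
  have "\<beta> 0 = \<beta> 0 * psi (0 + 1) x 1" using assms by (simp add: psi_def)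
  also have "\<dots> \<le> (\<Sum>j<k. \<beta> j * psi (j + 1) x 1)"
    using k1 by (intro member_le_sum mult_nonneg_nonneg beta_nonneg psi_nonneg) auto
  finally show ?thesis unfolding gmix_def
    using mult_nonneg_nonneg[OF beta_nonneg[of k] integral_psi_nonneg[of x]] by simp
qed

lemma gmix_ennreal:
  "ennreal (gmix k \<beta> Q x) = (\<Sum>j<k. ennreal (\<beta> j) * ennreal (psi (j + 1) x 1))
     + ennreal (\<beta> k) * (\<integral>\<^sup>+ \<theta>. ennreal (psi k x \<theta>) \<partial>Q)"
proof -
  have "(\<integral>\<^sup>+ \<theta>. ennreal (psi k x \<theta>) \<partial>Q) = ennreal (\<integral>\<theta>. psi k x \<theta> \<partial>Q)"
    by (intro nn_integral_eq_integral integrable_psi) (auto simp: psi_nonneg)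
  moreover have "(\<Sum>j<k. ennreal (\<beta> j) * ennreal (psi (j + 1) x 1)) = ennreal (\<Sum>j<k. \<beta> j * psi (j + 1) x 1)"
    by (subst sum_ennreal[symmetric]) (auto simp: ennreal_mult beta_nonneg psi_nonneg)
  moreover have "0 \<le> (\<Sum>j<k. \<beta> j * psi (j + 1) x 1)"
    by (auto intro!: sum_nonneg mult_nonneg_nonneg beta_nonneg psi_nonneg)
  ultimately show ?thesis unfolding gmix_def
    by (simp add: ennreal_plus ennreal_mult beta_nonneg integral_psi_nonneg)
qed

lemma borel_measurable_gmix[measurable]: "gmix k \<beta> Q \<in> borel_measurable borel"
proof -
  note [measurable] = measurable_snd_Q
  have "(\<lambda>p. psi k (fst p) (snd p)) \<in> borel_measurable (borel \<Otimes>\<^sub>M Q)"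
    by measurable
  then show ?thesis unfolding gmix_def[abs_def]
    by (intro borel_measurable_add borel_measurable_sum borel_measurable_times
        Q.borel_measurable_lebesgue_integral) (auto simp: split_beta')
qed

lemma nn_integral_gmix: "(\<integral>\<^sup>+ x. ennreal (gmix k \<beta> Q x) \<partial>lborel) = 1"
proof -
  interpret pair_sigma_finite Q lborel ..
  note [measurable] = measurable_snd_Q measurable_fst_Q
  have m: "(\<lambda>(x, y). ennreal (psi k x y)) \<in> borel_measurable (lborel \<Otimes>\<^sub>M Q)"
    unfolding split_beta' by measurable
  have m': "(\<lambda>(y, x). ennreal (psi k x y)) \<in> borel_measurable (Q \<Otimes>\<^sub>M lborel)"
    unfolding split_beta' by measurable
  have "(\<integral>\<^sup>+ x. (\<integral>\<^sup>+ \<theta>. ennreal (psi k x \<theta>) \<partial>Q) \<partial>lborel)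
      = (\<integral>\<^sup>+ \<theta>. (\<integral>\<^sup>+ x. ennreal (psi k x \<theta>) \<partial>lborel) \<partial>Q)"
    using Fubini'[OF m'] by simp
  also have "\<dots> = (\<integral>\<^sup>+ \<theta>. 1 \<partial>Q)"
    by (intro nn_integral_cong) (auto simp: space_Q nn_integral_psi[OF _ k1])
  finally have 1: "(\<integral>\<^sup>+ x. (\<integral>\<^sup>+ \<theta>. ennreal (psi k x \<theta>) \<partial>Q) \<partial>lborel) = 1"
    by (simp add: Q.emeasure_space_1)
  have [measurable]: "(\<lambda>x. \<integral>\<^sup>+ \<theta>. ennreal (psi k x \<theta>) \<partial>Q) \<in> borel_measurable lborel"
    using Q.borel_measurable_nn_integral[OF m] by simp
  have 2: "(\<integral>\<^sup>+ x. ennreal (psi (j + 1) x 1) \<partial>lborel) = 1" for j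
    by (rule nn_integral_psi) auto
  have "(\<integral>\<^sup>+ x. ennreal (gmix k \<beta> Q x) \<partial>lborel)
     = (\<integral>\<^sup>+ x. (\<Sum>j<k. ennreal (\<beta> j) * ennreal (psi (j + 1) x 1)) \<partial>lborel)
       + (\<integral>\<^sup>+ x. ennreal (\<beta> k) * (\<integral>\<^sup>+ \<theta>. ennreal (psi k x \<theta>) \<partial>Q) \<partial>lborel)"
    unfolding gmix_ennreal by (rule nn_integral_add) measurable
  also have "(\<integral>\<^sup>+ x. (\<Sum>j<k. ennreal (\<beta> j) * ennreal (psi (j + 1) x 1)) \<partial>lborel)
     = (\<Sum>j<k. \<integral>\<^sup>+ x. ennreal (\<beta> j) * ennreal (psi (j + 1) x 1) \<partial>lborel)"
    by (rule nn_integral_sum) measurable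
  also have "\<dots> = (\<Sum>j<k. ennreal (\<beta> j) * 1)"
  proof (intro sum.cong refl)
    fix j
    have "(\<integral>\<^sup>+ x. ennreal (\<beta> j) * ennreal (psi (j + 1) x 1) \<partial>lborel)
        = ennreal (\<beta> j) * (\<integral>\<^sup>+ x. ennreal (psi (j + 1) x 1) \<partial>lborel)"
      by (rule nn_integral_cmult) measurable
    then show "(\<integral>\<^sup>+ x. ennreal (\<beta> j) * ennreal (psi (j + 1) x 1) \<partial>lborel) = ennreal (\<beta> j) * 1"
      by (simp only: 2)
  qed
  also have "(\<integral>\<^sup>+ x. ennreal (\<beta> k) * (\<integral>\<^sup>+ \<theta>. ennreal (psi k x \<theta>) \<partial>Q) \<partial>lborel) = ennreal (\<beta> k) * 1"
    by (subst nn_integral_cmult, measurable) (simp only: 1)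
  also have "(\<Sum>j<k. ennreal (\<beta> j) * 1) + ennreal (\<beta> k) * 1 = ennreal ((\<Sum>j<k. \<beta> j) + \<beta> k)"
  proof -
    have "(\<Sum>j<k. ennreal (\<beta> j)) = ennreal (\<Sum>j<k. \<beta> j)"
      by (rule sum_ennreal) (auto simp: beta_nonneg)
    moreover have "0 \<le> (\<Sum>j<k. \<beta> j)" by (auto intro!: sum_nonneg beta_nonneg)
    ultimately show ?thesis by (simp only: mult_1_right ennreal_plus beta_nonneg[OF order_refl])
  qed
  finally show ?thesis by (simp add: beta_sum)
qed

end

section \<open>Expected posterior mass of a set covered by tests\<close>

text \<open>A weight \<open>w\<close> serves as a soft test: if \<open>w \<ge> 1\<close> it already
  dominates the posterior ratio, and otherwise dividing by \<open>w\<close> only enlarges the ratio.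
  The two error probabilities of a test are thereby replaced by moments of \<open>w\<close> and of
  \<open>1 / w\<close>.\<close>

lemma min_one_divide_le_add:
  fixes N :: ennreal
  assumes "0 < w" "0 < d"
  shows "min 1 (N / ennreal d) \<le> ennreal w + N / ennreal (d * w)"
proof (cases "1 \<le> w")
  case True
  then have "1 \<le> ennreal w" by simp
  then show ?thesis by (meson add_increasing2 min.coboundedI1 order_trans zero_le)
next
  case False
  then have "d * w \<le> d" using assms by simp
  then have "N / ennreal d \<le> N / ennreal (d * w)"
    unfolding divide_ennreal_def using assms
    by (intro mult_left_mono) (simp_all add: inverse_ennreal le_divide_eq one_le_inverse)
  then show ?thesis by (meson add_increasing min.coboundedI2 order_trans zero_le)
qed

text \<open>The conventions \<open>0 / 0 = 0\<close> and \<open>top / top = 0\<close> of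
  \<open>ennreal\<close> cover the degenerate cases, so a posterior ratio never exceeds
  \<open>1\<close>.\<close>

lemma ennreal_divide_le_1:
  fixes a b :: ennreal
  assumes "a \<le> b"
  shows "a / b \<le> 1"
proof -
  have "b / b \<le> 1"
    by (cases "b = 0 \<or> b = top") (auto simp: divide_ennreal_def ennreal_divide_self[unfolded divide_ennreal_def] less_top)
  then show ?thesis using divide_right_mono_ennreal[OF assms, of b] by (rule order_trans[rotated])
qed

lemma nn_integral_iid_prod:
  fixes F :: "real \<Rightarrow> real"
  assumes [measurable]: "F \<in> borel_measurable borel" "g0 \<in> borel_measurable borel"
    and "\<And>x. 0 \<le> g0 x" and g01: "(\<integral>\<^sup>+ x. ennreal (g0 x) \<partial>lborel) = 1"
    and F: "\<And>x. 0 \<le> F x"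
    and h: "(\<integral>\<^sup>+ x. ennreal (g0 x * F x) \<partial>lborel) \<le> q"
  shows "(\<integral>\<^sup>+ X. ennreal (\<Prod>i<n. F (X i)) \<partial>(PiM {..<n} (\<lambda>_. density lborel g0))) \<le> q ^ n"
proof -
  interpret prob_space "density lborel g0"
    by (rule prob_spaceI) (simp add: emeasure_density g01)
  interpret product_sigma_finite "\<lambda>_::nat. density lborel g0" ..
  have "(\<integral>\<^sup>+ X. ennreal (\<Prod>i<n. F (X i)) \<partial>(PiM {..<n} (\<lambda>_. density lborel g0)))
      = (\<integral>\<^sup>+ X. (\<Prod>i<n. ennreal (F (X i))) \<partial>(PiM {..<n} (\<lambda>_. density lborel g0)))"
    by (simp add: prod_ennreal F)
  also have "\<dots> = (\<Prod>i<n. \<integral>\<^sup>+ x. ennreal (F x) \<partial>density lborel g0)"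
    by (rule product_nn_integral_prod) auto
  also have "\<dots> = (\<integral>\<^sup>+ x. ennreal (g0 x * F x) \<partial>lborel) ^ n"
    using assms by (simp add: nn_integral_density ennreal_mult)
  also have "\<dots> \<le> q ^ n" using h by (rule power_mono) simp
  finally show ?thesis .
qed

text \<open>Where the evidence divided by the true likelihood is at least \<open>d\<close>, the
  posterior ratio is split over the covering sets \<open>S c\<close> and estimated with the product
  of the \<open>F c (X i)\<close> as weight. Where it is below \<open>d\<close>, a Markov-type
  inequality for the inverse likelihood ratio averaged over \<open>B\<close> gives the last term.
  \<open>Bpos\<close> guards against \<open>x / 0 = 0\<close>, which would make the chi-square
  integral blind to points where \<open>g p\<close> vanishes.\<close>

lemma posterior_expectation_bound:
  fixes g :: "'p \<Rightarrow> real \<Rightarrow> real" and F :: "'c \<Rightarrow> real \<Rightarrow> real"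
  assumes "prob_space Pr"
    and mg: "(\<lambda>(p, x). g p x) \<in> borel_measurable (Pr \<Otimes>\<^sub>M borel)"
    and g: "\<And>p x. 0 \<le> g p x"
    and mg0[measurable]: "g0 \<in> borel_measurable borel"
    and g0: "\<And>x. 0 \<le> g0 x" and g01: "(\<integral>\<^sup>+ x. ennreal (g0 x) \<partial>lborel) = 1"
    and C: "finite C"
    and mF: "\<And>c. c \<in> C \<Longrightarrow> F c \<in> borel_measurable borel"
    and F: "\<And>c x. c \<in> C \<Longrightarrow> 0 < F c x"
    and S[measurable]: "\<And>c. c \<in> C \<Longrightarrow> S c \<in> sets Pr"
    and cover: "AE p in Pr. p \<in> A \<longrightarrow> (\<exists>c\<in>C. p \<in> S c)"
    and test0: "\<And>c. c \<in> C \<Longrightarrow> (\<integral>\<^sup>+ x. ennreal (g0 x * F c x) \<partial>lborel) \<le> q"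
    and test1: "\<And>c p. c \<in> C \<Longrightarrow> p \<in> S c \<Longrightarrow> (\<integral>\<^sup>+ x. ennreal (g p x / F c x) \<partial>lborel) \<le> q"
    and B[measurable]: "B \<in> sets Pr" and Bpi: "emeasure Pr B = ennreal \<pi>" and pi: "0 < \<pi>"
    and Bpos: "\<And>p x. p \<in> B \<Longrightarrow> 0 < g0 x \<Longrightarrow> 0 < g p x"
    and chi: "\<And>p. p \<in> B \<Longrightarrow> (\<integral>\<^sup>+ x. ennreal ((g0 x)\<^sup>2 / g p x) \<partial>lborel) \<le> r"
    and d: "0 < d"
  shows "(\<integral>\<^sup>+ X. (\<integral>\<^sup>+ p. indicator A p * (\<Prod>i<n. ennreal (g p (X i))) \<partial>Pr)
              / (\<integral>\<^sup>+ p. (\<Prod>i<n. ennreal (g p (X i))) \<partial>Pr) \<partial>(PiM {..<n} (\<lambda>_. density lborel g0)))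
     \<le> of_nat (card C) * (q ^ n + q ^ n / ennreal d) + ennreal (4 * d / \<pi>) * r ^ n"
proof -
  interpret Pr: prob_space Pr by fact
  interpret P0: prob_space "density lborel g0"
    by (rule prob_spaceI) (simp add: emeasure_density g01)
  interpret product_prob_space "\<lambda>_::nat. density lborel g0" "{..<n}" ..
  let ?M = "PiM {..<n} (\<lambda>_. density lborel g0)"
  interpret PX: prob_space ?M by (rule prob_space_PiM) (rule P0.prob_space_axioms)
  interpret pair: pair_sigma_finite Pr ?M ..
  define L where "L p X = (\<Prod>i<n. g p (X i))" for p X
  define c where "c X = (\<Prod>i<n. g0 (X i))" for X
  define W where "W j X = (\<Prod>i<n. F j (X i))" for j X
  have L_ge: "0 \<le> L p X" for p X by (simp add: L_def g prod_nonneg)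
  have W_gt: "j \<in> C \<Longrightarrow> 0 < W j X" for j X by (simp add: W_def F prod_pos)
  have comp: "(\<lambda>q. snd q i) \<in> borel_measurable (Pr \<Otimes>\<^sub>M ?M)" if "i < n" for i
    using measurable_compose[OF measurable_snd measurable_component_singleton[of i "{..<n}" "\<lambda>_. density lborel g0"], of Pr]
      that by simp
  have comp': "(\<lambda>X. X i) \<in> borel_measurable ?M" if "i < n" for i
    using measurable_component_singleton[of i "{..<n}" "\<lambda>_. density lborel g0"] that by simp
  have mgi: "(\<lambda>q. g (fst q) (snd q i)) \<in> borel_measurable (Pr \<Otimes>\<^sub>M ?M)" if "i < n" for i
    using measurable_compose[OF measurable_Pair[OF measurable_fst comp[OF that]] mg]
    by simp
  have mL: "(\<lambda>q. L (fst q) (snd q)) \<in> borel_measurable (Pr \<Otimes>\<^sub>M ?M)"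
    unfolding L_def by (intro borel_measurable_prod mgi) auto
  have mc[measurable]: "c \<in> borel_measurable ?M"
    unfolding c_def[abs_def]
    by (intro borel_measurable_prod measurable_compose[OF comp' mg0]) auto
  have mW: "W j \<in> borel_measurable ?M" if "j \<in> C" for j
    unfolding W_def[abs_def]
    by (intro borel_measurable_prod measurable_compose[OF comp' mF[OF that]]) auto
  have mL1: "(\<lambda>p. L p X) \<in> borel_measurable Pr" for X
    unfolding L_def using measurable_compose[OF measurable_Pair2' mg]
    by (intro borel_measurable_prod) auto
  have prodL: "(\<Prod>i<n. ennreal (g p (X i))) = ennreal (L p X)" for p X
    by (simp add: L_def prod_ennreal g)
  define D where "D X = (\<integral>\<^sup>+ p. ennreal (L p X) \<partial>Pr)" for X
  define R where "R X = (\<Sum>j\<in>C. ennreal (W j X) + (\<integral>\<^sup>+ p. indicator (S j) p * ennreal (L p X / (c X * W j X)) \<partial>Pr) / ennreal d)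
     + ennreal (4 * d / \<pi>\<^sup>2) * (\<integral>\<^sup>+ p. indicator B p * ennreal (c X / L p X) \<partial>Pr)" for X
  have c_pos: "AE X in ?M. 0 < c X"
  proof -
    have "AE x in density lborel g0. 0 < g0 x"
      using g0 by (subst AE_density) (auto simp: less_le)
    then have "AE X in ?M. 0 < g0 (X i)" if "i < n" for i
      using AE_component[of i "\<lambda>x. 0 < g0 x"] that by auto
    then have "AE X in ?M. \<forall>i\<in>{..<n}. 0 < g0 (X i)"
      by (intro AE_finite_allI) auto
    then show ?thesis by eventually_elim (auto simp: c_def intro!: prod_pos)
  qed
  have point: "(\<integral>\<^sup>+ p. indicator A p * ennreal (L p X) \<partial>Pr) / D X \<le> R X" if cX: "0 < c X" "\<forall>i<n. 0 < g0 (X i)" for X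
  proof (cases "D X < ennreal (d * c X)")
    case True
    \<comment> \<open>With this \<open>t\<close> the first integral below is at most
      \<open>d / t = \<pi> / 2\<close>, so at least half of the mass of \<open>B\<close> must be
      carried by the inverse likelihood ratio.\<close>
    define t where "t = 2 * d / \<pi>"
    have t: "0 < t" using d pi by (simp add: t_def)
    have "ennreal \<pi> = (\<integral>\<^sup>+ p. indicator B p \<partial>Pr)" by (simp add: Bpi)
    also have "\<dots> \<le> (\<integral>\<^sup>+ p. ennreal (1 / (t * c X)) * ennreal (L p X) + ennreal t * (indicator B p * ennreal (c X / L p X)) \<partial>Pr)"
    proof (rule nn_integral_mono)
      fix p
      show "indicator B p \<le> ennreal (1 / (t * c X)) * ennreal (L p X) + ennreal t * (indicator B p * ennreal (c X / L p X))"
      proof (cases "p \<in> B")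
        case True
        then have Lp: "0 < L p X" unfolding L_def using Bpos cX by (intro prod_pos) auto
        \<comment> \<open>One of the two terms alone reaches \<open>1\<close>, according to whether
          the likelihood ratio exceeds \<open>t\<close>.\<close>
        have "1 \<le> L p X / (t * c X) + t * (c X / L p X)"
        proof (cases "t * c X \<le> L p X")
          case True
          then have "1 \<le> L p X / (t * c X)" using t cX by simp
          then show ?thesis using t cX Lp by (simp add: add_increasing2)
        next
          case False
          then have "1 \<le> t * c X / L p X" using Lp by simp
          then show ?thesis using t cX Lp by (simp add: add_increasing)
        qed
        then have "ennreal 1 \<le> ennreal (L p X / (t * c X) + t * (c X / L p X))" by (rule ennreal_leI)
        then show ?thesis using True t cX Lp by (simp add: ennreal_plus ennreal_mult[symmetric] flip: ennreal_1)
      qed simp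
    qed
    also have "\<dots> = ennreal (1 / (t * c X)) * D X + ennreal t * (\<integral>\<^sup>+ p. indicator B p * ennreal (c X / L p X) \<partial>Pr)"
      unfolding D_def using mL1[of X] by (subst nn_integral_add) (auto simp: nn_integral_cmult)
    also have "\<dots> \<le> ennreal (1 / (t * c X)) * ennreal (d * c X) + ennreal t * (\<integral>\<^sup>+ p. indicator B p * ennreal (c X / L p X) \<partial>Pr)"
      using True by (intro add_mono mult_left_mono) auto
    also have "ennreal (1 / (t * c X)) * ennreal (d * c X) = ennreal (\<pi> / 2)"
      using d pi cX by (simp add: ennreal_mult[symmetric] t_def)
    finally have 1: "ennreal \<pi> \<le> ennreal (\<pi> / 2) + ennreal t * (\<integral>\<^sup>+ p. indicator B p * ennreal (c X / L p X) \<partial>Pr)" (is "_ \<le> _ + _ * ?I") .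
    have "1 \<le> ennreal (4 * d / \<pi>\<^sup>2) * ?I"
    proof (cases ?I)
      case (real y)
      then have "ennreal \<pi> \<le> ennreal (\<pi> / 2 + t * y)"
        using 1 t pi by (simp add: ennreal_plus ennreal_mult)
      moreover have "0 \<le> \<pi> / 2 + t * y" using pi t real by simp
      ultimately have "\<pi> \<le> \<pi> / 2 + t * y" by (simp only: ennreal_le_iff)
      then have "1 \<le> 4 * d / \<pi>\<^sup>2 * y" using pi d unfolding t_def
        by (simp add: field_simps power2_eq_square)
      then show ?thesis using real d pi by (simp add: ennreal_mult[symmetric])
    next
      case top
      then show ?thesis using d pi by (simp add: ennreal_mult_top)
    qed
    moreover have "(\<integral>\<^sup>+ p. indicator A p * ennreal (L p X) \<partial>Pr) / D X \<le> 1"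
    proof -
      have "(\<integral>\<^sup>+ p. indicator A p * ennreal (L p X) \<partial>Pr) \<le> D X"
        unfolding D_def by (intro nn_integral_mono) (auto simp: indicator_def)
      then show ?thesis
        by (rule ennreal_divide_le_1)
    qed
    ultimately show ?thesis unfolding R_def by (meson add_increasing order_trans zero_le)
  next
    case False
    have N: "(\<integral>\<^sup>+ p. indicator A p * ennreal (L p X) \<partial>Pr) \<le> (\<Sum>j\<in>C. \<integral>\<^sup>+ p. indicator (S j) p * ennreal (L p X) \<partial>Pr)"
    proof -
      have "(\<integral>\<^sup>+ p. indicator A p * ennreal (L p X) \<partial>Pr) \<le> (\<integral>\<^sup>+ p. (\<Sum>j\<in>C. indicator (S j) p * ennreal (L p X)) \<partial>Pr)"
      proof (rule nn_integral_mono_AE, use cover in eventually_elim)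
        case (elim p)
        show ?case
        proof (cases "p \<in> A")
          case True
          then obtain j where j: "j \<in> C" "p \<in> S j" using elim by auto
          then have "indicator A p * ennreal (L p X) \<le> indicator (S j) p * ennreal (L p X)" using True by simp
          also have "\<dots> \<le> (\<Sum>j\<in>C. indicator (S j) p * ennreal (L p X))"
            using j C by (intro member_le_sum) auto
          finally show ?thesis .
        qed simp
      qed
      also have "\<dots> = (\<Sum>j\<in>C. \<integral>\<^sup>+ p. indicator (S j) p * ennreal (L p X) \<partial>Pr)"
        using mL1[of X] by (intro nn_integral_sum) auto
      finally show ?thesis .
    qed
    have dc: "0 < d * c X" using d cX by simp
    have D1: "a / D X \<le> a / ennreal (d * c X)" for a
    proof -
      have "inverse (D X) \<le> inverse (ennreal (d * c X))"
      proof (cases "D X")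
        case (real y)
        then have "d * c X \<le> y" using False dc by (simp add: ennreal_less_iff not_less)
        then have "inverse y \<le> inverse (d * c X)" using dc by (rule le_imp_inverse_le)
        then show ?thesis using real dc \<open>d * c X \<le> y\<close>
          by (simp only: inverse_ennreal order_less_le_trans[OF dc] ennreal_leI)
      qed simp
      then show ?thesis unfolding divide_ennreal_def by (rule mult_left_mono) simp
    qed
    have each: "(\<integral>\<^sup>+ p. indicator (S j) p * ennreal (L p X) \<partial>Pr) / D X
       \<le> ennreal (W j X) + (\<integral>\<^sup>+ p. indicator (S j) p * ennreal (L p X / (c X * W j X)) \<partial>Pr) / ennreal d" (is "?N / _ \<le> _")
      if j: "j \<in> C" for j
    proof -
      have "?N \<le> D X" unfolding D_def by (intro nn_integral_mono) (auto simp: indicator_def)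
      then have "?N / D X \<le> 1" by (rule ennreal_divide_le_1)
      then have "?N / D X \<le> min 1 (?N / ennreal (d * c X))" using D1 by simp
      also have "\<dots> \<le> ennreal (W j X) + ?N / ennreal (d * c X * W j X)"
        using W_gt[OF j, of X] dc by (rule min_one_divide_le_add)
      also have "?N / ennreal (d * c X * W j X) = (\<integral>\<^sup>+ p. indicator (S j) p * ennreal (L p X / (c X * W j X)) \<partial>Pr) / ennreal d"
      proof -
        have "(\<integral>\<^sup>+ p. indicator (S j) p * ennreal (L p X / (c X * W j X)) \<partial>Pr)
            = (\<integral>\<^sup>+ p. ennreal (1 / (c X * W j X)) * (indicator (S j) p * ennreal (L p X)) \<partial>Pr)"
          using W_gt[OF j, of X] cX L_ge
          by (intro nn_integral_cong) (auto simp: indicator_def ennreal_mult[symmetric])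
        also have "\<dots> = ennreal (1 / (c X * W j X)) * ?N"
          using mL1[of X] j by (intro nn_integral_cmult) auto
        finally have E: "(\<integral>\<^sup>+ p. indicator (S j) p * ennreal (L p X / (c X * W j X)) \<partial>Pr)
            = ennreal (1 / (c X * W j X)) * ?N" .
        have "0 < d * c X * W j X" using W_gt[OF j, of X] cX d by simp
        then have "inverse (ennreal (d * c X * W j X)) = ennreal (1 / (c X * W j X)) * inverse (ennreal d)"
          using W_gt[OF j, of X] cX d by (simp add: inverse_ennreal ennreal_mult[symmetric] field_simps)
        then show ?thesis unfolding E divide_ennreal_def by (simp add: mult_ac)
      qed
      finally show ?thesis .
    qed
    have "(\<integral>\<^sup>+ p. indicator A p * ennreal (L p X) \<partial>Pr) / D X \<le> (\<Sum>j\<in>C. \<integral>\<^sup>+ p. indicator (S j) p * ennreal (L p X) \<partial>Pr) / D X"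
      using N by (rule divide_right_mono_ennreal)
    also have "\<dots> = (\<Sum>j\<in>C. (\<integral>\<^sup>+ p. indicator (S j) p * ennreal (L p X) \<partial>Pr) / D X)"
      by (simp add: divide_ennreal_def sum_distrib_right)
    also have "\<dots> \<le> (\<Sum>j\<in>C. ennreal (W j X) + (\<integral>\<^sup>+ p. indicator (S j) p * ennreal (L p X / (c X * W j X)) \<partial>Pr) / ennreal d)"
      by (rule sum_mono) (rule each)
    also have "\<dots> \<le> R X" unfolding R_def by simp
    finally show ?thesis .
  qed
  have all_pos: "AE X in ?M. 0 < c X \<and> (\<forall>i<n. 0 < g0 (X i))"
    using c_pos by eventually_elim (auto simp: c_def less_le g0 prod_nonneg)
  have mLc: "(\<lambda>(p, X). indicator (S j) p * ennreal (L p X / (c X * W j X))) \<in> borel_measurable (Pr \<Otimes>\<^sub>M ?M)" if "j \<in> C" for j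
    using mL mW[OF that] that unfolding split_beta' by measurable
  have mcL: "(\<lambda>(p, X). indicator B p * ennreal (c X / L p X)) \<in> borel_measurable (Pr \<Otimes>\<^sub>M ?M)"
    using mL unfolding split_beta' by measurable
  have mint: "(\<lambda>X. \<integral>\<^sup>+ p. h p X \<partial>Pr) \<in> borel_measurable ?M"
    if "(\<lambda>(p, X). h p X) \<in> borel_measurable (Pr \<Otimes>\<^sub>M ?M)" for h :: "'p \<Rightarrow> _ \<Rightarrow> ennreal"
    using Pr.borel_measurable_nn_integral[of "\<lambda>X p. h p X" ?M] measurable_pair_swap[OF that]
    by (simp add: split_beta')
  have I1: "(\<integral>\<^sup>+ X. ennreal (W j X) \<partial>?M) \<le> q ^ n" if "j \<in> C" for j
    unfolding W_def using F[OF that] mF[OF that] test0[OF that] g0 g01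
    by (intro nn_integral_iid_prod) (auto simp: less_imp_le)
  have I2: "(\<integral>\<^sup>+ X. (\<integral>\<^sup>+ p. indicator (S j) p * ennreal (L p X / (c X * W j X)) \<partial>Pr) \<partial>?M) \<le> q ^ n" if j: "j \<in> C" for j
  proof -
    have "(\<integral>\<^sup>+ X. (\<integral>\<^sup>+ p. indicator (S j) p * ennreal (L p X / (c X * W j X)) \<partial>Pr) \<partial>?M)
       = (\<integral>\<^sup>+ p. (\<integral>\<^sup>+ X. indicator (S j) p * ennreal (L p X / (c X * W j X)) \<partial>?M) \<partial>Pr)"
      using pair.Fubini'[OF mLc[OF j]] by simp
    also have "\<dots> \<le> (\<integral>\<^sup>+ p. q ^ n \<partial>Pr)"
    proof (rule nn_integral_mono)
      fix p assume p: "p \<in> space Pr"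
      have [measurable]: "g p \<in> borel_measurable borel"
        using measurable_compose[OF measurable_Pair1'[OF p] mg] by simp
      note [measurable] = mF[OF j]
      show "(\<integral>\<^sup>+ X. indicator (S j) p * ennreal (L p X / (c X * W j X)) \<partial>?M) \<le> q ^ n"
      proof (cases "p \<in> S j")
        case True
        have "L p X / (c X * W j X) = (\<Prod>i<n. g p (X i) / (g0 (X i) * F j (X i)))" for X
          by (simp add: L_def c_def W_def prod_dividef prod.distrib)
        moreover have "(\<integral>\<^sup>+ X. ennreal (\<Prod>i<n. g p (X i) / (g0 (X i) * F j (X i))) \<partial>?M) \<le> q ^ n"
        proof (rule nn_integral_iid_prod)
          show "(\<integral>\<^sup>+ x. ennreal (g0 x * (g p x / (g0 x * F j x))) \<partial>lborel) \<le> q"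
            using g F[OF j] by (intro order_trans[OF nn_integral_mono test1[OF j True]] ennreal_leI)
              (auto simp: less_imp_le)
        qed (use g g0 g01 F[OF j] in \<open>auto simp: less_imp_le\<close>)
        ultimately show ?thesis using True by simp
      qed simp
    qed
    also have "\<dots> = q ^ n" by (simp add: Pr.emeasure_space_1)
    finally show ?thesis .
  qed
  have I3: "(\<integral>\<^sup>+ X. (\<integral>\<^sup>+ p. indicator B p * ennreal (c X / L p X) \<partial>Pr) \<partial>?M) \<le> ennreal \<pi> * r ^ n"
  proof -
    have "(\<integral>\<^sup>+ X. (\<integral>\<^sup>+ p. indicator B p * ennreal (c X / L p X) \<partial>Pr) \<partial>?M)
       = (\<integral>\<^sup>+ p. (\<integral>\<^sup>+ X. indicator B p * ennreal (c X / L p X) \<partial>?M) \<partial>Pr)"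
      using pair.Fubini'[OF mcL] by simp
    also have "\<dots> \<le> (\<integral>\<^sup>+ p. r ^ n * indicator B p \<partial>Pr)"
    proof (rule nn_integral_mono)
      fix p assume p: "p \<in> space Pr"
      have [measurable]: "g p \<in> borel_measurable borel"
        using measurable_compose[OF measurable_Pair1'[OF p] mg] by simp
      show "(\<integral>\<^sup>+ X. indicator B p * ennreal (c X / L p X) \<partial>?M) \<le> r ^ n * indicator B p"
      proof (cases "p \<in> B")
        case True
        have "c X / L p X = (\<Prod>i<n. g0 (X i) / g p (X i))" for X
          by (simp add: L_def c_def prod_dividef)
        moreover have "(\<integral>\<^sup>+ X. ennreal (\<Prod>i<n. g0 (X i) / g p (X i)) \<partial>?M) \<le> r ^ n"
          using chi[OF True] g g0 g01
          by (intro nn_integral_iid_prod) (auto simp: power2_eq_square)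
        ultimately show ?thesis using True by simp
      qed simp
    qed
    also have "\<dots> = ennreal \<pi> * r ^ n" by (subst nn_integral_cmult_indicator) (auto simp: Bpi mult.commute)
    finally show ?thesis .
  qed
  have "(\<integral>\<^sup>+ X. (\<integral>\<^sup>+ p. indicator A p * (\<Prod>i<n. ennreal (g p (X i))) \<partial>Pr)
              / (\<integral>\<^sup>+ p. (\<Prod>i<n. ennreal (g p (X i))) \<partial>Pr) \<partial>?M) \<le> (\<integral>\<^sup>+ X. R X \<partial>?M)"
    unfolding prodL D_def[symmetric]
    by (rule nn_integral_mono_AE, use all_pos in eventually_elim) (auto intro: point)
  also have "\<dots> = (\<Sum>j\<in>C. (\<integral>\<^sup>+ X. ennreal (W j X) \<partial>?M) + (\<integral>\<^sup>+ X. (\<integral>\<^sup>+ p. indicator (S j) p * ennreal (L p X / (c X * W j X)) \<partial>Pr) \<partial>?M) / ennreal d)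
     + ennreal (4 * d / \<pi>\<^sup>2) * (\<integral>\<^sup>+ X. (\<integral>\<^sup>+ p. indicator B p * ennreal (c X / L p X) \<partial>Pr) \<partial>?M)"
    unfolding R_def using mint[OF mcL] mint[OF mLc] mW
    by (subst nn_integral_add) (auto simp: nn_integral_add nn_integral_sum nn_integral_cmult nn_integral_divide)
  also have "\<dots> \<le> (\<Sum>j\<in>C. q ^ n + q ^ n / ennreal d) + ennreal (4 * d / \<pi>\<^sup>2) * (ennreal \<pi> * r ^ n)"
    by (intro add_mono sum_mono mult_left_mono divide_right_mono_ennreal I1 I2 I3) auto
  also have "ennreal (4 * d / \<pi>\<^sup>2) * (ennreal \<pi> * r ^ n) = ennreal (4 * d / \<pi>) * r ^ n"
    using d pi by (simp add: mult.assoc[symmetric] ennreal_mult[symmetric] power2_eq_square)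
  finally show ?thesis by simp
qed

section \<open>Exponential tests\<close>

text \<open>For negative \<open>y\<close> use \<open>1 - y \<le> exp (- y)\<close> together with
  \<open>(1 + y + y^2) (1 - y) = 1 - y^3 \<ge> 1\<close>.\<close>

lemma exp_le_quadratic:
  fixes y :: real
  assumes "\<bar>y\<bar> \<le> 1"
  shows "exp y \<le> 1 + y + y\<^sup>2"
proof (cases "0 \<le> y")
  case True then show ?thesis using exp_bound[of y] assms by simp
next
  case False
  have "1 \<le> (1 + y + y\<^sup>2) * (1 - y)"
  proof -
    have "(1 + y + y\<^sup>2) * (1 - y) = 1 - y ^ 3" by (simp add: algebra_simps power2_eq_square power3_eq_cube)
    moreover have "y ^ 3 \<le> 0" using False by (simp add: power3_eq_cube mult_nonneg_nonpos)
    ultimately show ?thesis by simp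
  qed
  also have "\<dots> \<le> (1 + y + y\<^sup>2) * exp (- y)"
  proof (rule mult_left_mono)
    show "1 - y \<le> exp (- y)" using exp_ge_add_one_self[of "- y"] by simp
    have "0 \<le> (1 + y)\<^sup>2 + y\<^sup>2 + 1" by (simp add: add_nonneg_nonneg)
    then show "0 \<le> 1 + y + y\<^sup>2" by (simp add: power2_eq_square algebra_simps)
  qed
  finally show ?thesis by (simp add: exp_minus divide_simps)
qed

lemma sqrt_diff_sq_le_chi:
  assumes "0 \<le> x" "0 < (y::real)"
  shows "(sqrt x - sqrt y)\<^sup>2 \<le> (x - y)\<^sup>2 / y"
proof -
  have "(x - y)\<^sup>2 = (sqrt x - sqrt y)\<^sup>2 * (sqrt x + sqrt y)\<^sup>2"
    using assms by (simp add: power_mult_distrib[symmetric] square_diff_square_factored[symmetric] algebra_simps flip: power2_eq_square)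
  moreover have "y \<le> (sqrt x + sqrt y)\<^sup>2"
    using assms by (simp add: power2_sum)
  ultimately have "(sqrt x - sqrt y)\<^sup>2 * y \<le> (x - y)\<^sup>2" by (simp add: mult_left_mono)
  then show ?thesis using assms by (simp add: pos_le_divide_eq)
qed

lemma sqrt_diff_sq_le_add:
  assumes "0 \<le> x" "0 \<le> (y::real)"
  shows "(sqrt x - sqrt y)\<^sup>2 \<le> x + y"
  using assms by (simp add: power2_diff)

text \<open>The terms with \<open>s\<close> and \<open>s^2\<close> form the exponent produced by the
  exponential moments of \<open>s * (u - g0)\<close> under \<open>g0\<close> and of its negative
  under \<open>g\<close>. The linear term gains \<open>s / 2\<close> times
  \<open>(u - g0)^2\<close>; the relation \<open>s * K = 1 / 16\<close> keeps the quadratic and the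
  Hellinger term below that gain, so only the approximation error \<open>(g - u)^2\<close>
  survives.\<close>

lemma test_pointwise_right:
  fixes g g0 u b G K :: real
  assumes "0 < b" "b \<le> 1" "b \<le> g0" "g0 \<le> G" "2 * G \<le> K" "1 \<le> K" "0 \<le> u" "u \<le> K" "0 \<le> g" "g \<le> K"
    and s: "s = 1 / (16 * K)"
  shows "s * ((g0 - g) * (u - g0)) + s\<^sup>2 * ((g0 + g) * (u - g0)\<^sup>2) + s * b / 16 * (sqrt g - sqrt g0)\<^sup>2
     \<le> (g - u)\<^sup>2"
proof -
  have sp: "0 < s" "s \<le> 1 / 16" "s * K = 1 / 16"
    unfolding s using assms by (auto simp: field_simps)
  define D E where "D = (u - g0)\<^sup>2" and "E = (g - u)\<^sup>2"
  have D: "0 \<le> D" "0 \<le> E" by (auto simp: D_def E_def)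
  have 1: "(g0 - g) * (u - g0) \<le> - D / 2 + E / 2"
  proof -
    \<comment> \<open>Polarisation, since \<open>g - g0\<close> is the sum of \<open>g - u\<close>
      and \<open>u - g0\<close>.\<close>
    have "2 * ((g0 - g) * (u - g0)) = E - D - (g - g0)\<^sup>2"
      by (simp add: D_def E_def power2_eq_square algebra_simps)
    then show ?thesis using zero_le_power2[of "g - g0"] by linarith
  qed
  have "(g0 + g) * D \<le> (2 * K) * D" using assms D by (intro mult_right_mono) auto
  then have 2: "s\<^sup>2 * ((g0 + g) * D) \<le> s\<^sup>2 * ((2 * K) * D)" by (intro mult_left_mono) auto
  have D8: "s\<^sup>2 * ((2 * K) * D) = s * D / 8" 
  proof -
    have "s\<^sup>2 * ((2 * K) * D) = 2 * (s * K) * (s * D)" by (simp add: power2_eq_square)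
    then show ?thesis unfolding sp(3) by simp
  qed
  have "(sqrt g - sqrt g0)\<^sup>2 \<le> (g - g0)\<^sup>2 / g0" using assms by (intro sqrt_diff_sq_le_chi) auto
  also have "\<dots> \<le> (g - g0)\<^sup>2 / b" using assms by (intro divide_left_mono) auto
  also have "(g - g0)\<^sup>2 \<le> 2 * D + 2 * E"
  proof -
    have "0 \<le> ((g - u) - (u - g0))\<^sup>2" by simp
    then show ?thesis by (simp add: D_def E_def power2_eq_square algebra_simps)
  qed
  finally have 3: "(sqrt g - sqrt g0)\<^sup>2 \<le> (2 * D + 2 * E) / b" using assms by (simp add: divide_right_mono)
  then have "b * (sqrt g - sqrt g0)\<^sup>2 \<le> 2 * D + 2 * E" using assms by (simp add: field_simps)
  then have "s / 16 * (b * (sqrt g - sqrt g0)\<^sup>2) \<le> s / 16 * (2 * D + 2 * E)" using sp by (intro mult_left_mono) auto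
  then have 3: "s * b / 16 * (sqrt g - sqrt g0)\<^sup>2 \<le> s * D / 8 + s * E / 8" by (simp add: algebra_simps)
  have "s * ((g0 - g) * (u - g0)) \<le> s * (- D / 2 + E / 2)" using 1 sp by (intro mult_left_mono) auto
  then have "s * ((g0 - g) * (u - g0)) + s\<^sup>2 * ((g0 + g) * D) + s * b / 16 * (sqrt g - sqrt g0)\<^sup>2
     \<le> - (s * D / 4) + s * E * 5 / 8" 
  proof -
    have "s * (- D / 2 + E / 2) = - (s * D / 2) + s * E / 2" by (simp add: algebra_simps)
    then show ?thesis
      using 2 D8 3 \<open>s * ((g0 - g) * (u - g0)) \<le> s * (- D / 2 + E / 2)\<close> by linarith
  qed
  also have "\<dots> \<le> s * E" using D sp by (simp add: algebra_simps)
  also have "\<dots> \<le> 1 * E" using D sp by (intro mult_right_mono) auto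
  finally show ?thesis by (simp add: D_def E_def)
qed

text \<open>Here \<open>u = K\<close>. Where \<open>g \<ge> K\<close> the linear term is at most
  \<open>- s * g * K / 4\<close>, which grows with \<open>g\<close> and so beats the quadratic and
  Hellinger terms however large \<open>g\<close> is. Where \<open>g < K\<close> the crude bound
  \<open>K^2\<close> is enough, since this occurs only on a short strip.\<close>

lemma test_pointwise_left:
  fixes g g0 b G K :: real
  assumes "0 < b" "b \<le> 1" "b \<le> g0" "g0 \<le> G" "2 * G \<le> K" "1 \<le> K" "0 \<le> g"
    and s: "s = 1 / (16 * K)"
  shows "s * ((g0 - g) * (K - g0)) + s\<^sup>2 * ((g0 + g) * (K - g0)\<^sup>2) + s * b / 16 * (sqrt g - sqrt g0)\<^sup>2
     \<le> (if K \<le> g then 0 else K\<^sup>2)"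
proof -
  have sp: "0 < s" "s \<le> 1 / 16" "s * K = 1 / 16"
    unfolding s using assms by (auto simp: field_simps)
  have Kg: "K / 2 \<le> K - g0" "0 \<le> K - g0" "K - g0 \<le> K" using assms by auto
  have "(K - g0)\<^sup>2 \<le> K\<^sup>2" using Kg by (intro power_mono) auto
  then have "s\<^sup>2 * ((g0 + g) * (K - g0)\<^sup>2) \<le> s\<^sup>2 * ((g0 + g) * K\<^sup>2)"
    using assms by (intro mult_left_mono) auto
  also have "\<dots> = s * (s * K) * (g0 + g) * K" by (simp add: power2_eq_square)
  also have "\<dots> = s * ((g0 + g) * K / 16)" unfolding sp(3) by simp
  finally have 2: "s\<^sup>2 * ((g0 + g) * (K - g0)\<^sup>2) \<le> s * ((g0 + g) * K / 16)" .
  have h: "b * (sqrt g - sqrt g0)\<^sup>2 \<le> g + g0"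
  proof -
    have "b * (sqrt g - sqrt g0)\<^sup>2 \<le> 1 * (sqrt g - sqrt g0)\<^sup>2" using assms by (intro mult_right_mono) auto
    also have "\<dots> \<le> g + g0" using assms by (auto simp: sqrt_diff_sq_le_add)
    finally show ?thesis .
  qed
  have h': "b * (sqrt g - sqrt g0)\<^sup>2 \<le> g" if "K \<le> g"
  proof -
    have "b * (sqrt g - sqrt g0)\<^sup>2 \<le> 1 * (sqrt g - sqrt g0)\<^sup>2" using assms by (intro mult_right_mono) auto
    also have "\<dots> \<le> (sqrt g)\<^sup>2" unfolding mult_1 using assms that by (intro power_mono) auto
    finally show ?thesis using assms by simp
  qed
  show ?thesis
  proof (cases "K \<le> g")
    case True
    then have "g / 2 * (K / 2) \<le> (g - g0) * (K - g0)" using assms Kg by (intro mult_mono) auto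
    then have 1: "(g0 - g) * (K - g0) \<le> - (g * K / 4)" by (simp add: algebra_simps)
    have "g0 \<le> g" using True assms by auto
    then have "(g0 + g) * K \<le> (2 * g) * K" using assms by (intro mult_right_mono) auto
    then have 3: "(g0 + g) * K / 16 \<le> g * K / 8" by (simp add: algebra_simps)
    have "s * ((g0 - g) * (K - g0)) + s\<^sup>2 * ((g0 + g) * (K - g0)\<^sup>2) + s * b / 16 * (sqrt g - sqrt g0)\<^sup>2
      \<le> s * (- (g * K / 4)) + s * (g * K / 8) + s / 16 * g"
    proof (intro add_mono)
      show "s * ((g0 - g) * (K - g0)) \<le> s * (- (g * K / 4))" using 1 sp by (intro mult_left_mono) auto
      show "s\<^sup>2 * ((g0 + g) * (K - g0)\<^sup>2) \<le> s * (g * K / 8)" using 2 3 sp by (meson mult_left_mono order_trans less_imp_le)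
      have "s / 16 * (b * (sqrt g - sqrt g0)\<^sup>2) \<le> s / 16 * g" using h'[OF True] sp by (intro mult_left_mono) auto
      then show "s * b / 16 * (sqrt g - sqrt g0)\<^sup>2 \<le> s / 16 * g" by (simp add: mult.assoc)
    qed
    also have "\<dots> = s * (g / 16 - g * K / 8)" by (simp add: algebra_simps)
    also have "\<dots> \<le> 0"
    proof -
      have "g * 1 \<le> g * K" using assms by (intro mult_left_mono) auto
      then have "g / 16 - g * K / 8 \<le> 0" using assms by simp
      then show ?thesis using sp by (simp add: mult_nonneg_nonpos)
    qed
    finally show ?thesis using True by simp
  next
    case False
    have 1: "(g0 - g) * (K - g0) \<le> G * K - g * K / 2"
    proof -
      have "g0 * (K - g0) \<le> G * K" using assms Kg by (intro mult_mono) auto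
      moreover have "g * (K / 2) \<le> g * (K - g0)" using assms Kg by (intro mult_left_mono) auto
      ultimately show ?thesis by (simp add: algebra_simps)
    qed
    have "s * ((g0 - g) * (K - g0)) + s\<^sup>2 * ((g0 + g) * (K - g0)\<^sup>2) + s * b / 16 * (sqrt g - sqrt g0)\<^sup>2
      \<le> s * (G * K - g * K / 2) + s * ((g0 + g) * K / 16) + s / 16 * (g + g0)"
    proof (intro add_mono)
      show "s * ((g0 - g) * (K - g0)) \<le> s * (G * K - g * K / 2)" using 1 sp by (intro mult_left_mono) auto
      show "s\<^sup>2 * ((g0 + g) * (K - g0)\<^sup>2) \<le> s * ((g0 + g) * K / 16)" by (rule 2)
      have "s / 16 * (b * (sqrt g - sqrt g0)\<^sup>2) \<le> s / 16 * (g + g0)" using h sp by (intro mult_left_mono) auto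
      then show "s * b / 16 * (sqrt g - sqrt g0)\<^sup>2 \<le> s / 16 * (g + g0)" by (simp add: mult.assoc)
    qed
    also have "\<dots> = s * (G * K + g0 * K / 16 + g0 / 16 - (g * K * 7 / 16 - g / 16))" by (simp add: field_simps)
    also have "\<dots> \<le> s * (K * K / 2 + K * K / 32 + K * K / 32 - 0)"
    proof -
      have "g * 1 \<le> g * K" using assms by (intro mult_left_mono) auto
      then have "0 \<le> g * K * 7 / 16 - g / 16" using assms by simp
      moreover have "G * K \<le> (K / 2) * K" "g0 * K \<le> (K / 2) * K" using assms by (intro mult_right_mono; simp)+
      moreover have "K * 1 \<le> K * K" using assms by (intro mult_left_mono) auto
      then have "g0 \<le> K * K / 2" using assms by linarith
      ultimately show ?thesis using sp(1) by (intro mult_left_mono) linarith+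
    qed
    also have "\<dots> \<le> 1 * K\<^sup>2" unfolding power2_eq_square
      using sp mult_right_mono[of s 1 "K * K"] assms by (simp add: algebra_simps)
    finally show ?thesis using False by simp
  qed
qed

lemma integrable_bounded_mult:
  fixes f h :: "real \<Rightarrow> real"
  assumes "integrable M f" "h \<in> borel_measurable M" "\<And>x. \<bar>h x\<bar> \<le> c"
  shows "integrable M (\<lambda>x. f x * h x)"
proof (rule Bochner_Integration.integrable_bound)
  show "integrable M (\<lambda>x. c * f x)" using assms by simp
  show "AE x in M. norm (f x * h x) \<le> norm (c * f x)"
  proof (rule AE_I2)
    fix x
    have "\<bar>f x\<bar> * \<bar>h x\<bar> \<le> \<bar>f x\<bar> * \<bar>c\<bar>" using assms(3)[of x] by (intro mult_left_mono) auto
    then show "norm (f x * h x) \<le> norm (c * f x)" by (simp add: abs_mult mult.commute)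
  qed
qed (use assms in auto)

lemma integrable_density_function:
  assumes "g \<in> borel_measurable borel" "\<And>x. 0 \<le> g x" "(\<integral>\<^sup>+ x. ennreal (g x) \<partial>lborel) = 1"
  shows "integrable lborel g" "(LINT x|lborel. g x) = 1"
  using assms nn_integral_eq_integrable[of g lborel 1] by auto

lemma hellinger_sq:
  assumes [measurable]: "g \<in> borel_measurable borel" "g0 \<in> borel_measurable borel"
  shows "(hellinger g g0)\<^sup>2 = (LINT x|lborel. (sqrt (g x) - sqrt (g0 x))\<^sup>2)"
  unfolding hellinger_def by (subst integral_eq_nn_integral) auto

lemma integral_exp_le:
  fixes g f :: "real \<Rightarrow> real"
  assumes [measurable]: "g \<in> borel_measurable borel" and g: "\<And>x. 0 \<le> g x" "(\<integral>\<^sup>+ x. ennreal (g x) \<partial>lborel) = 1"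
    and [measurable]: "f \<in> borel_measurable borel" and f: "\<And>x. \<bar>f x\<bar> \<le> 1"
  shows "integrable lborel (\<lambda>x. g x * exp (f x))"
    and "integrable lborel (\<lambda>x. g x * f x + g x * (f x)\<^sup>2)"
    and "(LINT x|lborel. g x * exp (f x)) \<le> exp (LINT x|lborel. g x * f x + g x * (f x)\<^sup>2)"
proof -
  note gi = integrable_density_function[OF assms(1-3)]
  show 1: "integrable lborel (\<lambda>x. g x * exp (f x))"
    by (rule integrable_bounded_mult[OF gi(1), where c="exp 1"]) (use f in \<open>auto simp: abs_le_iff\<close>)
  have 2: "integrable lborel (\<lambda>x. g x * f x)" "integrable lborel (\<lambda>x. g x * (f x)\<^sup>2)"
    by (rule integrable_bounded_mult[OF gi(1), where c=1]; use f in \<open>auto simp: abs_square_le_1\<close>)+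
  then show 3: "integrable lborel (\<lambda>x. g x * f x + g x * (f x)\<^sup>2)" by simp
  have "(LINT x|lborel. g x * exp (f x)) \<le> (LINT x|lborel. g x + (g x * f x + g x * (f x)\<^sup>2))"
  proof (rule integral_mono[OF 1])
    show "integrable lborel (\<lambda>x. g x + (g x * f x + g x * (f x)\<^sup>2))" using gi(1) 3 by (rule Bochner_Integration.integrable_add)
    show "g x * exp (f x) \<le> g x + (g x * f x + g x * (f x)\<^sup>2)" for x
      using mult_left_mono[OF exp_le_quadratic[OF f[of x]] g(1)[of x]] by (simp add: algebra_simps)
  qed
  also have "\<dots> = 1 + (LINT x|lborel. g x * f x + g x * (f x)\<^sup>2)" using gi 3 by simp
  also have "\<dots> \<le> exp (LINT x|lborel. g x * f x + g x * (f x)\<^sup>2)" by (rule exp_ge_add_one_self)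
  finally show "(LINT x|lborel. g x * exp (f x)) \<le> exp (LINT x|lborel. g x * f x + g x * (f x)\<^sup>2)" .
qed

text \<open>The moments under \<open>g0\<close> and \<open>g\<close> have to be multiplied: the
  integrals of \<open>g0 * (u - g0)\<close> and of \<open>g * (u - g0)\<close> have no useful sign,
  but their difference has. The term \<open>K^2 * \<delta>\<close> pays for the strip left of
  \<open>a0\<close> where \<open>u = K\<close> although \<open>g\<close> may be smaller.\<close>

lemma test_product:
  fixes g g0 u :: "real \<Rightarrow> real" and b G K a0 e2 \<delta> :: real
  assumes mg[measurable]: "g \<in> borel_measurable borel" and g: "\<And>x. 0 \<le> g x" "(\<integral>\<^sup>+ x. ennreal (g x) \<partial>lborel) = 1" "\<And>x. x \<notin> {0<..<1} \<Longrightarrow> g x = 0"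
    and mg0[measurable]: "g0 \<in> borel_measurable borel" and g0: "\<And>x. 0 \<le> g0 x" "(\<integral>\<^sup>+ x. ennreal (g0 x) \<partial>lborel) = 1" "\<And>x. x \<notin> {0<..<1} \<Longrightarrow> g0 x = 0"
    and bG: "\<And>x. x \<in> {0<..<1} \<Longrightarrow> b \<le> g0 x \<and> g0 x \<le> G" and K: "0 < b" "b \<le> 1" "2 * G \<le> K" "1 \<le> K"
    and mu[measurable]: "u \<in> borel_measurable borel" and u: "\<And>x. 0 \<le> u x \<and> u x \<le> K"
    and left: "\<And>x. 0 < x \<Longrightarrow> x \<le> a0 \<Longrightarrow> u x = K" and left': "\<And>x. 0 < x \<Longrightarrow> x < a0 - \<delta> \<Longrightarrow> K \<le> g x"
    and right: "\<And>x. a0 < x \<Longrightarrow> g x \<le> K"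
    and e2: "(\<integral>\<^sup>+ x. ennreal ((g x - u x)\<^sup>2) * indicator {a0<..<1} x \<partial>lborel) \<le> ennreal e2" "0 \<le> e2" "0 \<le> \<delta>"
    and s: "s = 1 / (16 * K)"
    and f: "f = (\<lambda>x. if x \<in> {0<..<1} then s * (u x - g0 x) else 0)"
  shows "(LINT x|lborel. g0 x * exp (f x)) * (LINT x|lborel. g x * exp (- f x))
     \<le> exp (- (s * b / 16) * (hellinger g g0)\<^sup>2 + e2 + K\<^sup>2 * \<delta>)"
proof -
  have sp: "0 < s" "s * K = 1 / 16" unfolding s using K by (auto simp: field_simps)
  have [measurable]: "f \<in> borel_measurable borel" unfolding f by measurable
  have f1: "\<bar>f x\<bar> \<le> 1" for x
  proof (cases "x \<in> {0<..<1}")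
    case True
    have "\<bar>u x - g0 x\<bar> \<le> K" using u[of x] bG[OF True] K g0(1)[of x] by linarith
    then have "s * \<bar>u x - g0 x\<bar> \<le> s * K" using sp by (intro mult_left_mono) auto
    then show ?thesis using True sp by (simp add: f abs_mult)
  qed (auto simp: f)
  note I0 = integral_exp_le[OF mg0 g0(1,2) \<open>f \<in> _\<close> f1]
  have I1: "integrable lborel (\<lambda>x. g x * exp (- f x))"
    "integrable lborel (\<lambda>x. g x * (- f x) + g x * (- f x)\<^sup>2)"
    "(LINT x|lborel. g x * exp (- f x)) \<le> exp (LINT x|lborel. g x * (- f x) + g x * (- f x)\<^sup>2)"
    using integral_exp_le[OF mg g(1,2), of "\<lambda>x. - f x"] f1 by auto
  note gi = integrable_density_function[OF mg g(1,2)] and g0i = integrable_density_function[OF mg0 g0(1,2)]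
  let ?R = "\<lambda>x. (g x - u x)\<^sup>2 * indicator {a0<..<1} x"
  let ?S = "\<lambda>x. K\<^sup>2 * indicator {a0 - \<delta>..a0} x"
  let ?h = "\<lambda>x. (sqrt (g x) - sqrt (g0 x))\<^sup>2"
  have Ri: "integrable lborel ?R" and RI: "(LINT x|lborel. ?R x) \<le> e2"
  proof -
    have n: "(\<integral>\<^sup>+ x. ennreal (?R x) \<partial>lborel) \<le> ennreal e2"
      using e2(1) by (simp add: ennreal_mult' ennreal_indicator[symmetric] mult.commute)
    show "integrable lborel ?R"
      by (rule integrableI_bounded) (use n in \<open>auto simp: order_le_less_trans\<close>)
    show "(LINT x|lborel. ?R x) \<le> e2"
      by (subst integral_eq_nn_integral) (use n e2 in \<open>auto intro!: enn2real_leI\<close>)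
  qed
  have Si: "integrable lborel ?S" by (intro integrable_mult_right integrable_real_indicator) (auto simp: emeasure_lborel_Icc_eq)
  have hi: "integrable lborel ?h"
  proof (rule Bochner_Integration.integrable_bound)
    show "integrable lborel (\<lambda>x. g x + g0 x)" using gi g0i by simp
    show "AE x in lborel. norm (?h x) \<le> norm (g x + g0 x)"
      using sqrt_diff_sq_le_add g g0 by (intro AE_I2) auto
  qed simp
  have "(LINT x|lborel. g0 x * exp (f x)) * (LINT x|lborel. g x * exp (- f x))
    \<le> exp (LINT x|lborel. g0 x * f x + g0 x * (f x)\<^sup>2) * exp (LINT x|lborel. g x * (- f x) + g x * (- f x)\<^sup>2)"
    by (intro mult_mono I0 I1 Bochner_Integration.integral_nonneg) (auto simp: g g0)
  also have "\<dots> = exp (LINT x|lborel. (g0 x * f x + g0 x * (f x)\<^sup>2) + (g x * (- f x) + g x * (- f x)\<^sup>2))"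
    using I0(2) I1(2) by (simp add: exp_add[symmetric])
  also have "\<dots> \<le> exp (LINT x|lborel. ?R x + ?S x - s * b / 16 * ?h x)"
  proof (subst exp_le_cancel_iff, rule integral_mono)
    show "integrable lborel (\<lambda>x. (g0 x * f x + g0 x * (f x)\<^sup>2) + (g x * (- f x) + g x * (- f x)\<^sup>2))"
      using I0(2) I1(2) by (rule Bochner_Integration.integrable_add)
    show "integrable lborel (\<lambda>x. ?R x + ?S x - s * b / 16 * ?h x)"
      using Ri Si hi by (intro Bochner_Integration.integrable_diff Bochner_Integration.integrable_add integrable_mult_right) auto
    fix x
    show "(g0 x * f x + g0 x * (f x)\<^sup>2) + (g x * (- f x) + g x * (- f x)\<^sup>2) \<le> ?R x + ?S x - s * b / 16 * ?h x"
    proof (cases "x \<in> {0<..<1}")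
      case False
      then show ?thesis using g(3) g0(3) K by (auto simp: indicator_def)
    next
      case True
      have e: "(g0 x * f x + g0 x * (f x)\<^sup>2) + (g x * (- f x) + g x * (- f x)\<^sup>2)
         = s * ((g0 x - g x) * (u x - g0 x)) + s\<^sup>2 * ((g0 x + g x) * (u x - g0 x)\<^sup>2)"
        using True by (simp add: f power2_eq_square algebra_simps)
      note bx = bG[OF True]
      show ?thesis
      proof (cases "a0 < x")
        case True
        then have "s * ((g0 x - g x) * (u x - g0 x)) + s\<^sup>2 * ((g0 x + g x) * (u x - g0 x)\<^sup>2) + s * b / 16 * ?h x
          \<le> (g x - u x)\<^sup>2"
          using bx u[of x] K right[OF True] g(1)[of x] by (intro test_pointwise_right[OF K(1,2) _ _ K(3,4) _ _ _ _ s]) auto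
        then show ?thesis unfolding e using True \<open>x \<in> {0<..<1}\<close> by (simp add: indicator_def)
      next
        case False
        then have "u x = K" using left \<open>x \<in> {0<..<1}\<close> by auto
        then have "s * ((g0 x - g x) * (u x - g0 x)) + s\<^sup>2 * ((g0 x + g x) * (u x - g0 x)\<^sup>2) + s * b / 16 * ?h x
          \<le> (if K \<le> g x then 0 else K\<^sup>2)"
          using test_pointwise_left[OF K(1,2) _ _ K(3,4) g(1)[of x] s, of "g0 x"] bx by simp
        \<comment> \<open>By \<open>left'\<close>, a value of \<open>g\<close> below
          \<open>K\<close> at \<open>x \<le> a0\<close> forces
          \<open>x \<ge> a0 - \<delta>\<close>.\<close>
        also have "\<dots> \<le> ?S x"
          using left'[of x] False \<open>x \<in> {0<..<1}\<close> by (force simp: indicator_def)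
        finally show ?thesis unfolding e using False by (simp add: indicator_def)
      qed
    qed
  qed
  also have "(LINT x|lborel. ?R x + ?S x - s * b / 16 * ?h x)
     = (LINT x|lborel. ?R x) + K\<^sup>2 * \<delta> - s * b / 16 * (hellinger g g0)\<^sup>2"
  proof -
    have "(LINT x|lborel. ?R x + ?S x - s * b / 16 * ?h x)
        = (LINT x|lborel. ?R x + ?S x) - (LINT x|lborel. s * b / 16 * ?h x)"
      using Ri Si hi by (intro Bochner_Integration.integral_diff Bochner_Integration.integrable_add) auto
    also have "(LINT x|lborel. ?R x + ?S x) = (LINT x|lborel. ?R x) + (LINT x|lborel. ?S x)"
      using Ri Si by (rule Bochner_Integration.integral_add)
    also have "(LINT x|lborel. ?S x) = K\<^sup>2 * \<delta>" using e2 by simp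
    finally show ?thesis by (simp add: hellinger_sq)
  qed
  also have "exp (\<dots>) \<le> exp (- (s * b / 16) * (hellinger g g0)\<^sup>2 + e2 + K\<^sup>2 * \<delta>)" using RI by simp
  finally show ?thesis .
qed

section \<open>Moment-matching finite mixtures\<close>

text \<open>Cells are grouped by equal \<open>level\<close>. For a monotone nonnegative
  \<open>\<Phi>\<close>, adding the floors at both ends of a cell isolates a cell in which
  \<open>\<Phi>\<close> changes its integer part: its level then differs from those of all other
  cells. Only cells without such a jump are ever merged.\<close>

definition level :: "(nat \<Rightarrow> real) \<Rightarrow> nat \<Rightarrow> nat" where
  "level \<Phi> l = nat \<lfloor>\<Phi> l\<rfloor> + nat \<lfloor>\<Phi> (Suc l)\<rfloor>"

lemma level_mono:
  assumes "mono \<Phi>" "l \<le> m"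
  shows "level \<Phi> l \<le> level \<Phi> m"
  unfolding level_def using assms by (intro add_mono nat_mono floor_mono) (auto simp: mono_def)

lemma level_le:
  assumes "mono \<Phi>" "\<Phi> (Suc l) \<le> real J"
  shows "level \<Phi> l \<le> 2 * J"
proof -
  have "\<Phi> l \<le> real J" using assms by (meson le_SucI order_refl monoD order_trans)
  then have "nat \<lfloor>\<Phi> l\<rfloor> \<le> J" "nat \<lfloor>\<Phi> (Suc l)\<rfloor> \<le> J" using assms(2) by linarith+
  then show ?thesis by (simp add: level_def)
qed

text \<open>The floors at \<open>l\<close>, \<open>Suc l\<close>, \<open>m\<close> and
  \<open>Suc m\<close> increase, and equal levels force all four to coincide. The oscillation bound
  thus includes the last cell in full.\<close>

lemma level_eq_imp_osc:
  assumes "mono \<Phi>" "\<And>l. 0 \<le> \<Phi> l" "l < m" "level \<Phi> l = level \<Phi> m"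
  shows "\<Phi> (Suc m) - \<Phi> l < 1"
proof -
  have m: "\<Phi> l \<le> \<Phi> (Suc l)" "\<Phi> (Suc l) \<le> \<Phi> m" "\<Phi> m \<le> \<Phi> (Suc m)"
    using assms by (auto intro: monoD)
  then have "\<lfloor>\<Phi> l\<rfloor> \<le> \<lfloor>\<Phi> (Suc l)\<rfloor>" "\<lfloor>\<Phi> (Suc l)\<rfloor> \<le> \<lfloor>\<Phi> m\<rfloor>" "\<lfloor>\<Phi> m\<rfloor> \<le> \<lfloor>\<Phi> (Suc m)\<rfloor>" "0 \<le> \<lfloor>\<Phi> l\<rfloor>"
    using assms(2)[of l] by (auto intro: floor_mono)
  then have "\<lfloor>\<Phi> l\<rfloor> = \<lfloor>\<Phi> (Suc m)\<rfloor>" using assms(4) unfolding level_def by linarith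
  then show ?thesis by linarith
qed

text \<open>Gaussian elimination: equation \<open>m\<close> is solved for the unknown
  \<open>i\<close>, which is then substituted into the remaining equations.\<close>

lemma exists_linear_relation:
  fixes a :: "nat \<Rightarrow> 'b \<Rightarrow> real"
  assumes "finite S" "m < card S"
  shows "\<exists>c. (\<exists>l\<in>S. c l \<noteq> 0) \<and> (\<forall>r<m. (\<Sum>l\<in>S. c l * a r l) = 0)"
  using assms
proof (induction m arbitrary: S a)
  case 0
  then have "S \<noteq> {}" by auto
  then show ?case by (intro exI[of _ "\<lambda>_. 1"]) auto
next
  case (Suc m)
  show ?case
  proof (cases "\<forall>l\<in>S. a m l = 0")
    case True
    obtain c where c: "\<exists>l\<in>S. c l \<noteq> 0" "\<forall>r<m. (\<Sum>l\<in>S. c l * a r l) = 0"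
      using Suc.IH[of S a] Suc.prems by auto
    have "(\<Sum>l\<in>S. c l * a m l) = 0" using True by simp
    then show ?thesis using c by (intro exI[of _ c]) (auto simp: less_Suc_eq)
  next
    case False
    then obtain i where i: "i \<in> S" "a m i \<noteq> 0" by auto
    define T where "T = S - {i}"
    have T: "finite T" "m < card T" "i \<notin> T" "S = insert i T" using Suc.prems i by (auto simp: T_def)
    obtain c where c: "\<exists>l\<in>T. c l \<noteq> 0"
      "\<forall>r<m. (\<Sum>l\<in>T. c l * (a r l - a r i * a m l / a m i)) = 0"
      using Suc.IH[OF T(1,2), of "\<lambda>r l. a r l - a r i * a m l / a m i"] by auto
    define y where "y = - (\<Sum>l\<in>T. c l * a m l) / a m i"
    define d where "d l = (if l = i then y else c l)" for l
    have sum_d: "(\<Sum>l\<in>S. d l * h l) = y * h i + (\<Sum>l\<in>T. c l * h l)" for h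
    proof -
      have "(\<Sum>l\<in>T. d l * h l) = (\<Sum>l\<in>T. c l * h l)" using T by (intro sum.cong) (auto simp: d_def)
      then show ?thesis using T by (simp add: d_def)
    qed
    have "(\<Sum>l\<in>S. d l * a r l) = 0" if "r < Suc m" for r
    proof (cases "r = m")
      case True
      then show ?thesis using i by (simp add: sum_d y_def)
    next
      case False
      then have "0 = (\<Sum>l\<in>T. c l * (a r l - a r i * a m l / a m i))" using c that by simp
      also have "\<dots> = (\<Sum>l\<in>T. c l * a r l) - a r i / a m i * (\<Sum>l\<in>T. c l * a m l)"
        by (simp add: algebra_simps sum_subtractf sum_distrib_left)
      finally show ?thesis by (simp add: sum_d y_def)
    qed
    moreover have "\<exists>l\<in>S. d l \<noteq> 0" using c T by (auto simp: d_def)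
    ultimately show ?thesis by blast
  qed
qed

text \<open>Finitely supported case of Caratheodory's theorem for the moment curve: a weight with
  minimal support has at most \<open>m\<close> atoms, since otherwise it can be moved along a linear relation
  between the moment vectors until an atom disappears.\<close>

lemma moment_reduction:
  fixes \<nu> :: "'b \<Rightarrow> real" and a :: "nat \<Rightarrow> 'b \<Rightarrow> real"
  assumes "finite G" "\<And>l. l \<in> G \<Longrightarrow> 0 \<le> \<nu> l"
  shows "\<exists>v. (\<forall>l\<in>G. 0 \<le> v l) \<and> card {l\<in>G. v l \<noteq> 0} \<le> m \<and>
    (\<forall>r<m. (\<Sum>l\<in>G. v l * a r l) = (\<Sum>l\<in>G. \<nu> l * a r l))"
proof -
  let ?P = "\<lambda>v. (\<forall>l\<in>G. 0 \<le> v l) \<and> (\<forall>r<m. (\<Sum>l\<in>G. v l * a r l) = (\<Sum>l\<in>G. \<nu> l * a r l))"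
  let ?s = "\<lambda>v. {l\<in>G. v l \<noteq> (0::real)}"
  have "?P \<nu>" using assms by auto
  then obtain v where v: "?P v" and min: "\<And>w. ?P w \<Longrightarrow> card (?s v) \<le> card (?s w)"
    using arg_min_nat_lemma[of ?P \<nu> "\<lambda>v. card (?s v)"] by auto
  have "card (?s v) \<le> m"
  proof (rule ccontr)
    assume "\<not> card (?s v) \<le> m"
    then obtain c0 where c0: "\<exists>l\<in>?s v. c0 l \<noteq> 0" "\<forall>r<m. (\<Sum>l\<in>?s v. c0 l * a r l) = 0"
      using exists_linear_relation[of "?s v" m a] assms by auto
    \<comment> \<open>A relation may be replaced by its negative; the sign is chosen so that some
      coefficient is positive and the move below is stopped by an atom.\<close>
    define \<sigma> where "\<sigma> = (if \<exists>l\<in>?s v. c0 l > 0 then 1 else - 1 :: real)"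
    define c where "c l = (if l \<in> ?s v then \<sigma> * c0 l else 0)" for l
    have cpos: "\<exists>l\<in>G. c l > 0 \<and> v l \<noteq> 0"
    proof (cases "\<exists>l\<in>?s v. c0 l > 0")
      case False
      then obtain l where "l \<in> ?s v" "c0 l < 0" using c0(1) by (meson linorder_neqE_linordered_idom)
      then show ?thesis using False by (intro bexI[of _ l]) (auto simp: c_def \<sigma>_def)
    qed (auto simp: c_def \<sigma>_def)
    have csum: "(\<Sum>l\<in>G. c l * a r l) = 0" if "r < m" for r
    proof -
      have "(\<Sum>l\<in>G. c l * a r l) = (\<Sum>l\<in>?s v. c l * a r l)"
        using assms by (intro sum.mono_neutral_right) (auto simp: c_def)
      also have "\<dots> = \<sigma> * (\<Sum>l\<in>?s v. c0 l * a r l)"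
        unfolding sum_distrib_left by (intro sum.cong) (auto simp: c_def)
      finally show ?thesis using c0(2) that by simp
    qed
    define P where "P = {l\<in>G. c l > 0}"
    define t where "t = Min ((\<lambda>l. v l / c l) ` P)"
    have P: "finite P" "P \<noteq> {}" using assms cpos by (auto simp: P_def)
    then have "t \<in> (\<lambda>l. v l / c l) ` P" unfolding t_def by (intro Min_in) auto
    then obtain i where i: "i \<in> P" "t = v i / c i" by auto
    have tle: "t \<le> v l / c l" if "l \<in> P" for l unfolding t_def using P that by (intro Min_le) auto
    have t0: "0 \<le> t" using i v by (auto simp: P_def)
    define w where "w l = v l - t * c l" for l
    have "?P w"
    proof (intro conjI ballI allI impI)
      fix l assume l: "l \<in> G"
      show "0 \<le> w l"
      proof (cases "c l > 0")
        case True
        then have "t \<le> v l / c l" using l tle by (auto simp: P_def)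
        then show ?thesis using True by (simp add: w_def pos_le_divide_eq)
      next
        case False
        then have "t * c l \<le> 0" using t0 by (simp add: mult_nonneg_nonpos)
        then show ?thesis using v l by (auto simp: w_def intro: order_trans)
      qed
    next
      fix r assume "r < m"
      then show "(\<Sum>l\<in>G. w l * a r l) = (\<Sum>l\<in>G. \<nu> l * a r l)"
        using v csum[of r] by (simp add: w_def left_diff_distrib sum_subtractf mult.assoc sum_distrib_left[symmetric])
    qed
    moreover have "card (?s w) < card (?s v)"
    proof (rule psubset_card_mono)
      show "finite (?s v)" using assms by simp
      have "w i = 0" using i by (auto simp: w_def P_def)
      moreover have "i \<in> ?s v" using i by (auto simp: P_def c_def split: if_splits)
      moreover have "?s w \<subseteq> ?s v" by (auto simp: w_def c_def)
      ultimately show "?s w \<subset> ?s v" by auto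
    qed
    ultimately show False using min[of w] by simp
  qed
  then show ?thesis using v by blast
qed

section \<open>Truncated powers and the right derivatives of a mixture\<close>

definition tpow :: "nat \<Rightarrow> real \<Rightarrow> real \<Rightarrow> real" where
  "tpow m x \<theta> = (if x < \<theta> then (\<theta> - x) ^ m else 0)"

lemma tpow_nonneg: "0 \<le> tpow m x \<theta>"
  by (simp add: tpow_def)

lemma tpow_le_1: "0 \<le> x \<Longrightarrow> \<theta> \<le> 1 \<Longrightarrow> tpow m x \<theta> \<le> 1"
  by (simp add: tpow_def power_le_one)

lemma measurable_tpow[measurable]: "tpow m x \<in> borel_measurable borel"
  unfolding tpow_def by measurable

text \<open>Dividing by \<open>\<theta>^k\<close> turns the mixture into an integral of truncated
  powers against \<open>\<theta>^(-k) dQ\<close>. For \<open>\<theta> > x\<close> the integrand is a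
  polynomial in \<open>\<theta>\<close>, which is what moment matching exploits.\<close>

lemma psi_eq_tpow:
  assumes "0 < x" "1 \<le> k"
  shows "psi k x \<theta> = real k * (tpow (k - 1) x \<theta> / \<theta> ^ k)"
  using assms psi_eq[of x \<theta> k] by (auto simp: tpow_def psi_eq_0)

lemma tpow_Suc_diff_le:
  assumes "0 \<le> x" "0 \<le> h" "\<theta> \<le> 1"
  shows "\<bar>tpow (Suc m) (x + h) \<theta> - tpow (Suc m) x \<theta>\<bar> \<le> (real m + 1) * h"
proof -
  define p q where "p = max 0 (\<theta> - (x + h))" and "q = max 0 (\<theta> - x)"
  have "tpow (Suc m) (x + h) \<theta> = p ^ Suc m" "tpow (Suc m) x \<theta> = q ^ Suc m"
    by (auto simp: tpow_def p_def q_def)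
  moreover have "norm (p ^ Suc m - q ^ Suc m) \<le> real (Suc m) * norm (p - q)"
    using assms by (intro norm_power_diff) (auto simp: p_def q_def)
  moreover have "\<bar>p - q\<bar> \<le> h" using assms by (auto simp: p_def q_def)
  then have "real (Suc m) * \<bar>p - q\<bar> \<le> real (Suc m) * h" by (intro mult_left_mono) auto
  ultimately show ?thesis by (simp add: algebra_simps)
qed

text \<open>At \<open>x = \<theta>\<close> the derivative from the right is \<open>0\<close>, the
  value prescribed by the strict inequality in \<open>tpow\<close>; for \<open>m = 0\<close> a
  two-sided derivative does not exist there.\<close>

lemma tpow_right_derivative:
  "((\<lambda>h. (tpow (Suc m) (x + h) \<theta> - tpow (Suc m) x \<theta>) / h) \<longlongrightarrow> - (real m + 1) * tpow m x \<theta>) (at_right 0)"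
proof (cases "x < \<theta>")
  case True
  have "((\<lambda>y. (\<theta> - y) ^ Suc m) has_real_derivative - (real m + 1) * (\<theta> - x) ^ m) (at x)"
    by (auto intro!: derivative_eq_intros simp del: power_Suc) (simp add: algebra_simps)
  then have "((\<lambda>h. ((\<theta> - (x + h)) ^ Suc m - (\<theta> - x) ^ Suc m) / h) \<longlongrightarrow> - (real m + 1) * (\<theta> - x) ^ m) (at_right 0)"
    unfolding DERIV_def by (rule tendsto_mono[rotated]) (simp add: at_le)
  moreover have "\<forall>\<^sub>F h in at_right 0. h < \<theta> - x"
    using True by (intro eventually_at_right_less[THEN eventually_mono] eventually_at_rightI[of 0 "\<theta> - x"]) auto
  then have "\<forall>\<^sub>F h in at_right 0. ((\<theta> - (x + h)) ^ Suc m - (\<theta> - x) ^ Suc m) / h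
     = (tpow (Suc m) (x + h) \<theta> - tpow (Suc m) x \<theta>) / h"
    by eventually_elim (use True in \<open>auto simp: tpow_def\<close>)
  ultimately have "((\<lambda>h. (tpow (Suc m) (x + h) \<theta> - tpow (Suc m) x \<theta>) / h) \<longlongrightarrow> - (real m + 1) * (\<theta> - x) ^ m) (at_right 0)"
    by (rule Lim_transform_eventually)
  then show ?thesis using True by (simp add: tpow_def)
next
  case False
  have "\<forall>\<^sub>F h::real in at_right 0. 0 < h" by (rule eventually_at_right_less)
  then have "\<forall>\<^sub>F h in at_right 0. (tpow (Suc m) (x + h) \<theta> - tpow (Suc m) x \<theta>) / h = 0"
    by eventually_elim (use False in \<open>auto simp: tpow_def\<close>)
  then show ?thesis using False by (simp add: tpow_def tendsto_eventually)
qed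

context mixing
begin

definition tmom :: "nat \<Rightarrow> real \<Rightarrow> real" where
  "tmom m x = (\<integral>\<theta>. tpow m x \<theta> / \<theta> ^ k \<partial>Q)"

lemma tmom_integrable:
  assumes "0 < x"
  shows "integrable Q (\<lambda>\<theta>. tpow m x \<theta> / \<theta> ^ k)"
proof (rule integrable_bounded_Q)
  fix \<theta> :: real assume "0 < \<theta>" "\<theta> < 1"
  show "\<bar>tpow m x \<theta> / \<theta> ^ k\<bar> \<le> 1 / x ^ k"
  proof (cases "x < \<theta>")
    case True
    have "tpow m x \<theta> / \<theta> ^ k \<le> 1 / x ^ k"
      using True assms \<open>\<theta> < 1\<close> by (intro frac_le tpow_le_1 power_mono) auto
    then show ?thesis using \<open>0 < \<theta>\<close> by (simp add: tpow_nonneg)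
  qed (use assms in \<open>simp add: tpow_def\<close>)
qed measurable

text \<open>Differentiation under the integral, by dominated convergence along sequences: scales
  \<open>\<theta> \<le> x\<close> contribute nothing, and on the others \<open>\<theta>^(-k)\<close>
  is at most \<open>x^(-k)\<close>.\<close>

lemma tmom_right_derivative:
  assumes x: "0 < x" "x < 1"
  shows "((\<lambda>h. (tmom (Suc m) (x + h) - tmom (Suc m) x) / h) \<longlongrightarrow> - (real m + 1) * tmom m x) (at_right 0)"
proof (rule tendsto_at_right_sequentially[of 0 1])
  fix S :: "nat \<Rightarrow> real"
  assume S: "\<And>n. 0 < S n" "\<And>n. S n < 1" "S \<longlonglongrightarrow> 0"
  have Sr: "filterlim S (at_right 0) sequentially"
    using S by (auto simp: filterlim_at less_imp_neq[THEN not_sym] intro!: always_eventually)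
  let ?f = "\<lambda>n \<theta>. (tpow (Suc m) (x + S n) \<theta> - tpow (Suc m) x \<theta>) / S n / \<theta> ^ k"
  have "(\<lambda>n. \<integral>\<theta>. ?f n \<theta> \<partial>Q) \<longlonglongrightarrow> (\<integral>\<theta>. - (real m + 1) * tpow m x \<theta> / \<theta> ^ k \<partial>Q)"
  proof (rule integral_dominated_convergence[where w="\<lambda>_. (real m + 1) / x ^ k"])
    show "AE \<theta> in Q. (\<lambda>n. ?f n \<theta>) \<longlonglongrightarrow> - (real m + 1) * tpow m x \<theta> / \<theta> ^ k"
    proof (rule AE_I2)
      fix \<theta> assume "\<theta> \<in> space Q"
      then have t: "\<theta> ^ k \<noteq> 0" by (simp add: space_Q)
      show "(\<lambda>n. ?f n \<theta>) \<longlonglongrightarrow> - (real m + 1) * tpow m x \<theta> / \<theta> ^ k"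
        by (intro tendsto_divide tendsto_const t filterlim_compose[OF tpow_right_derivative Sr])
    qed
    show "AE \<theta> in Q. norm (?f n \<theta>) \<le> (real m + 1) / x ^ k" for n
    proof (rule AE_I2)
      fix \<theta> assume "\<theta> \<in> space Q"
      then have t: "0 < \<theta>" "\<theta> < 1" by (auto simp: space_Q)
      show "norm (?f n \<theta>) \<le> (real m + 1) / x ^ k"
      proof (cases "x < \<theta>")
        case True
        have "\<bar>(tpow (Suc m) (x + S n) \<theta> - tpow (Suc m) x \<theta>) / S n\<bar> \<le> real m + 1"
          using tpow_Suc_diff_le[of x "S n" \<theta> m] S(1)[of n] x t by (simp add: pos_divide_le_eq)
        then have "\<bar>(tpow (Suc m) (x + S n) \<theta> - tpow (Suc m) x \<theta>) / S n\<bar> / \<theta> ^ k \<le> (real m + 1) / x ^ k"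
          using x True by (intro frac_le power_mono) auto
        then show ?thesis using t by (simp add: abs_mult)
      next
        case False
        then have e: "?f n \<theta> = 0" using S(1)[of n] by (simp add: tpow_def)
        show ?thesis unfolding e using x by simp
      qed
    qed
  qed (auto intro!: Q_measurable)
  moreover have "(\<integral>\<theta>. ?f n \<theta> \<partial>Q) = (tmom (Suc m) (x + S n) - tmom (Suc m) x) / S n" for n
  proof -
    have "(\<integral>\<theta>. ?f n \<theta> \<partial>Q) = (\<integral>\<theta>. (tpow (Suc m) (x + S n) \<theta> / \<theta> ^ k - tpow (Suc m) x \<theta> / \<theta> ^ k) / S n \<partial>Q)"
      by (intro Bochner_Integration.integral_cong) (auto simp: diff_divide_distrib[symmetric] mult.commute)
    also have "\<dots> = (tmom (Suc m) (x + S n) - tmom (Suc m) x) / S n"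
      unfolding tmom_def using tmom_integrable[of x] tmom_integrable[of "x + S n"] x S(1)[of n]
      by (simp add: add_pos_pos Bochner_Integration.integral_diff)
    finally show ?thesis .
  qed
  moreover have "(\<integral>\<theta>. - (real m + 1) * tpow m x \<theta> / \<theta> ^ k \<partial>Q) = - (real m + 1) * tmom m x"
    unfolding tmom_def times_divide_eq_right[symmetric] by (rule integral_mult_right_zero)
  ultimately show "(\<lambda>n. (tmom (Suc m) (x + S n) - tmom (Suc m) x) / S n) \<longlonglongrightarrow> - (real m + 1) * tmom m x"
    by simp
qed simp

lemma gmix_eq_tmom:
  assumes "0 < x" "x < 1"
  shows "gmix k \<beta> Q x = (\<Sum>j<k. \<beta> j * ((real j + 1) * (1 - x) ^ j)) + \<beta> k * (real k * tmom (k - 1) x)"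
proof -
  have "(\<integral>\<theta>. psi k x \<theta> \<partial>Q) = real k * tmom (k - 1) x"
    unfolding tmom_def psi_eq_tpow[OF assms(1) k1] by (rule integral_mult_right_zero)
  moreover have "(\<Sum>j<k. \<beta> j * psi (j + 1) x 1) = (\<Sum>j<k. \<beta> j * ((real j + 1) * (1 - x) ^ j))"
    by (simp only: psi_one[OF assms])
  ultimately show ?thesis by (simp add: gmix_def)
qed

text \<open>Each right derivative lowers the order of the truncated power by one and multiplies by a
  nonzero constant, while the components of scale \<open>1\<close> contribute a polynomial. For
  \<open>j = k - 1\<close> the remaining integral is that of \<open>\<theta>^(-k)\<close> over
  \<open>\<theta> > x\<close>.\<close>

lemma iter_rderiv_gmix:
  assumes "j \<le> k - 1"
  shows "\<exists>p C. C \<noteq> 0 \<and> (\<forall>x. 0 < x \<longrightarrow> x < 1 \<longrightarrow>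
    iter_rderiv j (gmix k \<beta> Q) x = poly p x + C * (\<beta> k * tmom (k - 1 - j) x))"
  using assms
proof (induction j)
  case 0
  show ?case
    by (intro exI[of _ "\<Sum>j<k. smult (\<beta> j * (real j + 1)) ([:1, -1:] ^ j)"] exI[of _ "real k"])
       (use k1 in \<open>auto simp: gmix_eq_tmom poly_sum mult_ac\<close>)
next
  case (Suc j)
  then obtain p C where C: "C \<noteq> 0"
    and eq: "\<And>x. 0 < x \<Longrightarrow> x < 1 \<Longrightarrow> iter_rderiv j (gmix k \<beta> Q) x = poly p x + C * (\<beta> k * tmom (k - 1 - j) x)"
    by auto
  define m where "m = k - 1 - Suc j"
  have m: "k - 1 - j = Suc m" using Suc.prems by (simp add: m_def)
  have "iter_rderiv (Suc j) (gmix k \<beta> Q) x = poly (pderiv p) x + (- C * (real m + 1)) * (\<beta> k * tmom m x)"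
    if x: "0 < x" "x < 1" for x
  proof -
    have "((\<lambda>h. (poly p (x + h) - poly p x) / h) \<longlongrightarrow> poly (pderiv p) x) (at_right 0)"
      using poly_DERIV[of p x] unfolding DERIV_def by (rule tendsto_mono[rotated]) (simp add: at_le)
    from tendsto_add[OF this tendsto_mult_left[OF tmom_right_derivative[OF x, of m], of "C * \<beta> k"]]
    have "((\<lambda>h. (poly p (x + h) - poly p x) / h + C * \<beta> k * ((tmom (Suc m) (x + h) - tmom (Suc m) x) / h))
      \<longlongrightarrow> poly (pderiv p) x + C * \<beta> k * (- (real m + 1) * tmom m x)) (at_right 0)" .
    moreover have "\<forall>\<^sub>F h in at_right 0. 0 < h \<and> h < 1 - x"
      using x by (intro eventually_at_rightI[of 0 "1 - x"]) auto
    then have "\<forall>\<^sub>F h in at_right 0. (iter_rderiv j (gmix k \<beta> Q) (x + h) - iter_rderiv j (gmix k \<beta> Q) x) / h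
      = (poly p (x + h) - poly p x) / h + C * \<beta> k * ((tmom (Suc m) (x + h) - tmom (Suc m) x) / h)"
      by eventually_elim (use x m in \<open>simp add: eq field_simps\<close>)
    ultimately have "((\<lambda>h. (iter_rderiv j (gmix k \<beta> Q) (x + h) - iter_rderiv j (gmix k \<beta> Q) x) / h)
       \<longlongrightarrow> poly (pderiv p) x + C * \<beta> k * (- (real m + 1) * tmom m x)) (at_right 0)"
      by (simp add: tendsto_cong)
    then have "rderiv (iter_rderiv j (gmix k \<beta> Q)) x = poly (pderiv p) x + C * \<beta> k * (- (real m + 1) * tmom m x)"
      unfolding rderiv_def by (intro tendsto_Lim) auto
    then show ?thesis by (simp add: algebra_simps)
  qed
  then show ?case using C unfolding m_def[symmetric]
    by (intro exI[of _ "pderiv p"] exI[of _ "- C * (real m + 1)"]) auto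
qed

text \<open>\<open>tmom 0 x\<close> increases as \<open>x\<close> decreases to \<open>0\<close>, so
  a finite limit of the derivative is a finite monotone limit of integrals, and monotone convergence
  applies. Isolating \<open>tmom\<close> requires dividing by \<open>\<beta> k\<close>.\<close>

lemma integrable_inverse_power:
  assumes "(iter_rderiv (k - 1) (gmix k \<beta> Q) \<longlongrightarrow> L) (at_right 0)" "\<beta> k \<noteq> 0"
  shows "integrable Q (\<lambda>\<theta>. 1 / \<theta> ^ k)"
proof -
  obtain p C where C: "C \<noteq> 0"
    and eq: "\<And>x. 0 < x \<Longrightarrow> x < 1 \<Longrightarrow> iter_rderiv (k - 1) (gmix k \<beta> Q) x = poly p x + C * (\<beta> k * tmom 0 x)"
    using iter_rderiv_gmix[of "k - 1"] by auto
  \<comment> \<open>The shift by \<open>2\<close> keeps the sequence inside the open unit interval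
    from its first term on, where the formula for the derivative is valid.\<close>
  define S :: "nat \<Rightarrow> real" where "S n = 1 / real (n + 2)" for n
  have S: "0 < S n" "S n < 1" for n by (auto simp: S_def)
  have S0: "S \<longlonglongrightarrow> 0" unfolding S_def using LIMSEQ_ignore_initial_segment[OF lim_1_over_n, of 2] by simp
  have Sr: "filterlim S (at_right 0) sequentially"
    using S S0 by (auto simp: filterlim_at less_imp_neq[THEN not_sym] intro!: always_eventually)
  have "(\<lambda>n. (iter_rderiv (k - 1) (gmix k \<beta> Q) (S n) - poly p (S n)) / (C * \<beta> k)) \<longlonglongrightarrow> (L - poly p 0) / (C * \<beta> k)"
    using C assms(2)
    by (intro tendsto_intros filterlim_compose[OF assms(1) Sr] isCont_tendsto_compose[OF _ S0]) auto
  also have "(\<lambda>n. (iter_rderiv (k - 1) (gmix k \<beta> Q) (S n) - poly p (S n)) / (C * \<beta> k)) = (\<lambda>n. tmom 0 (S n))"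
  proof
    fix n show "(iter_rderiv (k - 1) (gmix k \<beta> Q) (S n) - poly p (S n)) / (C * \<beta> k) = tmom 0 (S n)"
      using C assms(2) unfolding eq[OF S] by simp
  qed
  finally have lim: "(\<lambda>n. tmom 0 (S n)) \<longlonglongrightarrow> (L - poly p 0) / (C * \<beta> k)" .
  show ?thesis
  proof (rule integrable_monotone_convergence[OF _ _ _ lim[unfolded tmom_def]])
    show "integrable Q (\<lambda>\<theta>. tpow 0 (S i) \<theta> / \<theta> ^ k)" for i by (rule tmom_integrable[OF S(1)])
    show "AE \<theta> in Q. mono (\<lambda>n. tpow 0 (S n) \<theta> / \<theta> ^ k)"
    proof (intro AE_I2 monoI)
      fix \<theta> and n m :: nat assume "\<theta> \<in> space Q" "n \<le> m"
      moreover have "S m \<le> S n" using \<open>n \<le> m\<close> by (simp add: S_def frac_le)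
      ultimately show "tpow 0 (S n) \<theta> / \<theta> ^ k \<le> tpow 0 (S m) \<theta> / \<theta> ^ k"
        by (auto simp: tpow_def space_Q divide_right_mono)
    qed
    show "AE \<theta> in Q. (\<lambda>n. tpow 0 (S n) \<theta> / \<theta> ^ k) \<longlonglongrightarrow> 1 / \<theta> ^ k"
    proof (intro AE_I2)
      fix \<theta> assume "\<theta> \<in> space Q"
      then have "0 < \<theta>" by (simp add: space_Q)
      then have "\<forall>\<^sub>F n in sequentially. S n < \<theta>" by (rule order_tendstoD[OF S0])
      then have "\<forall>\<^sub>F n in sequentially. tpow 0 (S n) \<theta> / \<theta> ^ k = 1 / \<theta> ^ k"
        by eventually_elim (simp add: tpow_def)
      then show "(\<lambda>n. tpow 0 (S n) \<theta> / \<theta> ^ k) \<longlonglongrightarrow> 1 / \<theta> ^ k" by (rule tendsto_eventually)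
    qed
  qed (intro Q_measurable, measurable)
qed

text \<open>Integrability of \<open>\<theta>^(-k)\<close> bounds the mixture uniformly, including
  near \<open>0\<close>; for the truth this is the ceiling from which the truncation level
  \<open>K\<close> is computed.\<close>

lemma gmix_le:
  assumes V: "integrable Q (\<lambda>\<theta>. 1 / \<theta> ^ k)"
  shows "gmix k \<beta> Q x \<le> real k + real k * (\<integral>\<theta>. 1 / \<theta> ^ k \<partial>Q)"
proof (cases "x \<in> {0<..<1}")
  case True
  have "(\<Sum>j<k. \<beta> j * psi (j + 1) x 1) \<le> (\<Sum>j<k. \<beta> j * real k)"
  proof (intro sum_mono mult_left_mono beta_nonneg)
    fix j assume "j \<in> {..<k}"
    then show "psi (j + 1) x 1 \<le> real k" using psi_le_moment[of 1 "j + 1" x] by simp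
  qed auto
  also have "\<dots> = (\<Sum>j<k. \<beta> j) * real k" by (simp add: sum_distrib_right)
  also have "\<dots> \<le> 1 * real k" using beta_sum beta_nonneg[of k] by (intro mult_right_mono) auto
  finally have 1: "(\<Sum>j<k. \<beta> j * psi (j + 1) x 1) \<le> real k" by simp
  have "(\<integral>\<theta>. psi k x \<theta> \<partial>Q) \<le> (\<integral>\<theta>. real k * (1 / \<theta> ^ k) \<partial>Q)"
    using psi_le_moment[OF _ _ k1] by (intro integral_mono integrable_psi integrable_mult_right V) (auto simp: space_Q)
  also have "\<dots> = real k * (\<integral>\<theta>. 1 / \<theta> ^ k \<partial>Q)" by (rule integral_mult_right_zero)
  finally have "\<beta> k * (\<integral>\<theta>. psi k x \<theta> \<partial>Q) \<le> 1 * (real k * (\<integral>\<theta>. 1 / \<theta> ^ k \<partial>Q))"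
    using beta_nonneg[of k] beta_le[of k] integral_psi_nonneg by (intro mult_mono) auto
  then show ?thesis using 1 unfolding gmix_def by simp
next
  case False
  have "0 \<le> (\<integral>\<theta>. 1 / \<theta> ^ k \<partial>Q)" by (intro Bochner_Integration.integral_nonneg) (auto simp: space_Q)
  then show ?thesis using gmix_eq_0[OF False] by simp
qed

end

section \<open>A uniform grid on the unit interval\<close>

definition gcell :: "nat \<Rightarrow> nat \<Rightarrow> real set" where
  "gcell L l = {real l / real L <.. (real l + 1) / real L}"

text \<open>The index is the ceiling of \<open>L * x\<close> minus one. Cells are closed on the
  right, so the first starts just after \<open>0\<close> and the last contains
  \<open>1\<close>.\<close>

lemma gcell_cover:
  assumes "0 < x" "x \<le> 1" "1 \<le> L"
  shows "\<exists>l<L. \<forall>m. x \<in> gcell L m \<longleftrightarrow> m = l"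
proof -
  define c where "c = nat \<lceil>real L * x\<rceil>"
  have Lx: "0 < real L * x" "real L * x \<le> real L" using assms by (auto simp: mult_left_le)
  then have c1: "1 \<le> c" unfolding c_def by linarith
  have cc: "real c - 1 < real L * x" "real L * x \<le> real c" using Lx unfolding c_def by linarith+
  have "c \<le> L" using Lx unfolding c_def by linarith
  moreover have "x \<in> gcell L m \<longleftrightarrow> m = c - 1" for m
  proof -
    have "x \<in> gcell L m \<longleftrightarrow> real m < real L * x \<and> real L * x \<le> real m + 1"
      using assms by (simp add: gcell_def divide_less_eq le_divide_eq mult.commute)
    also have "\<dots> \<longleftrightarrow> m = c - 1" using cc c1 by linarith
    finally show ?thesis .
  qed
  ultimately show ?thesis using c1 by (intro exI[of _ "c - 1"]) auto
qed

lemma gcell_sum: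
  assumes "0 < x" "x \<le> 1" "1 \<le> L"
  shows "(\<Sum>l<L. indicator (gcell L l) x) = (1::real)"
proof -
  obtain l where l: "l < L" "\<And>m. x \<in> gcell L m \<longleftrightarrow> m = l" using gcell_cover[OF assms] by blast
  have "(\<Sum>m<L. indicator (gcell L m) x) = (\<Sum>m<L. if m = l then 1 else (0::real))"
    using l by (intro sum.cong) (auto simp: indicator_def)
  then show ?thesis using l by simp
qed

lemma gcell_sets[measurable]: "gcell L l \<in> sets borel"
  by (simp add: gcell_def)

lemma emeasure_gcell: "1 \<le> L \<Longrightarrow> emeasure lborel (gcell L l) = ennreal (1 / real L)"
  by (simp add: gcell_def divide_right_mono diff_divide_distrib[symmetric])

lemma gcell_order:
  assumes "x \<in> gcell L l" "y \<in> gcell L m" "l < m" "1 \<le> L"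
  shows "x \<le> real m / real L" "x < y" "(real l + 1) / real L < y"
proof -
  have "(real l + 1) / real L \<le> real m / real L" using assms by (intro divide_right_mono) auto
  then show "x \<le> real m / real L" "x < y" "(real l + 1) / real L < y" using assms by (auto simp: gcell_def)
qed

definition gmid :: "nat \<Rightarrow> nat \<Rightarrow> real" where
  "gmid L l = (real l + 1 / 2) / real L"

lemma gmid_in_gcell: "1 \<le> L \<Longrightarrow> gmid L l \<in> gcell L l"
  by (auto simp: gmid_def gcell_def divide_strict_right_mono divide_right_mono)

lemma gmid_bounds: "1 \<le> L \<Longrightarrow> l < L \<Longrightarrow> 0 < gmid L l \<and> gmid L l < 1"
  by (auto simp: gmid_def divide_less_eq)

lemma gmid_near:
  assumes "\<theta> \<in> gcell L l" "1 \<le> L"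
  shows "\<bar>\<theta> - gmid L l\<bar> \<le> 1 / (2 * real L)"
proof -
  have "real l / real L = gmid L l - 1 / (2 * real L)" "(real l + 1) / real L = gmid L l + 1 / (2 * real L)"
    using assms by (auto simp: gmid_def field_simps)
  then show ?thesis using assms unfolding gcell_def by auto
qed

lemma sum_power_le_power_sum:
  fixes \<nu> :: "'b \<Rightarrow> real"
  assumes "finite A" "\<And>l. l \<in> A \<Longrightarrow> 0 \<le> \<nu> l"
  shows "(\<Sum>l\<in>A. (\<nu> l)\<^sup>2) \<le> (\<Sum>l\<in>A. \<nu> l)\<^sup>2"
proof -
  have "(\<Sum>l\<in>A. \<nu> l * \<nu> l) \<le> (\<Sum>l\<in>A. \<nu> l * (\<Sum>l\<in>A. \<nu> l))"
    using assms by (intro sum_mono mult_left_mono member_le_sum) auto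
  then show ?thesis by (simp add: power2_eq_square sum_distrib_right)
qed

text \<open>By the binomial theorem \<open>(z - x)^m\<close> is a combination of the powers of
  \<open>z\<close> up to \<open>m\<close> with coefficients free of the atoms, so matched moments
  serve all points \<open>x\<close> at once.\<close>

lemma moments_match_shifted_power:
  fixes v \<nu> z :: "'b \<Rightarrow> real"
  assumes "\<forall>r<Suc m. (\<Sum>l\<in>A. v l * z l ^ r) = (\<Sum>l\<in>A. \<nu> l * z l ^ r)"
  shows "(\<Sum>l\<in>A. v l * (z l - x) ^ m) = (\<Sum>l\<in>A. \<nu> l * (z l - x) ^ m)"
proof -
  have expand: "(\<Sum>l\<in>A. h l * (z l - x) ^ m) = (\<Sum>r\<le>m. (of_nat (m choose r) * (- x) ^ (m - r)) * (\<Sum>l\<in>A. h l * z l ^ r))"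
    for h :: "'b \<Rightarrow> real"
  proof -
    have "(\<Sum>l\<in>A. h l * (z l - x) ^ m) = (\<Sum>l\<in>A. \<Sum>r\<le>m. h l * (of_nat (m choose r) * z l ^ r * (- x) ^ (m - r)))"
      using binomial_ring[of "z _" "- x" m] by (simp add: sum_distrib_left)
    also have "\<dots> = (\<Sum>r\<le>m. \<Sum>l\<in>A. h l * (of_nat (m choose r) * z l ^ r * (- x) ^ (m - r)))"
      by (rule sum.swap)
    finally show ?thesis by (simp add: sum_distrib_left mult_ac)
  qed
  show ?thesis unfolding expand using assms by (intro sum.cong) auto
qed

context mixing
begin

text \<open>Seen from a point \<open>x\<close>, groups of scales below \<open>x\<close> contribute
  nothing. Groups above \<open>x\<close> are integrated against a polynomial, so once scales are
  rounded to midpoints the matched moments give equal values. The group of \<open>x\<close> itself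
  has width at most \<open>1 / N\<close> and mass at most \<open>V / N\<close>, hence contributes of
  order \<open>V / N^k\<close>, unless it is a single cell, whose error is charged to its length
  \<open>1 / L\<close>.\<close>

lemma finite_mixture_approximation:
  assumes Vint: "integrable Q (\<lambda>\<theta>. 1 / \<theta> ^ k)" and V: "V = (\<integral>\<theta>. 1 / \<theta> ^ k \<partial>Q)" and N: "1 \<le> N" and L: "1 \<le> L"
  shows "\<exists>Z w. Z \<subseteq> {..<L} \<and> card Z \<le> (4 * N + 1) * (k + 1) \<and> (\<forall>l\<in>Z. 0 \<le> w l)
    \<and> \<bar>(\<Sum>l\<in>Z. w l) - 1\<bar> \<le> real k * V / real L
    \<and> (\<integral>\<^sup>+ x. ennreal (((\<Sum>l\<in>Z. w l * psi k x (gmid L l)) - (\<integral>\<theta>. psi k x \<theta> \<partial>Q))\<^sup>2) * indicator {0<..<1} x \<partial>lborel)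
       \<le> ennreal (3 * (real k)\<^sup>2 * V\<^sup>2 * ((real k)\<^sup>2 / real L + 1 / real N ^ (2 * k) + 1 / real L))"
proof -
  let ?z = "gmid L"
  have Lp: "0 < real L" and Np: "0 < real N" using L N by auto
  have intc: "integrable Q (\<lambda>\<theta>. indicator (gcell L l) \<theta> * (f \<theta> / \<theta> ^ k))"
    if f: "f \<in> borel_measurable borel" and f1: "\<And>\<theta>. 0 < \<theta> \<Longrightarrow> \<theta> < 1 \<Longrightarrow> \<bar>f \<theta>\<bar> \<le> 1" for f l
  proof (rule Bochner_Integration.integrable_bound[OF Vint])
    show "(\<lambda>\<theta>. indicator (gcell L l) \<theta> * (f \<theta> / \<theta> ^ k)) \<in> borel_measurable Q"
      by (intro Q_measurable borel_measurable_times borel_measurable_divide f borel_measurable_power borel_measurable_indicator) auto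
    show "AE \<theta> in Q. norm (indicator (gcell L l) \<theta> * (f \<theta> / \<theta> ^ k)) \<le> norm (1 / \<theta> ^ k)"
      using f1 by (intro AE_I2) (auto simp: space_Q indicator_def abs_mult divide_right_mono)
  qed
  define \<nu> where "\<nu> l = (\<integral>\<theta>. indicator (gcell L l) \<theta> * (1 / \<theta> ^ k) \<partial>Q)" for l
  have intnu: "integrable Q (\<lambda>\<theta>. indicator (gcell L l) \<theta> * (1 / \<theta> ^ k))" for l
    using intc[of "\<lambda>_. 1"] by simp
  have nu0: "0 \<le> \<nu> l" for l unfolding \<nu>_def
    by (intro Bochner_Integration.integral_nonneg_AE AE_I2) (auto simp: space_Q)
  have split: "(\<integral>\<theta>. f \<theta> / \<theta> ^ k \<partial>Q) = (\<Sum>l<L. \<integral>\<theta>. indicator (gcell L l) \<theta> * (f \<theta> / \<theta> ^ k) \<partial>Q)"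
    if f: "f \<in> borel_measurable borel" and f1: "\<And>\<theta>. 0 < \<theta> \<Longrightarrow> \<theta> < 1 \<Longrightarrow> \<bar>f \<theta>\<bar> \<le> 1" for f
  proof -
    have "(\<integral>\<theta>. f \<theta> / \<theta> ^ k \<partial>Q) = (\<integral>\<theta>. (\<Sum>l<L. indicator (gcell L l) \<theta> * (f \<theta> / \<theta> ^ k)) \<partial>Q)"
      unfolding sum_distrib_right[symmetric] using gcell_sum[OF _ _ L]
      by (intro Bochner_Integration.integral_cong) (auto simp: space_Q)
    also have "\<dots> = (\<Sum>l<L. \<integral>\<theta>. indicator (gcell L l) \<theta> * (f \<theta> / \<theta> ^ k) \<partial>Q)"
      using intc[OF f f1] by (rule Bochner_Integration.integral_sum)
    finally show ?thesis .
  qed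
  have Vsum: "V = (\<Sum>l<L. \<nu> l)" unfolding V \<nu>_def using split[of "\<lambda>_. 1"] by simp
  have close: "\<bar>(\<integral>\<theta>. indicator (gcell L l) \<theta> * (f \<theta> / \<theta> ^ k) \<partial>Q) - \<nu> l * c\<bar> \<le> e * \<nu> l"
    if f: "f \<in> borel_measurable borel" and f1: "\<And>\<theta>. 0 < \<theta> \<Longrightarrow> \<theta> < 1 \<Longrightarrow> \<bar>f \<theta>\<bar> \<le> 1"
      and fc: "\<And>\<theta>. \<theta> \<in> gcell L l \<Longrightarrow> 0 < \<theta> \<Longrightarrow> \<theta> < 1 \<Longrightarrow> \<bar>f \<theta> - c\<bar> \<le> e" for f l c e
  proof -
    have "(\<integral>\<theta>. indicator (gcell L l) \<theta> * (f \<theta> / \<theta> ^ k) \<partial>Q) - \<nu> l * c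
        = (\<integral>\<theta>. indicator (gcell L l) \<theta> * (f \<theta> / \<theta> ^ k) - c * (indicator (gcell L l) \<theta> * (1 / \<theta> ^ k)) \<partial>Q)"
    proof -
      have "(\<integral>\<theta>. c * (indicator (gcell L l) \<theta> * (1 / \<theta> ^ k)) \<partial>Q) = c * \<nu> l"
        unfolding \<nu>_def by (rule integral_mult_right_zero)
      then show ?thesis
        using Bochner_Integration.integral_diff[OF intc[OF f f1] integrable_mult_right[OF intnu], of l c l]
        by (simp only: mult.commute[of "\<nu> l" c])
    qed
    also have "\<bar>\<dots>\<bar> \<le> (\<integral>\<theta>. e * (indicator (gcell L l) \<theta> * (1 / \<theta> ^ k)) \<partial>Q)"
    proof (rule integral_abs_bound_integral)
      show "integrable Q (\<lambda>\<theta>. indicator (gcell L l) \<theta> * (f \<theta> / \<theta> ^ k) - c * (indicator (gcell L l) \<theta> * (1 / \<theta> ^ k)))"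
        using intc[OF f f1] intnu by (intro Bochner_Integration.integrable_diff integrable_mult_right) auto
      show "integrable Q (\<lambda>\<theta>. e * (indicator (gcell L l) \<theta> * (1 / \<theta> ^ k)))" using intnu by (intro integrable_mult_right)
      fix \<theta> assume "\<theta> \<in> space Q"
      then have "0 < \<theta>" "\<theta> < 1" by (auto simp: space_Q)
      then show "\<bar>indicator (gcell L l) \<theta> * (f \<theta> / \<theta> ^ k) - c * (indicator (gcell L l) \<theta> * (1 / \<theta> ^ k))\<bar>
        \<le> e * (indicator (gcell L l) \<theta> * (1 / \<theta> ^ k))"
        using fc[of \<theta>] by (auto simp: indicator_def diff_divide_distrib[symmetric] divide_right_mono)
    qed
    also have "\<dots> = e * \<nu> l" unfolding \<nu>_def by (rule integral_mult_right_zero)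
    finally show ?thesis .
  qed
  have V1: "1 \<le> V"
  proof -
    have "1 = (\<integral>\<theta>. (1::real) \<partial>Q)" by (simp add: Q.prob_space)
    also have "\<dots> \<le> V" unfolding V
      by (intro integral_mono_AE Vint AE_I2) (auto simp: space_Q power_le_one)
    finally show ?thesis .
  qed
  \<comment> \<open>Length and normalised mass, each of total \<open>1\<close>, are added and scaled
    by \<open>N\<close>: an oscillation below \<open>1\<close> bounds the width of a group by
    \<open>1 / N\<close> and its mass by \<open>V / N\<close> simultaneously.\<close>
  define \<Phi> where "\<Phi> l = real N * (real l / real L + (\<Sum>m<l. \<nu> m) / V)" for l
  have Phi_mono: "mono \<Phi>"
  proof (rule incseq_SucI)
    show "\<Phi> l \<le> \<Phi> (Suc l)" for l
      unfolding \<Phi>_def using nu0[of l] V1 by (intro mult_left_mono add_mono divide_right_mono) auto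
  qed
  have Phi0: "0 \<le> \<Phi> l" for l unfolding \<Phi>_def using V1 nu0 by (auto intro!: mult_nonneg_nonneg add_nonneg_nonneg divide_nonneg_nonneg sum_nonneg)
  have lev: "level \<Phi> l \<le> 4 * N" if "l < L" for l
  proof -
    have "(\<Sum>m<Suc l. \<nu> m) \<le> V" unfolding Vsum using that nu0 by (intro sum_mono2) auto
    then have "(\<Sum>m<Suc l. \<nu> m) / V \<le> 1" using V1 by (subst divide_le_eq_1_pos) auto
    moreover have "real (Suc l) / real L \<le> 1" using that by simp
    ultimately have "real (Suc l) / real L + (\<Sum>m<Suc l. \<nu> m) / V \<le> 2" by linarith
    then have "\<Phi> (Suc l) \<le> real N * 2" unfolding \<Phi>_def by (rule mult_left_mono) simp
    then show ?thesis using level_le[OF Phi_mono, of l "2 * N"] by simp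
  qed
  define G where "G i = {l\<in>{..<L}. level \<Phi> l = i}" for i
  have finG: "finite (G i)" for i by (simp add: G_def)
  \<comment> \<open>Moments of order \<open>0\<close> to \<open>k - 1\<close> reproduce the
    truncated power of order \<open>k - 1\<close>; the additional order \<open>k\<close> preserves
    the mass of \<open>Q\<close>, because \<open>\<theta>^k\<close> undoes the density
    \<open>\<theta>^(-k)\<close>.\<close>
  have "\<exists>v. (\<forall>l\<in>G i. 0 \<le> v l) \<and> card {l\<in>G i. v l \<noteq> 0} \<le> k + 1 \<and>
    (\<forall>r<k + 1. (\<Sum>l\<in>G i. v l * ?z l ^ r) = (\<Sum>l\<in>G i. \<nu> l * ?z l ^ r))" for i
    using nu0 by (intro moment_reduction finG) auto
  then have "\<forall>i. \<exists>v. (\<forall>l\<in>G i. 0 \<le> v l) \<and> card {l\<in>G i. v l \<noteq> 0} \<le> k + 1 \<and>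
    (\<forall>r<k + 1. (\<Sum>l\<in>G i. v l * ?z l ^ r) = (\<Sum>l\<in>G i. \<nu> l * ?z l ^ r))" by blast
  from choice[OF this] obtain v' where v'_all: "\<forall>i. (\<forall>l\<in>G i. 0 \<le> v' i l) \<and> card {l\<in>G i. v' i l \<noteq> 0} \<le> k + 1 \<and>
    (\<forall>r<k + 1. (\<Sum>l\<in>G i. v' i l * ?z l ^ r) = (\<Sum>l\<in>G i. \<nu> l * ?z l ^ r))" by blast
  have v': "\<And>i l. l \<in> G i \<Longrightarrow> 0 \<le> v' i l" "\<And>i. card {l\<in>G i. v' i l \<noteq> (0::real)} \<le> k + 1"
    "\<And>i r. r < k + 1 \<Longrightarrow> (\<Sum>l\<in>G i. v' i l * ?z l ^ r) = (\<Sum>l\<in>G i. \<nu> l * ?z l ^ r)"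
    using v'_all by blast+
  define v where "v l = v' (level \<Phi> l) l" for l
  have v0: "0 \<le> v l" if "l < L" for l using v'(1)[of l "level \<Phi> l"] that by (simp add: v_def G_def)
  have vmom: "(\<Sum>l\<in>G i. v l * ?z l ^ r) = (\<Sum>l\<in>G i. \<nu> l * ?z l ^ r)" if "r < k + 1" for i r
    using v'(3)[OF that, of i] by (simp add: v_def G_def)
  have group: "(\<Sum>l\<in>{..<L}. if P (level \<Phi> l) then h l else 0) = (\<Sum>i\<le>4 * N. if P i then \<Sum>l\<in>G i. h l else 0)"
    for P and h :: "nat \<Rightarrow> real"
  proof -
    have "(\<Sum>l\<in>{..<L}. if P (level \<Phi> l) then h l else 0)
       = (\<Sum>i\<le>4 * N. \<Sum>l\<in>{l\<in>{..<L}. level \<Phi> l = i}. if P (level \<Phi> l) then h l else 0)"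
      using lev by (intro sum.group[symmetric]) auto
    also have "\<dots> = (\<Sum>i\<le>4 * N. if P i then \<Sum>l\<in>G i. h l else 0)"
      by (intro sum.cong) (auto simp: G_def)
    finally show ?thesis .
  qed
  define Z where "Z = {l\<in>{..<L}. v l \<noteq> 0}"
  \<comment> \<open>Multiplying by the \<open>k\<close>-th power of the midpoint turns a weight for
    truncated powers back into a weight for \<open>psi\<close>.\<close>
  define w where "w l = v l * ?z l ^ k" for l
  have sumZ: "(\<Sum>l\<in>Z. v l * h l) = (\<Sum>l<L. v l * h l)" for h :: "nat \<Rightarrow> real"
    unfolding Z_def by (rule sum.mono_neutral_left) auto
  have cardZ: "card Z \<le> (4 * N + 1) * (k + 1)"
  proof -
    have "Z \<subseteq> (\<Union>i\<in>{..4 * N}. {l\<in>G i. v' i l \<noteq> 0})" using lev by (auto simp: Z_def v_def G_def)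
    then have "card Z \<le> card (\<Union>i\<in>{..4 * N}. {l\<in>G i. v' i l \<noteq> 0})" using finG by (intro card_mono) auto
    also have "\<dots> \<le> (\<Sum>i\<le>4 * N. card {l\<in>G i. v' i l \<noteq> 0})" by (rule card_UN_le) simp
    also have "\<dots> \<le> (\<Sum>i\<le>4 * N. k + 1)" by (rule sum_mono) (rule v'(2))
    finally show ?thesis by simp
  qed
  have mass: "\<bar>(\<Sum>l\<in>Z. w l) - 1\<bar> \<le> real k * V / real L"
  proof -
    have "(\<Sum>l\<in>Z. w l) = (\<Sum>l<L. v l * ?z l ^ k)" unfolding w_def by (rule sumZ)
    also have "\<dots> = (\<Sum>l<L. \<nu> l * ?z l ^ k)"
      using group[of "\<lambda>_. True" "\<lambda>l. v l * ?z l ^ k"] group[of "\<lambda>_. True" "\<lambda>l. \<nu> l * ?z l ^ k"] vmom[of k] by simp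
    finally have 1: "(\<Sum>l\<in>Z. w l) = (\<Sum>l<L. \<nu> l * ?z l ^ k)" .
    have "1 = (\<integral>\<theta>. \<theta> ^ k / \<theta> ^ k \<partial>Q)"
    proof -
      have "(\<integral>\<theta>. \<theta> ^ k / \<theta> ^ k \<partial>Q) = (\<integral>\<theta>. (1::real) \<partial>Q)" by (intro Bochner_Integration.integral_cong) (auto simp: space_Q)
      then show ?thesis by (simp add: Q.prob_space)
    qed
    also have "\<dots> = (\<Sum>l<L. \<integral>\<theta>. indicator (gcell L l) \<theta> * (\<theta> ^ k / \<theta> ^ k) \<partial>Q)"
      by (rule split) (auto simp: power_le_one)
    finally have "(\<Sum>l\<in>Z. w l) - 1 = - (\<Sum>l<L. (\<integral>\<theta>. indicator (gcell L l) \<theta> * (\<theta> ^ k / \<theta> ^ k) \<partial>Q) - \<nu> l * ?z l ^ k)"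
      unfolding 1 by (simp add: sum_subtractf)
    also have "\<bar>\<dots>\<bar> \<le> (\<Sum>l<L. \<bar>(\<integral>\<theta>. indicator (gcell L l) \<theta> * (\<theta> ^ k / \<theta> ^ k) \<partial>Q) - \<nu> l * ?z l ^ k\<bar>)"
      unfolding abs_minus_cancel by (rule sum_abs)
    also have "\<dots> \<le> (\<Sum>l<L. real k / real L * \<nu> l)"
    proof (intro sum_mono close)
      fix l \<theta> assume l: "l \<in> {..<L}" and t: "\<theta> \<in> gcell L l" "0 < \<theta>" "\<theta> < 1"
      have "norm (\<theta> ^ k - ?z l ^ k) \<le> real k * norm (\<theta> - ?z l)"
        using t gmid_bounds[OF L, of l] l by (intro norm_power_diff) auto
      also have "\<dots> \<le> real k * (1 / real L)"
        using gmid_near[OF t(1) L] Lp by (intro mult_left_mono) (auto simp: field_simps)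
      finally show "\<bar>\<theta> ^ k - ?z l ^ k\<bar> \<le> real k / real L" by simp
    qed (auto simp: power_le_one)
    also have "\<dots> = real k * V / real L" by (simp add: Vsum sum_distrib_left sum_divide_distrib)
    finally show ?thesis .
  qed
  have point: "\<bar>(\<Sum>l\<in>Z. w l * psi k x (?z l)) - (\<integral>\<theta>. psi k x \<theta> \<partial>Q)\<bar>
      \<le> real k * (V * real k / real L + V / real N ^ k + \<nu> l0)"
    if x: "0 < x" "x < 1" and l0: "l0 < L" "x \<in> gcell L l0" for x l0
  proof -
    define h where "h = tpow (k - 1) x"
    define A where "A l = (\<integral>\<theta>. indicator (gcell L l) \<theta> * (h \<theta> / \<theta> ^ k) \<partial>Q)" for l
    have hm: "h \<in> borel_measurable borel" and h1: "\<bar>h \<theta>\<bar> \<le> 1" if "\<theta> < 1" for \<theta>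
      using x that by (auto simp: h_def tpow_nonneg tpow_le_1)
    have hm: "h \<in> borel_measurable borel" by (simp add: h_def)
    have h0: "0 \<le> h \<theta>" for \<theta> by (simp add: h_def tpow_nonneg)
    have A0: "0 \<le> A l" for l unfolding A_def
      using h0 by (intro Bochner_Integration.integral_nonneg_AE AE_I2) (auto simp: space_Q)
    have eQ: "(\<integral>\<theta>. psi k x \<theta> \<partial>Q) = real k * (\<Sum>l<L. A l)"
    proof -
      have "(\<integral>\<theta>. psi k x \<theta> \<partial>Q) = real k * (\<integral>\<theta>. h \<theta> / \<theta> ^ k \<partial>Q)"
        unfolding psi_eq_tpow[OF x(1) k1] h_def by (rule integral_mult_right_zero)
      then show ?thesis unfolding A_def using split[OF hm h1] by simp
    qed
    have eZ: "(\<Sum>l\<in>Z. w l * psi k x (?z l)) = real k * (\<Sum>l<L. v l * h (?z l))"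
    proof -
      have "(\<Sum>l\<in>Z. w l * psi k x (?z l)) = (\<Sum>l\<in>Z. real k * (v l * h (?z l)))"
      proof (rule sum.cong)
        fix l assume "l \<in> Z"
        then have "?z l > 0" using gmid_bounds[OF L, of l] by (simp add: Z_def)
        then show "w l * psi k x (?z l) = real k * (v l * h (?z l))"
          unfolding psi_eq_tpow[OF x(1) k1] h_def w_def by simp
      qed simp
      then show ?thesis using sumZ[of "\<lambda>l. h (?z l)"] by (simp add: sum_distrib_left[symmetric])
    qed
    define i0 where "i0 = level \<Phi> l0"
    have after: "l0 < l" if "i0 < level \<Phi> l" for l
      using that level_mono[OF Phi_mono, of l l0] unfolding i0_def by (meson leD not_le_imp_less)
    have before: "l < l0" if "level \<Phi> l < i0" for l
      using that level_mono[OF Phi_mono, of l0 l] unfolding i0_def by (meson leD not_le_imp_less)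
    have zero: "A l = 0" "h (?z l) = 0" if "l < l0" for l
    proof -
      have x': "\<theta> \<le> x" if "\<theta> \<in> gcell L l" for \<theta>
        using gcell_order[OF that l0(2) \<open>l < l0\<close> L] by simp
      show "h (?z l) = 0" using x'[OF gmid_in_gcell[OF L]] by (simp add: h_def tpow_def)
      have "A l = (\<integral>\<theta>. 0 \<partial>Q)" unfolding A_def
        by (intro Bochner_Integration.integral_cong) (auto simp: h_def tpow_def indicator_def dest: x')
      then show "A l = 0" by simp
    qed
    \<comment> \<open>Because levels increase with the cell index, only the groups strictly above
      that of \<open>x\<close> and the group of \<open>x\<close> itself remain.\<close>
    have cutoff: "(\<Sum>l<L. f l) = (\<Sum>l<L. if i0 < level \<Phi> l then f l else 0) + (\<Sum>l\<in>G i0. f l)"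
      if f: "\<And>l. l < l0 \<Longrightarrow> f l = 0" for f :: "nat \<Rightarrow> real"
    proof -
      have "(\<Sum>l<L. f l) = (\<Sum>l<L. (if i0 < level \<Phi> l then f l else 0) + (if level \<Phi> l = i0 then f l else 0))"
        using f before by (intro sum.cong) (auto simp: not_less_iff_gr_or_eq)
      also have "\<dots> = (\<Sum>l<L. if i0 < level \<Phi> l then f l else 0) + (\<Sum>l<L. if level \<Phi> l = i0 then f l else 0)"
        by (rule sum.distrib)
      also have "(\<Sum>l<L. if level \<Phi> l = i0 then f l else 0) = (\<Sum>l\<in>G i0. f l)"
        unfolding G_def by (rule sum.inter_filter[symmetric]) simp
      finally show ?thesis .
    qed
    have far: "\<bar>(\<Sum>l<L. if i0 < level \<Phi> l then v l * h (?z l) else 0) - (\<Sum>l<L. if i0 < level \<Phi> l then A l else 0)\<bar>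
       \<le> V * real k / real L"
    proof -
      have hz: "h (?z l) = (?z l - x) ^ (k - 1)" if "l0 < l" for l
        using gcell_order(2)[OF l0(2) gmid_in_gcell[OF L] that L] by (simp add: h_def tpow_def)
      have "(\<Sum>l<L. if i0 < level \<Phi> l then v l * h (?z l) else 0)
         = (\<Sum>l<L. if i0 < level \<Phi> l then v l * (?z l - x) ^ (k - 1) else 0)"
        using after hz by (intro sum.cong) auto
      also have "\<dots> = (\<Sum>i\<le>4 * N. if i0 < i then \<Sum>l\<in>G i. v l * (?z l - x) ^ (k - 1) else 0)" by (rule group)
      also have "\<dots> = (\<Sum>i\<le>4 * N. if i0 < i then \<Sum>l\<in>G i. \<nu> l * (?z l - x) ^ (k - 1) else 0)"
        using vmom k1 by (intro sum.cong refl if_cong moments_match_shifted_power) auto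
      also have "\<dots> = (\<Sum>l<L. if i0 < level \<Phi> l then \<nu> l * (?z l - x) ^ (k - 1) else 0)" by (rule group[symmetric])
      finally have E: "(\<Sum>l<L. if i0 < level \<Phi> l then v l * h (?z l) else 0)
         = (\<Sum>l<L. if i0 < level \<Phi> l then \<nu> l * (?z l - x) ^ (k - 1) else 0)" .
      have "(\<Sum>l<L. if i0 < level \<Phi> l then v l * h (?z l) else 0) - (\<Sum>l<L. if i0 < level \<Phi> l then A l else 0)
        = - (\<Sum>l<L. if i0 < level \<Phi> l then A l - \<nu> l * (?z l - x) ^ (k - 1) else 0)"
        unfolding E sum_negf[symmetric] sum_subtractf[symmetric] by (intro sum.cong) auto
      then have "\<bar>(\<Sum>l<L. if i0 < level \<Phi> l then v l * h (?z l) else 0) - (\<Sum>l<L. if i0 < level \<Phi> l then A l else 0)\<bar>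
        = \<bar>\<Sum>l<L. if i0 < level \<Phi> l then A l - \<nu> l * (?z l - x) ^ (k - 1) else 0\<bar>"
        by (simp only: abs_minus_cancel)
      also have "\<dots> \<le> (\<Sum>l<L. real k / real L * \<nu> l)"
      proof (rule order_trans[OF sum_abs sum_mono])
        fix l assume l: "l \<in> {..<L}"
        have "\<bar>A l - \<nu> l * (?z l - x) ^ (k - 1)\<bar> \<le> real k / real L * \<nu> l" if ll: "l0 < l"
          unfolding A_def
        proof (rule close[OF hm h1])
          fix \<theta> assume t: "\<theta> \<in> gcell L l" "0 < \<theta>" "\<theta> < 1"
          have xt: "x < \<theta>" "x < ?z l"
            using gcell_order(2)[OF l0(2) t(1) ll L] gcell_order(2)[OF l0(2) gmid_in_gcell[OF L] ll L] by auto
          have "norm ((\<theta> - x) ^ (k - 1) - (?z l - x) ^ (k - 1)) \<le> real (k - 1) * norm ((\<theta> - x) - (?z l - x))"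
            using t gmid_bounds[OF L, of l] l xt x by (intro norm_power_diff) auto
          also have "\<dots> \<le> real k * (1 / real L)"
            using gmid_near[OF t(1) L] Lp by (intro mult_mono) (auto simp: field_simps)
          finally show "\<bar>h \<theta> - (?z l - x) ^ (k - 1)\<bar> \<le> real k / real L" using xt by (simp add: h_def tpow_def)
        qed auto
        then show "\<bar>if i0 < level \<Phi> l then A l - \<nu> l * (?z l - x) ^ (k - 1) else 0\<bar> \<le> real k / real L * \<nu> l"
          using after[of l] nu0[of l] by auto
      qed
      also have "\<dots> = V * real k / real L"
        by (simp add: Vsum sum_distrib_left sum_distrib_right sum_divide_distrib mult.commute)
      finally show ?thesis .
    qed
    define X where "X = V / real N ^ k + \<nu> l0"
    have near: "(\<Sum>l\<in>G i0. A l) \<le> X" "(\<Sum>l\<in>G i0. v l * h (?z l)) \<le> X"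
    proof -
      have l0G: "l0 \<in> G i0" using l0 by (simp add: G_def i0_def)
      \<comment> \<open>\<open>c\<close> bounds the truncated power on the group: \<open>1\<close>
        for a single cell, whose whole mass \<open>\<nu> l0\<close> is then charged, and
        \<open>N^(-(k-1))\<close> for a group of width at most \<open>1 / N\<close>.\<close>
      have "\<exists>c\<ge>0. (\<forall>l\<in>G i0. \<forall>\<theta>\<in>gcell L l. \<theta> < 1 \<longrightarrow> h \<theta> \<le> c) \<and> c * (\<Sum>l\<in>G i0. \<nu> l) \<le> X"
      proof (cases "G i0 = {l0}")
        case True
        have "1 * (\<Sum>l\<in>G i0. \<nu> l) \<le> X" using V1 True by (simp add: X_def)
        moreover have "h \<theta> \<le> 1" if "\<theta> < 1" for \<theta> using h1[OF that] by linarith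
        ultimately show ?thesis by (intro exI[of _ 1]) auto
      next
        case False
        define mn mx where "mn = Min (G i0)" and "mx = Max (G i0)"
        have mm: "mn \<in> G i0" "mx \<in> G i0" "\<And>l. l \<in> G i0 \<Longrightarrow> mn \<le> l \<and> l \<le> mx"
          unfolding mn_def mx_def using Min_in[OF finG] Max_in[OF finG] Min_le[OF finG] Max_ge[OF finG] l0G by blast+
        obtain l1 where l1: "l1 \<in> G i0" "l1 \<noteq> l0" using False l0G by auto
        have lt: "mn < mx" using mm(3)[OF l0G] mm(3)[OF l1(1)] l1(2) by linarith
        have "level \<Phi> mn = level \<Phi> mx" using mm by (simp add: G_def)
        from level_eq_imp_osc[OF Phi_mono Phi0 lt this]
        have osc: "\<Phi> (Suc mx) - \<Phi> mn < 1" .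
        have "(\<Sum>m<Suc mx. \<nu> m) - (\<Sum>m<mn. \<nu> m) = (\<Sum>m\<in>{mn..mx}. \<nu> m)"
        proof -
          have "{..<Suc mx} = {..<mn} \<union> {mn..mx}" using lt by auto
          then have "(\<Sum>m<Suc mx. \<nu> m) = (\<Sum>m\<in>{..<mn} \<union> {mn..mx}. \<nu> m)" by (rule arg_cong)
          also have "\<dots> = (\<Sum>m<mn. \<nu> m) + (\<Sum>m\<in>{mn..mx}. \<nu> m)" by (rule sum.union_disjoint) auto
          finally show ?thesis by simp
        qed
        then have "\<Phi> (Suc mx) - \<Phi> mn = real N * ((real (Suc mx) - real mn) / real L) + real N * ((\<Sum>m\<in>{mn..mx}. \<nu> m) / V)"
          by (simp only: \<Phi>_def) (simp add: algebra_simps diff_divide_distrib add_divide_distrib)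
        moreover have "0 \<le> (real (Suc mx) - real mn) / real L" "0 \<le> (\<Sum>m\<in>{mn..mx}. \<nu> m) / V"
          using lt V1 nu0 by (auto intro!: divide_nonneg_nonneg sum_nonneg)
        ultimately have o: "real N * ((real (Suc mx) - real mn) / real L) \<le> 1" "real N * ((\<Sum>m\<in>{mn..mx}. \<nu> m) / V) \<le> 1"
          using osc Np mult_nonneg_nonneg[of "real N"] by (smt (verit))+
        have d: "(real mx + 1) / real L - real mn / real L \<le> 1 / real N"
        proof -
          have "(real (Suc mx) - real mn) / real L \<le> 1 / real N"
            unfolding pos_le_divide_eq[OF Np] using o(1) by (simp only: mult.commute)
          then show ?thesis by (simp add: diff_divide_distrib[symmetric] add.commute)
        qed
        have n: "(\<Sum>m\<in>{mn..mx}. \<nu> m) \<le> V / real N" using o(2) Np V1 by (simp add: field_simps)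
        have "(\<Sum>l\<in>G i0. \<nu> l) \<le> (\<Sum>m\<in>{mn..mx}. \<nu> m)" using mm nu0 by (intro sum_mono2) auto
        then have "(1 / real N) ^ (k - 1) * (\<Sum>l\<in>G i0. \<nu> l) \<le> (1 / real N) ^ (k - 1) * (V / real N)"
          using n by (intro mult_left_mono) auto
        also have "\<dots> = V / real N ^ k" using k1 by (cases k) (auto simp: power_one_over)
        also have "\<dots> \<le> X" using nu0 by (simp add: X_def)
        finally have c: "(1 / real N) ^ (k - 1) * (\<Sum>l\<in>G i0. \<nu> l) \<le> X" .
        have "h \<theta> \<le> (1 / real N) ^ (k - 1)" if "l \<in> G i0" "\<theta> \<in> gcell L l" for l \<theta>
        proof (cases "x < \<theta>")
          case True
          have "\<theta> \<le> (real l + 1) / real L" using that by (simp add: gcell_def)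
          also have "\<dots> \<le> (real mx + 1) / real L" using mm(3)[OF that(1)] by (intro divide_right_mono) auto
          finally have "\<theta> \<le> (real mx + 1) / real L" .
          moreover have "real mn / real L \<le> real l0 / real L" using mm(3)[OF l0G] by (intro divide_right_mono) auto
          then have "real mn / real L \<le> x" using l0 by (simp add: gcell_def)
          ultimately have "\<theta> - x \<le> 1 / real N" using d by linarith
          then show ?thesis using True by (simp add: h_def tpow_def power_mono)
        qed (simp add: h_def tpow_def)
        then show ?thesis using c by (intro exI[of _ "(1 / real N) ^ (k - 1)"]) auto
      qed
      then obtain c where c: "0 \<le> c" "\<And>l \<theta>. l \<in> G i0 \<Longrightarrow> \<theta> \<in> gcell L l \<Longrightarrow> \<theta> < 1 \<Longrightarrow> h \<theta> \<le> c" "c * (\<Sum>l\<in>G i0. \<nu> l) \<le> X"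
        by blast
      have "(\<Sum>l\<in>G i0. A l) \<le> (\<Sum>l\<in>G i0. c * \<nu> l)"
      proof (rule sum_mono)
        fix l assume l: "l \<in> G i0"
        have "A l \<le> (\<integral>\<theta>. c * (indicator (gcell L l) \<theta> * (1 / \<theta> ^ k)) \<partial>Q)" unfolding A_def
        proof (rule integral_mono)
          show "integrable Q (\<lambda>\<theta>. indicator (gcell L l) \<theta> * (h \<theta> / \<theta> ^ k))" using hm h1 by (rule intc)
          show "integrable Q (\<lambda>\<theta>. c * (indicator (gcell L l) \<theta> * (1 / \<theta> ^ k)))" using intnu by (rule integrable_mult_right)
          show "indicator (gcell L l) \<theta> * (h \<theta> / \<theta> ^ k) \<le> c * (indicator (gcell L l) \<theta> * (1 / \<theta> ^ k))" if "\<theta> \<in> space Q" for \<theta>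
            using that c(2)[OF l, of \<theta>] by (auto simp: indicator_def space_Q divide_right_mono)
        qed
        also have "\<dots> = c * \<nu> l" unfolding \<nu>_def by (rule integral_mult_right_zero)
        finally show "A l \<le> c * \<nu> l" .
      qed
      then show "(\<Sum>l\<in>G i0. A l) \<le> X" using c(3) by (simp add: sum_distrib_left)
      have "(\<Sum>l\<in>G i0. v l * h (?z l)) \<le> (\<Sum>l\<in>G i0. v l * c)"
        using c(2) v0 gmid_in_gcell[OF L] gmid_bounds[OF L] by (intro sum_mono mult_left_mono) (auto simp: G_def)
      also have "\<dots> = c * (\<Sum>l\<in>G i0. \<nu> l)" using vmom[of 0 i0] by (simp add: sum_distrib_left[symmetric] mult.commute)
      finally show "(\<Sum>l\<in>G i0. v l * h (?z l)) \<le> X" using c(3) by simp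
    qed
    have nn: "0 \<le> (\<Sum>l\<in>G i0. A l)" "0 \<le> (\<Sum>l\<in>G i0. v l * h (?z l))"
      using A0 v0 h0 by (auto intro!: sum_nonneg simp: G_def)
    have "\<bar>(\<Sum>l<L. v l * h (?z l)) - (\<Sum>l<L. A l)\<bar> \<le> V * real k / real L + X"
      using far near nn cutoff[of A] cutoff[of "\<lambda>l. v l * h (?z l)"] zero by simp
    then have "real k * \<bar>(\<Sum>l<L. v l * h (?z l)) - (\<Sum>l<L. A l)\<bar> \<le> real k * (V * real k / real L + X)"
      by (intro mult_left_mono) auto
    then show ?thesis unfolding eQ eZ right_diff_distrib[symmetric] X_def by (simp add: abs_mult add.assoc)
  qed
  have "(\<integral>\<^sup>+ x. ennreal (((\<Sum>l\<in>Z. w l * psi k x (?z l)) - (\<integral>\<theta>. psi k x \<theta> \<partial>Q))\<^sup>2) * indicator {0<..<1} x \<partial>lborel)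
    \<le> (\<integral>\<^sup>+ x. ennreal (3 * (real k)\<^sup>2 * ((V * real k / real L)\<^sup>2 + (V / real N ^ k)\<^sup>2)) * indicator {0<..<1} x
        + (\<Sum>l<L. ennreal (3 * (real k)\<^sup>2 * (\<nu> l)\<^sup>2) * indicator (gcell L l) x) \<partial>lborel)"
  proof (rule nn_integral_mono)
    fix x :: real
    show "ennreal (((\<Sum>l\<in>Z. w l * psi k x (?z l)) - (\<integral>\<theta>. psi k x \<theta> \<partial>Q))\<^sup>2) * indicator {0<..<1} x
      \<le> ennreal (3 * (real k)\<^sup>2 * ((V * real k / real L)\<^sup>2 + (V / real N ^ k)\<^sup>2)) * indicator {0<..<1} x
        + (\<Sum>l<L. ennreal (3 * (real k)\<^sup>2 * (\<nu> l)\<^sup>2) * indicator (gcell L l) x)"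
    proof (cases "x \<in> {0<..<1}")
      case True
      then obtain l0 where l0: "l0 < L" "x \<in> gcell L l0" using gcell_cover[of x L] L by auto
      have "((\<Sum>l\<in>Z. w l * psi k x (?z l)) - (\<integral>\<theta>. psi k x \<theta> \<partial>Q))\<^sup>2
         \<le> (real k * (V * real k / real L + V / real N ^ k + \<nu> l0))\<^sup>2"
        using power_mono[OF point[OF _ _ l0] abs_ge_zero, of 2] True by (simp only: power2_abs greaterThanLessThan_iff)
      also have "\<dots> \<le> 3 * (real k)\<^sup>2 * ((V * real k / real L)\<^sup>2 + (V / real N ^ k)\<^sup>2 + (\<nu> l0)\<^sup>2)"
      proof -
        have sq: "(a + b + c)\<^sup>2 \<le> 3 * (a\<^sup>2 + b\<^sup>2 + c\<^sup>2)" for a b c :: real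
        proof -
          have "0 \<le> (a - b)\<^sup>2 + (b - c)\<^sup>2 + (a - c)\<^sup>2" by simp
          then show ?thesis by (simp add: power2_eq_square algebra_simps)
        qed
        have "(real k)\<^sup>2 * (V * real k / real L + V / real N ^ k + \<nu> l0)\<^sup>2
          \<le> (real k)\<^sup>2 * (3 * ((V * real k / real L)\<^sup>2 + (V / real N ^ k)\<^sup>2 + (\<nu> l0)\<^sup>2))"
          by (intro mult_left_mono sq) auto
        then show ?thesis by (simp only: power_mult_distrib[of "real k"] mult.assoc mult.left_commute[of "(real k)\<^sup>2" 3])
      qed
      also have "\<dots> = 3 * (real k)\<^sup>2 * ((V * real k / real L)\<^sup>2 + (V / real N ^ k)\<^sup>2) + 3 * (real k)\<^sup>2 * (\<nu> l0)\<^sup>2"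
        by (simp add: algebra_simps)
      finally have "ennreal (((\<Sum>l\<in>Z. w l * psi k x (?z l)) - (\<integral>\<theta>. psi k x \<theta> \<partial>Q))\<^sup>2)
        \<le> ennreal (3 * (real k)\<^sup>2 * ((V * real k / real L)\<^sup>2 + (V / real N ^ k)\<^sup>2) + 3 * (real k)\<^sup>2 * (\<nu> l0)\<^sup>2)"
        by (rule ennreal_leI)
      also have "\<dots> = ennreal (3 * (real k)\<^sup>2 * ((V * real k / real L)\<^sup>2 + (V / real N ^ k)\<^sup>2)) + ennreal (3 * (real k)\<^sup>2 * (\<nu> l0)\<^sup>2)"
        by (rule ennreal_plus) auto
      also have "ennreal (3 * (real k)\<^sup>2 * (\<nu> l0)\<^sup>2) = ennreal (3 * (real k)\<^sup>2 * (\<nu> l0)\<^sup>2) * indicator (gcell L l0) x" using l0 by simp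
      also have "\<dots> \<le> (\<Sum>l<L. ennreal (3 * (real k)\<^sup>2 * (\<nu> l)\<^sup>2) * indicator (gcell L l) x)"
        using l0 by (intro member_le_sum[of l0 "{..<L}" "\<lambda>l. ennreal (3 * (real k)\<^sup>2 * (\<nu> l)\<^sup>2) * indicator (gcell L l) x"]) auto
      finally show ?thesis using True by (simp add: add_mono)
    qed simp
  qed
  also have "\<dots> = ennreal (3 * (real k)\<^sup>2 * ((V * real k / real L)\<^sup>2 + (V / real N ^ k)\<^sup>2))
      + (\<Sum>l<L. ennreal (3 * (real k)\<^sup>2 * (\<nu> l)\<^sup>2) * ennreal (1 / real L))"
  proof -
    have "(\<integral>\<^sup>+ x. (\<Sum>l<L. ennreal (3 * (real k)\<^sup>2 * (\<nu> l)\<^sup>2) * indicator (gcell L l) x) \<partial>lborel)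
      = (\<Sum>l<L. \<integral>\<^sup>+ x. ennreal (3 * (real k)\<^sup>2 * (\<nu> l)\<^sup>2) * indicator (gcell L l) x \<partial>lborel)"
      by (rule nn_integral_sum) measurable
    moreover have "(\<integral>\<^sup>+ x. ennreal (3 * (real k)\<^sup>2 * (\<nu> l)\<^sup>2) * indicator (gcell L l) x \<partial>lborel)
      = ennreal (3 * (real k)\<^sup>2 * (\<nu> l)\<^sup>2) * ennreal (1 / real L)" for l
      by (subst nn_integral_cmult_indicator) (simp_all only: emeasure_gcell[OF L] sets_lborel gcell_sets)
    moreover have "(\<integral>\<^sup>+ x. ennreal (3 * (real k)\<^sup>2 * ((V * real k / real L)\<^sup>2 + (V / real N ^ k)\<^sup>2)) * indicator {0<..<1} x
        + (\<Sum>l<L. ennreal (3 * (real k)\<^sup>2 * (\<nu> l)\<^sup>2) * indicator (gcell L l) x) \<partial>lborel)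
      = (\<integral>\<^sup>+ x. ennreal (3 * (real k)\<^sup>2 * ((V * real k / real L)\<^sup>2 + (V / real N ^ k)\<^sup>2)) * indicator {0<..<1::real} x \<partial>lborel)
        + (\<integral>\<^sup>+ x. (\<Sum>l<L. ennreal (3 * (real k)\<^sup>2 * (\<nu> l)\<^sup>2) * indicator (gcell L l) x) \<partial>lborel)"
      by (rule nn_integral_add) measurable
    moreover have "(\<integral>\<^sup>+ x. c * indicator {0<..<1::real} x \<partial>lborel) = c" for c
      by (subst nn_integral_cmult_indicator) auto
    ultimately show ?thesis by (simp only:)
  qed
  also have "(\<Sum>l<L. ennreal (3 * (real k)\<^sup>2 * (\<nu> l)\<^sup>2) * ennreal (1 / real L)) = ennreal (\<Sum>l<L. 3 * (real k)\<^sup>2 * (\<nu> l)\<^sup>2 * (1 / real L))"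
    by (subst sum_ennreal[symmetric]) (auto simp: ennreal_mult[symmetric])
  also have "ennreal (3 * (real k)\<^sup>2 * ((V * real k / real L)\<^sup>2 + (V / real N ^ k)\<^sup>2)) + \<dots>
     = ennreal (3 * (real k)\<^sup>2 * ((V * real k / real L)\<^sup>2 + (V / real N ^ k)\<^sup>2) + (\<Sum>l<L. 3 * (real k)\<^sup>2 * (\<nu> l)\<^sup>2 * (1 / real L)))"
    by (rule ennreal_plus[symmetric]) (auto intro!: sum_nonneg)
  also have "\<dots> \<le> ennreal (3 * (real k)\<^sup>2 * V\<^sup>2 * ((real k)\<^sup>2 / real L + 1 / real N ^ (2 * k) + 1 / real L))"
  proof (rule ennreal_leI)
    \<comment> \<open>The isolated cells cost \<open>\<nu> l\<close> squared times their length
      \<open>1 / L\<close>, and the sum of squares is at most the square of the total mass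
      \<open>V\<close>.\<close>
    have "(\<Sum>l<L. 3 * (real k)\<^sup>2 * (\<nu> l)\<^sup>2 * (1 / real L)) = 3 * (real k)\<^sup>2 * (1 / real L) * (\<Sum>l<L. (\<nu> l)\<^sup>2)"
      by (simp add: sum_distrib_left sum_divide_distrib mult_ac)
    also have "\<dots> \<le> 3 * (real k)\<^sup>2 * (1 / real L) * V\<^sup>2"
      unfolding Vsum using nu0 by (intro mult_left_mono sum_power_le_power_sum) auto
    finally have 1: "(\<Sum>l<L. 3 * (real k)\<^sup>2 * (\<nu> l)\<^sup>2 * (1 / real L)) \<le> 3 * (real k)\<^sup>2 * V\<^sup>2 * (1 / real L)" by (simp add: mult_ac)
    have "(V * real k / real L)\<^sup>2 \<le> V\<^sup>2 * ((real k)\<^sup>2 / real L)"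
    proof -
      have "1 / (real L)\<^sup>2 \<le> 1 / real L" using L by (intro divide_left_mono) (auto simp: power2_eq_square)
      then have "V\<^sup>2 * (real k)\<^sup>2 * (1 / (real L)\<^sup>2) \<le> V\<^sup>2 * (real k)\<^sup>2 * (1 / real L)" by (intro mult_left_mono) auto
      then show ?thesis by (simp add: power_divide power_mult_distrib)
    qed
    moreover have "(V / real N ^ k)\<^sup>2 = V\<^sup>2 * (1 / real N ^ (2 * k))" by (simp add: power_divide power_mult[symmetric] mult.commute)
    ultimately have "3 * (real k)\<^sup>2 * ((V * real k / real L)\<^sup>2 + (V / real N ^ k)\<^sup>2)
       \<le> 3 * (real k)\<^sup>2 * (V\<^sup>2 * ((real k)\<^sup>2 / real L) + V\<^sup>2 * (1 / real N ^ (2 * k)))"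
      by (intro mult_left_mono) auto
    then show "3 * (real k)\<^sup>2 * ((V * real k / real L)\<^sup>2 + (V / real N ^ k)\<^sup>2) + (\<Sum>l<L. 3 * (real k)\<^sup>2 * (\<nu> l)\<^sup>2 * (1 / real L))
      \<le> 3 * (real k)\<^sup>2 * V\<^sup>2 * ((real k)\<^sup>2 / real L + 1 / real N ^ (2 * k) + 1 / real L)"
      using 1 by (simp add: distrib_left mult.assoc)
  qed
  finally have L2: "(\<integral>\<^sup>+ x. ennreal (((\<Sum>l\<in>Z. w l * psi k x (?z l)) - (\<integral>\<theta>. psi k x \<theta> \<partial>Q))\<^sup>2) * indicator {0<..<1} x \<partial>lborel)
       \<le> ennreal (3 * (real k)\<^sup>2 * V\<^sup>2 * ((real k)\<^sup>2 / real L + 1 / real N ^ (2 * k) + 1 / real L))" .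
  have w0: "\<forall>l\<in>Z. 0 \<le> w l" using v0 gmid_bounds[OF L] by (auto simp: Z_def w_def less_imp_le)
  show ?thesis
    using cardZ mass L2 w0 by (intro exI[of _ Z] exI[of _ w]) (auto simp: Z_def)
qed

end

section \<open>Piecewise polynomial approximation of unbounded mixtures\<close>

context mixing
begin

text \<open>The part of the mixture at \<open>x\<close> that comes from scales \<open>\<theta>\<close> in \<open>(x, b]\<close>.\<close>

definition rem :: "real \<Rightarrow> real \<Rightarrow> real" where
  "rem b x = \<beta> k * (real k * (\<integral>\<theta>. indicator {..b} \<theta> * (tpow (k - 1) x \<theta> / \<theta> ^ k) \<partial>Q))"

lemma rem_integrable:
  assumes "0 < x"
  shows "integrable Q (\<lambda>\<theta>. indicator {..b} \<theta> * (tpow m x \<theta> / \<theta> ^ k))"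
proof (rule Bochner_Integration.integrable_bound[OF tmom_integrable[OF assms, of m]])
  have "indicator {..b} \<in> borel_measurable (borel :: real measure)" by measurable
  then show "(\<lambda>\<theta>. indicator {..b} \<theta> * (tpow m x \<theta> / \<theta> ^ k)) \<in> borel_measurable Q"
    by (intro borel_measurable_times Q_measurable[of "indicator {..b}"] borel_measurable_integrable[OF tmom_integrable[OF assms]]) auto
qed (auto simp: indicator_def intro!: AE_I2)

lemma rem_nonneg: "0 \<le> rem b x"
  unfolding rem_def
  by (intro mult_nonneg_nonneg beta_nonneg Bochner_Integration.integral_nonneg_AE AE_I2) (auto simp: space_Q tpow_nonneg)

lemma rem_mono:
  assumes "0 < x" "b \<le> b'"
  shows "rem b x \<le> rem b' x"
  unfolding rem_def using assms
  by (intro mult_left_mono integral_mono rem_integrable) (auto simp: beta_nonneg indicator_def space_Q tpow_nonneg)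

lemma rem_le_gmix:
  assumes "0 < x"
  shows "rem b x \<le> gmix k \<beta> Q x"
proof -
  have "rem b x \<le> \<beta> k * (real k * (\<integral>\<theta>. tpow (k - 1) x \<theta> / \<theta> ^ k \<partial>Q))"
    unfolding rem_def using assms
    by (intro mult_left_mono integral_mono rem_integrable tmom_integrable) (auto simp: beta_nonneg indicator_def space_Q tpow_nonneg)
  also have "real k * (\<integral>\<theta>. tpow (k - 1) x \<theta> / \<theta> ^ k \<partial>Q) = (\<integral>\<theta>. psi k x \<theta> \<partial>Q)"
    unfolding psi_eq_tpow[OF assms k1] by (rule integral_mult_right_zero[symmetric])
  also have "\<beta> k * \<dots> \<le> gmix k \<beta> Q x"
    unfolding gmix_def
    by (intro add_increasing sum_nonneg mult_nonneg_nonneg beta_nonneg psi_nonneg) auto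
  finally show ?thesis .
qed

text \<open>The mass of \<open>\<theta>^(-k) dQ\<close> on \<open>(x, b]\<close> has no bound
  uniform in \<open>Q\<close> and \<open>a0\<close>; only its integral against
  \<open>(\<theta> - a0)^(k-1)\<close> has one, through the value of the mixture at
  \<open>a0\<close>. On this interval \<open>\<theta> - x \<le> b - x\<close> and
  \<open>\<theta> - a0 \<ge> x - a0\<close>, which compares the two weights.\<close>

lemma rem_local:
  assumes "0 < a0" "a0 < x" "x \<le> b"
  shows "rem b x \<le> ((b - x) / (x - a0)) ^ (k - 1) * (rem b a0 - rem x a0)"
proof -
  define M where "M = (b - x) / (x - a0)"
  have M: "0 \<le> M" "M * (x - a0) = b - x" using assms by (auto simp: M_def)
  have "(\<integral>\<theta>. indicator {..b} \<theta> * (tpow (k - 1) x \<theta> / \<theta> ^ k) \<partial>Q)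
    \<le> (\<integral>\<theta>. M ^ (k - 1) * (indicator {..b} \<theta> * (tpow (k - 1) a0 \<theta> / \<theta> ^ k) - indicator {..x} \<theta> * (tpow (k - 1) a0 \<theta> / \<theta> ^ k)) \<partial>Q)"
  proof (rule integral_mono)
    show "integrable Q (\<lambda>\<theta>. indicator {..b} \<theta> * (tpow (k - 1) x \<theta> / \<theta> ^ k))" using assms by (intro rem_integrable) auto
    show "integrable Q (\<lambda>\<theta>. M ^ (k - 1) * (indicator {..b} \<theta> * (tpow (k - 1) a0 \<theta> / \<theta> ^ k) - indicator {..x} \<theta> * (tpow (k - 1) a0 \<theta> / \<theta> ^ k)))"
      using assms by (intro integrable_mult_right Bochner_Integration.integrable_diff rem_integrable) auto
    fix \<theta> assume "\<theta> \<in> space Q"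
    then have t: "0 < \<theta>" by (simp add: space_Q)
    show "indicator {..b} \<theta> * (tpow (k - 1) x \<theta> / \<theta> ^ k)
      \<le> M ^ (k - 1) * (indicator {..b} \<theta> * (tpow (k - 1) a0 \<theta> / \<theta> ^ k) - indicator {..x} \<theta> * (tpow (k - 1) a0 \<theta> / \<theta> ^ k))"
    proof (cases "x < \<theta> \<and> \<theta> \<le> b")
      case True
      have "\<theta> - x \<le> M * (x - a0)" using M True by simp
      also have "\<dots> \<le> M * (\<theta> - a0)" using M True by (intro mult_left_mono) auto
      finally have "(\<theta> - x) ^ (k - 1) \<le> (M * (\<theta> - a0)) ^ (k - 1)" using True by (intro power_mono) auto
      then have "(\<theta> - x) ^ (k - 1) / \<theta> ^ k \<le> M ^ (k - 1) * (\<theta> - a0) ^ (k - 1) / \<theta> ^ k"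
        using t by (intro divide_right_mono) (auto simp: power_mult_distrib)
      then show ?thesis using True assms by (simp add: tpow_def)
    next
      case False
      then show ?thesis using assms by (auto simp: tpow_def indicator_def)
    qed
  qed
  also have "\<dots> = M ^ (k - 1) * ((\<integral>\<theta>. indicator {..b} \<theta> * (tpow (k - 1) a0 \<theta> / \<theta> ^ k) \<partial>Q)
      - (\<integral>\<theta>. indicator {..x} \<theta> * (tpow (k - 1) a0 \<theta> / \<theta> ^ k) \<partial>Q))"
    unfolding integral_mult_right_zero Bochner_Integration.integral_diff[OF rem_integrable[OF assms(1)] rem_integrable[OF assms(1)]] ..
  finally have "\<beta> k * (real k * (\<integral>\<theta>. indicator {..b} \<theta> * (tpow (k - 1) x \<theta> / \<theta> ^ k) \<partial>Q)) \<le> \<beta> k * (real k * \<dots>)"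
    by (intro mult_left_mono beta_nonneg) auto
  then show ?thesis unfolding rem_def M_def by (simp add: algebra_simps)
qed

text \<open>For scales beyond \<open>b\<close>, both \<open>\<theta> - x\<close> and
  \<open>1 - x\<close> are \<open>b - x\<close> plus a nonnegative number, and expanding gives
  nonnegative coefficients. This sign later bounds each coefficient by a value of the mixture and
  keeps the rounded polynomials below \<open>K\<close>.\<close>

lemma gmix_tail_expansion:
  assumes b: "0 < b" "b \<le> 1"
  shows "\<exists>c. (\<forall>i<k. 0 \<le> c i) \<and> (\<forall>x. 0 < x \<longrightarrow> x \<le> b \<longrightarrow> x < 1 \<longrightarrow>
    gmix k \<beta> Q x = (\<Sum>i<k. c i * (b - x) ^ i) + rem b x)"
proof -
  define c where "c i = (\<Sum>j<k. \<beta> j * ((real j + 1) * (real (j choose i) * (1 - b) ^ (j - i))))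
     + \<beta> k * (real k * (real ((k - 1) choose i) * tmom (k - 1 - i) b))" for i
  have tm0: "0 \<le> tmom m b" for m unfolding tmom_def
    by (intro Bochner_Integration.integral_nonneg_AE AE_I2) (auto simp: space_Q tpow_nonneg)
  have c0: "0 \<le> c i" for i unfolding c_def
    using b tm0 by (auto intro!: add_nonneg_nonneg sum_nonneg mult_nonneg_nonneg beta_nonneg)
  have "gmix k \<beta> Q x = (\<Sum>i<k. c i * (b - x) ^ i) + rem b x" if x: "0 < x" "x \<le> b" "x < 1" for x
  proof -
    have binom: "(y - x) ^ m = (\<Sum>i<k. real (m choose i) * (y - b) ^ (m - i) * (b - x) ^ i)" if "m < k" for y m
    proof -
      have "(y - x) ^ m = ((b - x) + (y - b)) ^ m" by simp
      also have "\<dots> = (\<Sum>i\<le>m. real (m choose i) * (b - x) ^ i * (y - b) ^ (m - i))"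
        by (rule binomial_ring)
      also have "\<dots> = (\<Sum>i<k. real (m choose i) * (b - x) ^ i * (y - b) ^ (m - i))"
        using that by (intro sum.mono_neutral_left) auto
      finally show ?thesis by (simp add: mult_ac)
    qed
    have 1: "(\<Sum>j<k. \<beta> j * ((real j + 1) * (1 - x) ^ j))
      = (\<Sum>i<k. (\<Sum>j<k. \<beta> j * ((real j + 1) * (real (j choose i) * (1 - b) ^ (j - i)))) * (b - x) ^ i)"
    proof -
      have "(\<Sum>j<k. \<beta> j * ((real j + 1) * (1 - x) ^ j))
        = (\<Sum>j<k. \<Sum>i<k. \<beta> j * ((real j + 1) * (real (j choose i) * (1 - b) ^ (j - i))) * (b - x) ^ i)"
        by (intro sum.cong refl) (simp add: binom sum_distrib_left mult.assoc)
      also have "\<dots> = (\<Sum>i<k. \<Sum>j<k. \<beta> j * ((real j + 1) * (real (j choose i) * (1 - b) ^ (j - i))) * (b - x) ^ i)"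
        by (rule sum.swap)
      finally show ?thesis by (simp add: sum_distrib_right)
    qed
    have split: "tpow (k - 1) x \<theta> / \<theta> ^ k = indicator {..b} \<theta> * (tpow (k - 1) x \<theta> / \<theta> ^ k)
       + (\<Sum>i<k. real ((k - 1) choose i) * (b - x) ^ i * (tpow (k - 1 - i) b \<theta> / \<theta> ^ k))" for \<theta>
    proof (cases "b < \<theta>")
      case True
      have "tpow (k - 1) x \<theta> = (\<Sum>i<k. real ((k - 1) choose i) * (\<theta> - b) ^ (k - 1 - i) * (b - x) ^ i)"
        using True x k1 binom[of "k - 1" \<theta>] by (simp only: tpow_def if_True) auto
      then show ?thesis using True by (simp add: tpow_def sum_divide_distrib mult_ac)
    qed (simp add: tpow_def)
    have int_i: "integrable Q (\<lambda>\<theta>. real ((k - 1) choose i) * (b - x) ^ i * (tpow (k - 1 - i) b \<theta> / \<theta> ^ k))" for i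
      using tmom_integrable[OF b(1)] by (rule integrable_mult_right)
    have "tmom (k - 1) x = (\<integral>\<theta>. indicator {..b} \<theta> * (tpow (k - 1) x \<theta> / \<theta> ^ k)
       + (\<Sum>i<k. real ((k - 1) choose i) * (b - x) ^ i * (tpow (k - 1 - i) b \<theta> / \<theta> ^ k)) \<partial>Q)"
      unfolding tmom_def by (rule Bochner_Integration.integral_cong[OF refl split])
    also have "\<dots> = (\<integral>\<theta>. indicator {..b} \<theta> * (tpow (k - 1) x \<theta> / \<theta> ^ k) \<partial>Q)
       + (\<integral>\<theta>. (\<Sum>i<k. real ((k - 1) choose i) * (b - x) ^ i * (tpow (k - 1 - i) b \<theta> / \<theta> ^ k)) \<partial>Q)"
      using x int_i by (intro Bochner_Integration.integral_add rem_integrable Bochner_Integration.integrable_sum) auto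
    also have "(\<integral>\<theta>. (\<Sum>i<k. real ((k - 1) choose i) * (b - x) ^ i * (tpow (k - 1 - i) b \<theta> / \<theta> ^ k)) \<partial>Q)
       = (\<Sum>i<k. real ((k - 1) choose i) * (b - x) ^ i * tmom (k - 1 - i) b)"
      unfolding tmom_def using int_i by (subst Bochner_Integration.integral_sum) (auto simp only: integral_mult_right_zero)
    finally have "\<beta> k * (real k * tmom (k - 1) x) = rem b x
      + (\<Sum>i<k. \<beta> k * (real k * (real ((k - 1) choose i) * tmom (k - 1 - i) b)) * (b - x) ^ i)"
      by (simp add: rem_def distrib_left sum_distrib_left mult_ac)
    then show ?thesis unfolding gmix_eq_tmom[OF x(1,3)] 1 c_def by (simp add: distrib_right sum.distrib)
  qed
  then show ?thesis using c0 by blast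
qed

end

text \<open>A piece \<open>(s, t, e)\<close> encodes a polynomial of degree less than \<open>k\<close> on the grid interval
  \<open>(s/L, t/L]\<close>, with coefficients \<open>e i / R\<close> in the powers of \<open>(t - L x) / (t - s)\<close>.\<close>

definition piece :: "nat \<Rightarrow> nat \<Rightarrow> nat \<Rightarrow> nat \<times> nat \<times> (nat \<Rightarrow> nat) \<Rightarrow> real \<Rightarrow> real" where
  "piece k L R = (\<lambda>(s, t, e) x. if x \<in> {real s / real L<..real t / real L}
     then (\<Sum>i<k. real (e i) / real R * ((real t - real L * x) / (real t - real s)) ^ i) else 0)"

definition piece_codes :: "nat \<Rightarrow> nat \<Rightarrow> nat \<Rightarrow> nat \<Rightarrow> (nat \<times> nat \<times> (nat \<Rightarrow> nat)) set" where
  "piece_codes k L R K = {..L} \<times> {..L} \<times> PiE {..<k} (\<lambda>_. {..K * R})"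

definition pieces_sum :: "nat \<Rightarrow> nat \<Rightarrow> nat \<Rightarrow> nat \<Rightarrow> (nat \<Rightarrow> nat \<times> nat \<times> (nat \<Rightarrow> nat)) \<Rightarrow> real \<Rightarrow> real" where
  "pieces_sum J k L R c x = (\<Sum>i<J. piece k L R (c i) x)"

lemma measurable_piece[measurable]: "piece k L R c \<in> borel_measurable borel"
  unfolding piece_def by (cases c) simp

lemma measurable_pieces_sum[measurable]: "pieces_sum J k L R c \<in> borel_measurable borel"
  unfolding pieces_sum_def[abs_def] by measurable

lemma finite_piece_codes: "finite (piece_codes k L R K)"
  by (auto simp: piece_codes_def intro!: finite_PiE)

lemma card_piece_codes: "card (piece_codes k L R K) = (L + 1)\<^sup>2 * (K * R + 1) ^ k"
  by (simp only: piece_codes_def card_cartesian_product card_PiE finite_lessThan card_atMost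
      prod_constant card_lessThan Suc_eq_plus1 power2_eq_square mult.assoc)

text \<open>By convexity the left side lies below its chord on \<open>[0, 1]\<close>. The bound
  converts a step on the root scale into a relative step in \<open>x - a0\<close>.\<close>

lemma one_plus_power_minus_one_le:
  fixes y :: real
  assumes "0 \<le> y" "y \<le> 1"
  shows "(1 + y) ^ m - 1 \<le> 2 ^ m * y"
proof (induction m)
  case (Suc m)
  have "(1 + y) ^ m \<le> 2 ^ m" using assms by (intro power_mono) auto
  have "(1 + y) ^ Suc m - 1 = ((1 + y) ^ m - 1) + y * (1 + y) ^ m" by (simp add: algebra_simps)
  also have "\<dots> \<le> 2 ^ m * y + y * 2 ^ m"
    using Suc assms \<open>(1 + y) ^ m \<le> 2 ^ m\<close> by (intro add_mono mult_left_mono) auto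
  finally show ?case by (simp add: algebra_simps)
qed (use assms in simp)

lemma nn_integral_powr_shift:
  fixes a p :: real
  assumes "0 \<le> a" "- 1 < p"
  shows "(\<integral>\<^sup>+ x. ennreal ((x - a) powr p) * indicator {a<..<1} x \<partial>lborel) \<le> ennreal (1 / (p + 1))"
proof -
  have "(\<integral>\<^sup>+ x. ennreal ((x - a) powr p) * indicator {a<..<1} x \<partial>lborel)
     = (\<integral>\<^sup>+ x. ennreal ((a + 1 * x - a) powr p) * indicator {a<..<1} (a + 1 * x) \<partial>lborel)"
    by (subst nn_integral_real_affine[where c=1 and t=a]) (auto simp: add.commute)
  also have "\<dots> \<le> (\<integral>\<^sup>+ x. ennreal (x powr p) * indicator {0..1} x \<partial>lborel)"
    using assms by (intro nn_integral_mono) (auto simp: indicator_def)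
  also have "\<dots> = ennreal (1 powr (p + 1) / (p + 1))"
    using has_integral_powr_from_0[of p 1] assms by (intro nn_integral_has_integral_lebesgue') auto
  finally show ?thesis by simp
qed

lemma nn_integral_add4:
  assumes [measurable]: "f1 \<in> borel_measurable M" "f2 \<in> borel_measurable M" "f3 \<in> borel_measurable M" "f4 \<in> borel_measurable M"
  shows "(\<integral>\<^sup>+ x. (f1 x + f2 x) + (f3 x + f4 x) \<partial>M)
    = ((\<integral>\<^sup>+ x. f1 x \<partial>M) + (\<integral>\<^sup>+ x. f2 x \<partial>M)) + ((\<integral>\<^sup>+ x. f3 x \<partial>M) + (\<integral>\<^sup>+ x. f4 x \<partial>M))"
  by (simp add: nn_integral_add)

context mixing
begin

text \<open>The pieces are level groups of grid cells right of \<open>a0\<close>, plus one piece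
  carrying the constant \<open>K\<close> on the left. On a piece the polynomial keeps the
  contribution of scales beyond its right end; the omitted part \<open>rem\<close> is nonnegative
  and is controlled by \<open>rem_local\<close>. Everything is described by integers in ranges that
  do not depend on the mixture.\<close>

lemma cover_function:
  assumes N: "1 \<le> N" and L: "1 \<le> L" and R: "1 \<le> R" and K: "1 \<le> (K::nat)"
  shows "\<exists>c\<in>PiE {..<4 * N + 2} (\<lambda>_. piece_codes k L R K). \<exists>a0.
     (\<forall>x. 0 \<le> pieces_sum (4 * N + 2) k L R c x \<and> pieces_sum (4 * N + 2) k L R c x \<le> real K)
   \<and> (\<forall>x. 0 < x \<longrightarrow> x \<le> a0 \<longrightarrow> pieces_sum (4 * N + 2) k L R c x = real K)
   \<and> (\<forall>x. 0 < x \<longrightarrow> x < a0 - 1 / real L \<longrightarrow> real K \<le> gmix k \<beta> Q x)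
   \<and> (\<forall>x. a0 < x \<longrightarrow> gmix k \<beta> Q x \<le> real K)
   \<and> (\<integral>\<^sup>+ x. ennreal ((gmix k \<beta> Q x - pieces_sum (4 * N + 2) k L R c x)\<^sup>2) * indicator {a0<..<1} x \<partial>lborel)
      \<le> ennreal (2 * (real k / real R)\<^sup>2 + 2 * (((4 ^ k) ^ (k - 1) * real K)\<^sup>2 / real N ^ (2 * k) * real k
          + (real K)\<^sup>2 / real N ^ (2 * k) + (real K)\<^sup>2 * real (4 * N + 1) / real L))"
proof -
  let ?g = "gmix k \<beta> Q"
  have Lp: "0 < real L" and Np: "0 < real N" and Rp: "0 < real R" and Kp: "0 < real K" using L N R K by auto
  \<comment> \<open>The mixture vanishes at \<open>1\<close>, so the last grid point
    qualifies.\<close>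
  have "\<exists>l. 1 \<le> l \<and> ?g (real l / real L) \<le> real K"
    using L gmix_eq_0[of 1] by (intro exI[of _ L]) auto
  define j0 where "j0 = (LEAST l. 1 \<le> l \<and> ?g (real l / real L) \<le> real K)"
  have j0: "1 \<le> j0" "?g (real j0 / real L) \<le> real K"
    unfolding j0_def using LeastI_ex[OF \<open>\<exists>l. _ l\<close>] by auto
  have j0L: "j0 \<le> L"
    unfolding j0_def using L gmix_eq_0[of 1] by (intro Least_le) auto
  have j0_min: "real K < ?g (real l / real L)" if "1 \<le> l" "l < j0" for l
    using not_less_Least[of l "\<lambda>l. 1 \<le> l \<and> ?g (real l / real L) \<le> real K"] that unfolding j0_def by auto
  \<comment> \<open>The crossing of the level \<open>K\<close>, rounded up to the grid. Between the
    crossing and \<open>a0\<close> the mixture may be below \<open>K\<close>, so the left bound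
    holds only up to \<open>a0 - 1 / L\<close>.\<close>
  define a0 where "a0 = real j0 / real L"
  have a0: "0 < a0" "a0 \<le> 1" "?g a0 \<le> real K" using j0 j0L Lp by (auto simp: a0_def)
  have right: "?g x \<le> real K" if "a0 < x" for x using gmix_antimono[of a0 x] a0 that by simp
  have left: "real K \<le> ?g x" if "0 < x" "x < a0 - 1 / real L" for x
  proof (cases "j0 = 1")
    case False
    have e: "a0 - 1 / real L = real (j0 - 1) / real L" using j0 by (simp add: a0_def diff_divide_distrib of_nat_diff)
    have "real K < ?g (real (j0 - 1) / real L)" using False j0 by (intro j0_min) auto
    also have "\<dots> \<le> ?g x" by (rule gmix_antimono) (use that e in linarith)+
    finally show ?thesis by simp
  qed (use that in \<open>simp add: a0_def\<close>)
  define gp where "gp l = real (j0 + l) / real L" for l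
  have gp_diff: "gp l - a0 = real l / real L" for l by (simp add: gp_def a0_def add_divide_distrib)
  define d where "d = L - j0"
  \<comment> \<open>The first summand measures the remainder at \<open>a0\<close>, normalised by its
    bound \<open>K\<close>. The root shortens the groups near \<open>a0\<close>: at distance
    \<open>z^(2k)\<close> with \<open>z \<ge> 1 / N\<close> the width is of order
    \<open>z^(2k-1) / N\<close>, which tames the factor \<open>((b - x) / (x - a0))^(k-1)\<close> of
    \<open>rem_local\<close>.\<close>
  define \<Phi> where "\<Phi> l = real N * (rem (gp l) a0 / real K + root (2 * k) (gp l - a0))" for l
  have k2: "0 < 2 * k" using k1 by simp
  have gp_mono: "l \<le> m \<Longrightarrow> gp l \<le> gp m" for l m by (simp add: gp_def divide_right_mono)
  have Phi_mono: "mono \<Phi>"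
  proof (rule monoI)
    fix l m :: nat assume "l \<le> m"
    then have "gp l \<le> gp m" by (rule gp_mono)
    then show "\<Phi> l \<le> \<Phi> m" unfolding \<Phi>_def using k2 a0(1)
      by (intro mult_left_mono add_mono divide_right_mono rem_mono real_root_le_mono) auto
  qed
  have Phi0: "0 \<le> \<Phi> l" for l
    unfolding \<Phi>_def gp_diff using rem_nonneg by (intro mult_nonneg_nonneg add_nonneg_nonneg divide_nonneg_nonneg real_root_ge_zero) auto
  have lev: "level \<Phi> l \<le> 4 * N" if "l < d" for l
  proof -
    have "rem (gp (Suc l)) a0 \<le> real K" using rem_le_gmix[OF a0(1)] a0(3) by (rule order_trans)
    then have "rem (gp (Suc l)) a0 / real K \<le> 1" using Kp by simp
    moreover have "real (Suc l) / real L \<le> 1" using that by (simp add: d_def)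
    then have "root (2 * k) (gp (Suc l) - a0) \<le> 1" unfolding gp_diff using real_root_le_mono[OF k2, of _ 1] k2 by simp
    ultimately have "rem (gp (Suc l)) a0 / real K + root (2 * k) (gp (Suc l) - a0) \<le> 2" by linarith
    then have "\<Phi> (Suc l) \<le> real N * 2" unfolding \<Phi>_def by (rule mult_left_mono) simp
    then show ?thesis using level_le[OF Phi_mono, of l "2 * N"] by simp
  qed
  define G where "G i = {l\<in>{..<d}. level \<Phi> l = i}" for i
  have finG: "finite (G i)" for i by (simp add: G_def)
  define mn mx where "mn i = Min (G i)" and "mx i = Max (G i)" for i
  have mm: "mn i \<in> G i" "mx i \<in> G i" if "G i \<noteq> {}" for i
    unfolding mn_def mx_def using Min_in[OF finG that] Max_in[OF finG that] by auto
  have mm': "mn i \<le> l" "l \<le> mx i" if "l \<in> G i" for i l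
    unfolding mn_def mx_def using Min_le[OF finG that] Max_ge[OF finG that] by auto
  define s t where "s i = j0 + mn i" and "t i = j0 + mx i + 1" for i
  define a b where "a i = real (s i) / real L" and "b i = real (t i) / real L" for i
  have st: "j0 \<le> s i" "s i < t i" "t i \<le> L" if "G i \<noteq> {}" for i
    using mm[OF that] mm'(1)[OF mm(2)[OF that]] j0L by (auto simp: s_def t_def G_def d_def)
  have ab: "a0 \<le> a i" "a i < b i" "b i \<le> 1" "a i < 1" "0 < b i" "0 < a i" if "G i \<noteq> {}" for i
  proof -
    show "a0 \<le> a i" "a i < b i" "b i \<le> 1" using st[OF that] Lp
      by (auto simp: a0_def a_def b_def divide_right_mono divide_strict_right_mono)
    then show "a i < 1" "0 < b i" "0 < a i" using a0 by auto
  qed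
  have "\<exists>c. G i \<noteq> {} \<longrightarrow> (\<forall>j<k. 0 \<le> c j) \<and> (\<forall>x. 0 < x \<longrightarrow> x \<le> b i \<longrightarrow> x < 1 \<longrightarrow>
      ?g x = (\<Sum>j<k. c j * (b i - x) ^ j) + rem (b i) x)" for i
    using gmix_tail_expansion[of "b i"] ab[of i] by blast
  then have "\<forall>i. \<exists>c. G i \<noteq> {} \<longrightarrow> (\<forall>j<k. 0 \<le> c j) \<and> (\<forall>x. 0 < x \<longrightarrow> x \<le> b i \<longrightarrow> x < 1 \<longrightarrow>
      ?g x = (\<Sum>j<k. c j * (b i - x) ^ j) + rem (b i) x)" by blast
  from choice[OF this] obtain C where C_all: "\<forall>i. G i \<noteq> {} \<longrightarrow> (\<forall>j<k. 0 \<le> C i j) \<and> (\<forall>x. 0 < x \<longrightarrow> x \<le> b i \<longrightarrow> x < 1 \<longrightarrow>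
      ?g x = (\<Sum>j<k. C i j * (b i - x) ^ j) + rem (b i) x)" by blast
  have C0: "0 \<le> C i j" if "G i \<noteq> {}" "j < k" for i j using C_all that by blast
  have Cexp: "?g x = (\<Sum>j<k. C i j * (b i - x) ^ j) + rem (b i) x" if "G i \<noteq> {}" "0 < x" "x \<le> b i" "x < 1" for i x
    using C_all that by blast
  \<comment> \<open>Coefficients in the rescaled variable \<open>(b i - x) / (b i - a i)\<close>. At
    \<open>x = a i\<close> this variable is \<open>1\<close>, so the nonnegative
    \<open>D i j\<close> sum to at most the value of the mixture there, hence to at most
    \<open>K\<close>.\<close>
  define D where "D i j = C i j * (b i - a i) ^ j" for i j
  have D0: "0 \<le> D i j" if "G i \<noteq> {}" "j < k" for i j
    unfolding D_def using C0[OF that] ab[OF that(1)] by simp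
  have Dsum: "(\<Sum>j<k. D i j) \<le> real K" if "G i \<noteq> {}" for i
  proof -
    have "(\<Sum>j<k. D i j) \<le> ?g (a i)"
      using Cexp[OF that, of "a i"] ab[OF that] rem_nonneg[of "b i" "a i"] by (simp add: D_def)
    also have "\<dots> \<le> ?g a0" using ab[OF that] a0 by (intro gmix_antimono) auto
    finally show ?thesis using a0 by simp
  qed
  have DK: "D i j \<le> real K" if "G i \<noteq> {}" "j < k" for i j
    using member_le_sum[of j "{..<k}" "D i"] D0[OF that(1)] Dsum[OF that(1)] that by force
  \<comment> \<open>Rounding down keeps the piece below the mixture and below
    \<open>K\<close>.\<close>
  define e where "e i j = nat \<lfloor>real R * D i j\<rfloor>" for i j
  have e1: "real (e i j) / real R \<le> D i j" "D i j - 1 / real R \<le> real (e i j) / real R" if "G i \<noteq> {}" "j < k" for i j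
  proof -
    have "0 \<le> real R * D i j" using D0[OF that] Rp by simp
    then have "real (e i j) \<le> real R * D i j" "real R * D i j - 1 \<le> real (e i j)" unfolding e_def by linarith+
    then have "real (e i j) / real R \<le> real R * D i j / real R" "(real R * D i j - 1) / real R \<le> real (e i j) / real R"
      by (simp_all only: divide_right_mono of_nat_0_le_iff)
    then show "real (e i j) / real R \<le> D i j" "D i j - 1 / real R \<le> real (e i j) / real R"
      using Rp by (auto simp: diff_divide_distrib)
  qed
  have eK: "e i j \<le> K * R" if "G i \<noteq> {}" "j < k" for i j
  proof -
    have "real R * D i j \<le> real R * real K" using DK[OF that] by (intro mult_left_mono) auto
    then have "\<lfloor>real R * D i j\<rfloor> \<le> int (K * R)" by (simp add: floor_le_iff mult.commute)
    then show ?thesis unfolding e_def by (simp only: nat_le_iff)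
  qed
  define code where "code i = (case i of 0 \<Rightarrow> (0, j0, \<lambda>j\<in>{..<k}. if j = 0 then K * R else 0)
     | Suc i \<Rightarrow> if G i = {} then (0, 0, \<lambda>j\<in>{..<k}. 0) else (s i, t i, \<lambda>j\<in>{..<k}. e i j))" for i
  define cc where "cc = (\<lambda>i\<in>{..<4 * N + 2}. code i)"
  define u where "u = pieces_sum (4 * N + 2) k L R cc"
  have code_in: "code i \<in> piece_codes k L R K" for i
  proof (cases i)
    case 0
    then show ?thesis using j0L by (auto simp: code_def piece_codes_def)
  next
    case (Suc i')
    show ?thesis
    proof (cases "G i' = {}")
      case False
      then show ?thesis using st[OF False] eK[OF False] Suc by (auto simp: code_def piece_codes_def)
    qed (auto simp: code_def piece_codes_def Suc)
  qed
  have cc_in: "cc \<in> PiE {..<4 * N + 2} (\<lambda>_. piece_codes k L R K)" using code_in by (auto simp: cc_def)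
  have u_eq: "u x = (\<Sum>i<4 * N + 2. piece k L R (code i) x)" for x
    unfolding u_def pieces_sum_def by (intro sum.cong) (auto simp: cc_def)
  have p0: "piece k L R (code 0) x = (if 0 < x \<and> x \<le> a0 then real K else 0)" for x
  proof -
    have "(\<Sum>i<k. real ((\<lambda>j\<in>{..<k}. if j = 0 then K * R else 0) i) / real R * y ^ i) = real K" for y :: real
    proof -
      have "(\<Sum>i<k. real ((\<lambda>j\<in>{..<k}. if j = 0 then K * R else 0) i) / real R * y ^ i)
         = (\<Sum>i<k. if i = 0 then real K else 0)" using Rp by (intro sum.cong) auto
      also have "\<dots> = real K" using k1 by (subst sum.delta) auto
      finally show ?thesis .
    qed
    then show ?thesis by (auto simp: piece_def code_def a0_def)
  qed
  have ps: "piece k L R (code (Suc i)) x = (if G i \<noteq> {} \<and> a i < x \<and> x \<le> b i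
      then \<Sum>j<k. real (e i j) / real R * ((b i - x) / (b i - a i)) ^ j else 0)" for i x
  proof -
    have "(real (t i) - real L * x) / (real (t i) - real (s i)) = (b i - x) / (b i - a i)" for i
    proof -
      have "(b i - x) / (b i - a i) = (real L * (b i - x)) / (real L * (b i - a i))" using Lp by simp
      also have "\<dots> = (real (t i) - real L * x) / (real (t i) - real (s i))"
        using Lp by (simp add: right_diff_distrib a_def b_def)
      finally show ?thesis by simp
    qed
    then show ?thesis by (auto simp: piece_def code_def a_def[symmetric] b_def[symmetric] intro!: sum.cong)
  qed
  have cell_idx: "\<exists>l<d. x \<in> gcell L (j0 + l)" if ax: "a0 < x" "x \<le> 1" for x
  proof -
    have "0 < x" using a0 ax by simp
    then obtain l where l: "l < L" "x \<in> gcell L l" using gcell_cover[OF _ ax(2) L] by blast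
    have "real j0 / real L < (real l + 1) / real L" using l ax by (auto simp: gcell_def a0_def)
    then have "j0 \<le> l" using Lp by (simp add: divide_less_cancel)
    then show ?thesis using l by (intro exI[of _ "l - j0"]) (auto simp: d_def)
  qed
  \<comment> \<open>Levels are monotone in the cell index, so a group is a run of consecutive cells
    and its hull contains no foreign cell.\<close>
  have in_piece: "a i < x \<and> x \<le> b i \<longleftrightarrow> level \<Phi> l = i"
    if l: "l < d" "x \<in> gcell L (j0 + l)" and G: "G i \<noteq> {}" for l x i
  proof
    assume ax: "a i < x \<and> x \<le> b i"
    have "real (s i) / real L < (real (j0 + l) + 1) / real L" "real (j0 + l) / real L < real (t i) / real L"
      using ax l(2) by (auto simp: gcell_def a_def b_def)
    then have "mn i \<le> l" "l \<le> mx i" using Lp by (simp_all add: divide_less_cancel s_def t_def)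
    then have "level \<Phi> (mn i) \<le> level \<Phi> l" "level \<Phi> l \<le> level \<Phi> (mx i)" by (auto intro: level_mono[OF Phi_mono])
    then show "level \<Phi> l = i" using mm[OF G] by (simp add: G_def)
  next
    assume "level \<Phi> l = i"
    then have "l \<in> G i" using l by (simp add: G_def)
    then have "mn i \<le> l" "l \<le> mx i" using mm' by auto
    then have "real (s i) / real L \<le> real (j0 + l) / real L" "(real (j0 + l) + 1) / real L \<le> real (t i) / real L"
      using Lp by (auto simp: s_def t_def intro!: divide_right_mono)
    then show "a i < x \<and> x \<le> b i" using l(2) by (auto simp: gcell_def a_def b_def)
  qed
  have u_right: "u x = (\<Sum>j<k. real (e i j) / real R * ((b i - x) / (b i - a i)) ^ j)"
    if l: "l < d" "x \<in> gcell L (j0 + l)" and i: "i = level \<Phi> l" for l x i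
  proof -
    have Gi: "G i \<noteq> {}" using l i by (auto simp: G_def)
    have "a i < x" using in_piece[OF l Gi] i by simp
    then have ax: "a0 < x" using ab[OF Gi] by simp
    have "u x = (\<Sum>i'<4 * N + 2. if i' = Suc i then piece k L R (code i') x else 0)"
      unfolding u_eq
    proof (intro sum.cong refl)
      fix i' assume "i' \<in> {..<4 * N + 2}"
      show "piece k L R (code i') x = (if i' = Suc i then piece k L R (code i') x else 0)"
      proof (cases i')
        case 0
        then show ?thesis using p0 ax by simp
      next
        case (Suc m)
        then show ?thesis using ps[of m x] in_piece[OF l, of m] i by auto
      qed
    qed
    also have "\<dots> = piece k L R (code (Suc i)) x" using lev[OF l(1)] i by (subst sum.delta) auto
    finally show ?thesis using ps[of i x] in_piece[OF l Gi] i Gi by simp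
  qed
  have u_bounds_right: "0 \<le> u x \<and> u x \<le> real K" if l: "l < d" "x \<in> gcell L (j0 + l)" for l x
  proof -
    define i where "i = level \<Phi> l"
    have Gi: "G i \<noteq> {}" using l by (auto simp: G_def i_def)
    have x: "a i < x" "x \<le> b i" using in_piece[OF l Gi] i_def by auto
    define y where "y = (b i - x) / (b i - a i)"
    have y: "0 \<le> y" "y \<le> 1" using x ab[OF Gi] by (auto simp: y_def divide_le_eq)
    have "(\<Sum>j<k. real (e i j) / real R * y ^ j) \<le> (\<Sum>j<k. D i j * 1)"
      using e1[OF Gi] y D0[OF Gi] by (intro sum_mono mult_mono power_le_one) auto
    also have "\<dots> \<le> real K" using Dsum[OF Gi] by simp
    finally show ?thesis unfolding u_right[OF l i_def] y_def[symmetric] using y by (auto intro!: sum_nonneg)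
  qed
  have u_left: "u x = (if 0 < x then real K else 0)" if "x \<le> a0" for x
  proof -
    have "piece k L R (code (Suc i)) x = 0" for i
      using ps[of i x] ab[of i] that by force
    then have "u x = (\<Sum>i<4 * N + 2. if i = 0 then piece k L R (code 0) x else 0)"
      unfolding u_eq by (intro sum.cong refl) (metis not0_implies_Suc)
    also have "\<dots> = piece k L R (code 0) x" by (subst sum.delta) auto
    finally show ?thesis using p0 that by simp
  qed
  have u_far: "u x = 0" if "1 < x" for x
  proof -
    have "piece k L R (code i) x = 0" for i
    proof (cases i)
      case 0 then show ?thesis using p0[of x] a0 that by simp
    next
      case (Suc m) then show ?thesis using ps[of m x] ab[of m] that by force
    qed
    then show ?thesis unfolding u_eq by simp
  qed
  have u_bounds: "0 \<le> u x \<and> u x \<le> real K" for x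
  proof -
    consider "x \<le> a0" | "a0 < x" "x \<le> 1" | "1 < x" by linarith
    then show ?thesis
    proof cases
      case 2
      then show ?thesis using cell_idx[OF 2] u_bounds_right by blast
    qed (use u_left u_far in auto)
  qed
  \<comment> \<open>Isolated cells have no oscillation bound. There the remainder is bounded by
    \<open>K\<close>, and the loss is paid by the length \<open>1 / L\<close>.\<close>
  define Bad where "Bad i = (if G i \<noteq> {} \<and> mn i = mx i then gcell L (j0 + mn i) else {})" for i
  define M where "M = (4 ^ k) ^ (k - 1) * real K"
  \<comment> \<open>The exponent that arises from squaring \<open>z^(-(k-1))\<close> with
    \<open>z = (x - a0)^(1/(2k))\<close>. It exceeds \<open>- 1\<close>, so the singularity at
    \<open>a0\<close> is integrable, with integral at most \<open>1 / (p + 1) = k\<close>.\<close>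
  define p where "p = - (real (k - 1) / real k)"
  have rem_bound: "(rem (b i) x)\<^sup>2 \<le> M\<^sup>2 / real N ^ (2 * k) * (x - a0) powr p
      + (real K)\<^sup>2 * indicator {a0<..<a0 + 1 / real N ^ (2 * k)} x + (\<Sum>i\<le>4 * N. (real K)\<^sup>2 * indicator (Bad i) x)"
    if x: "a0 < x" "x < 1" and l: "l < d" "x \<in> gcell L (j0 + l)" and i: "i = level \<Phi> l" for x l i
  proof -
    have Gi: "G i \<noteq> {}" and lG: "l \<in> G i" using l i by (auto simp: G_def)
    have xi: "a i < x" "x \<le> b i" using in_piece[OF l Gi] i by auto
    have remK: "(rem (b i) x)\<^sup>2 \<le> (real K)\<^sup>2"
      using rem_le_gmix[of x "b i"] right[OF x(1)] x a0 rem_nonneg by (intro power_mono) auto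
    have nn: "0 \<le> M\<^sup>2 / real N ^ (2 * k) * (x - a0) powr p" "0 \<le> (\<Sum>i\<le>4 * N. (real K)\<^sup>2 * indicator (Bad i) x)"
      by (auto intro!: sum_nonneg)
    show ?thesis
    proof (cases "mn i = mx i")
      case True
      then have "l = mn i" using mm'[OF lG] by simp
      then have "x \<in> Bad i" using True Gi l by (simp add: Bad_def)
      moreover have "i \<le> 4 * N" using lev[OF l(1)] i by simp
      ultimately have "(real K)\<^sup>2 \<le> (\<Sum>i\<le>4 * N. (real K)\<^sup>2 * indicator (Bad i) x)"
        using member_le_sum[of i "{..4 * N}" "\<lambda>i. (real K)\<^sup>2 * indicator (Bad i) x"] by simp
      then show ?thesis using remK nn(1) by (simp add: add_increasing add_increasing2)
    next
      case False
      then have lt: "mn i < mx i" using mm'(1)[OF mm(2)[OF Gi]] by simp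
      define z where "z = root (2 * k) (x - a0)"
      have z0: "0 < z" using x k2 by (simp add: z_def)
      have zp: "z ^ (2 * k) = x - a0" unfolding z_def using x k2 by (intro real_root_pow_pos2) auto
      show ?thesis
      \<comment> \<open>Within distance \<open>N^(-2k)\<close> of \<open>a0\<close> the bound
        \<open>K\<close> on the remainder suffices, because the length of that interval is already
        of the order aimed at.\<close>
      proof (cases "z < 1 / real N")
        case True
        then have "z ^ (2 * k) < (1 / real N) ^ (2 * k)" using z0 k2 by (intro power_strict_mono) auto
        then have "x \<in> {a0<..<a0 + 1 / real N ^ (2 * k)}" using zp x by (simp add: power_one_over)
        then have e1: "indicator {a0<..<a0 + 1 / real N ^ (2 * k)} x = (1::real)" by (rule indicator_eq_1_iff[THEN iffD2])
        show ?thesis unfolding e1 mult_1_right using remK nn by linarith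
      next
        case False
        have "level \<Phi> (mn i) = level \<Phi> (mx i)" using mm[OF Gi] by (simp add: G_def)
        from level_eq_imp_osc[OF Phi_mono Phi0 lt this]
        have osc: "\<Phi> (Suc (mx i)) - \<Phi> (mn i) < 1" .
        have gp_ab: "gp (mn i) = a i" "gp (Suc (mx i)) = b i" by (simp_all add: gp_def a_def b_def s_def t_def)
        have "real N * ((rem (b i) a0 - rem (a i) a0) / real K) + real N * (root (2 * k) (b i - a0) - root (2 * k) (a i - a0)) < 1"
          using osc unfolding \<Phi>_def gp_ab by (simp add: algebra_simps diff_divide_distrib)
        moreover have "rem (a i) a0 \<le> rem (b i) a0" "root (2 * k) (a i - a0) \<le> root (2 * k) (b i - a0)"
          using ab[OF Gi] a0 k2 by (auto intro!: rem_mono real_root_le_mono)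
        then have "0 \<le> real N * ((rem (b i) a0 - rem (a i) a0) / real K)" "0 \<le> real N * (root (2 * k) (b i - a0) - root (2 * k) (a i - a0))"
          by auto
        ultimately have o: "real N * ((rem (b i) a0 - rem (a i) a0) / real K) \<le> 1"
          "real N * (root (2 * k) (b i - a0) - root (2 * k) (a i - a0)) \<le> 1" by linarith+
        have o1: "rem (b i) a0 - rem (a i) a0 \<le> real K / real N" using o(1) Np Kp by (simp add: field_simps)
        have "root (2 * k) (b i - a0) \<le> root (2 * k) (a i - a0) + 1 / real N" using o(2) Np by (simp add: field_simps)
        also have "root (2 * k) (a i - a0) \<le> z" unfolding z_def using xi k2 by (intro real_root_le_mono) auto
        finally have o2: "root (2 * k) (b i - a0) \<le> z + 1 / real N" by simp
        \<comment> \<open>The relative step on the root scale. It is at most \<open>1\<close>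
          outside the excluded neighbourhood of \<open>a0\<close>, so
          \<open>(1 + y)^(2k) - 1\<close> is at most \<open>4^k * y\<close>.\<close>
        define y where "y = 1 / (real N * z)"
        have y: "0 < y" "y \<le> 1" using False z0 Np by (auto simp: y_def field_simps)
        have "b i - a0 = root (2 * k) (b i - a0) ^ (2 * k)" using k2 ab[OF Gi] by (intro real_root_pow_pos2[symmetric]) auto
        also have "\<dots> \<le> (z + 1 / real N) ^ (2 * k)" using o2 ab[OF Gi] k2 by (intro power_mono real_root_ge_zero) auto
        also have "z + 1 / real N = z * (1 + y)" using z0 Np by (simp add: y_def field_simps)
        finally have "b i - a0 \<le> (x - a0) * (1 + y) ^ (2 * k)" by (simp add: power_mult_distrib zp)
        then have "(b i - x) \<le> (x - a0) * ((1 + y) ^ (2 * k) - 1)" by (simp add: algebra_simps)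
        also have "\<dots> \<le> (x - a0) * (2 ^ (2 * k) * y)"
          using x y by (intro mult_left_mono one_plus_power_minus_one_le) auto
        finally have "(b i - x) / (x - a0) \<le> 4 ^ k * y" 
        proof -
          assume "b i - x \<le> (x - a0) * (2 ^ (2 * k) * y)"
          moreover have "(2::real) ^ (2 * k) = 4 ^ k" by (simp add: power_mult)
          ultimately show ?thesis using x by (simp only: pos_divide_le_eq mult.commute[of "x - a0"])
        qed
        then have q: "((b i - x) / (x - a0)) ^ (k - 1) \<le> (4 ^ k * y) ^ (k - 1)" using x xi by (intro power_mono) auto
        have "rem (b i) x \<le> ((b i - x) / (x - a0)) ^ (k - 1) * (rem (b i) a0 - rem x a0)"
          using a0 x xi by (intro rem_local) auto
        also have "\<dots> \<le> (4 ^ k * y) ^ (k - 1) * (real K / real N)"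
        proof (rule mult_mono[OF q])
          show "rem (b i) a0 - rem x a0 \<le> real K / real N" using o1 rem_mono[OF a0(1), of "a i" x] xi by simp
          show "0 \<le> rem (b i) a0 - rem x a0" using rem_mono[OF a0(1), of x "b i"] xi by simp
        qed (use y in auto)
        also have "\<dots> = M / (real N ^ k * z ^ (k - 1))"
        proof -
          have "real N ^ k = real N ^ (k - 1) * real N" using k1 by (cases k) auto
          then show ?thesis using z0 Np by (simp add: M_def y_def power_mult_distrib power_one_over power_divide)
        qed
        finally have "(rem (b i) x)\<^sup>2 \<le> (M / (real N ^ k * z ^ (k - 1)))\<^sup>2" using rem_nonneg by (intro power_mono) auto
        also have "\<dots> = M\<^sup>2 / real N ^ (2 * k) * (1 / z ^ (2 * (k - 1)))"
          by (simp add: power_divide power_mult_distrib power_mult[symmetric] mult.commute)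
        also have "1 / z ^ (2 * (k - 1)) = (x - a0) powr p"
        proof -
          have "z = (x - a0) powr (1 / real (2 * k))" unfolding z_def using x k2 by (subst root_powr_inverse) auto
          then have "z ^ (2 * (k - 1)) = (x - a0) powr (1 / real (2 * k) * real (2 * (k - 1)))"
            using z0 by (simp add: powr_realpow[symmetric] powr_powr)
          also have "1 / real (2 * k) * real (2 * (k - 1)) = - p" using k1 by (simp add: p_def of_nat_diff field_simps)
          finally show ?thesis by (simp add: powr_minus_divide)
        qed
        finally show ?thesis using nn(2) by (simp add: add_increasing2)
      qed
    qed
  qed
  have point: "(?g x - u x)\<^sup>2 \<le> 2 * (real k / real R)\<^sup>2 + 2 * (M\<^sup>2 / real N ^ (2 * k) * (x - a0) powr p
      + (real K)\<^sup>2 * indicator {a0<..<a0 + 1 / real N ^ (2 * k)} x + (\<Sum>i\<le>4 * N. (real K)\<^sup>2 * indicator (Bad i) x))"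
    if x: "a0 < x" "x < 1" for x
  proof -
    obtain l where l: "l < d" "x \<in> gcell L (j0 + l)" using cell_idx[of x] x by auto
    define i where "i = level \<Phi> l"
    have Gi: "G i \<noteq> {}" using l by (auto simp: G_def i_def)
    have xi: "a i < x" "x \<le> b i" using in_piece[OF l Gi] i_def by auto
    define y where "y = (b i - x) / (b i - a i)"
    have y: "0 \<le> y" "y \<le> 1" using xi ab[OF Gi] by (auto simp: y_def divide_le_eq)
    have "?g x = (\<Sum>j<k. D i j * y ^ j) + rem (b i) x"
    proof -
      have "D i j * y ^ j = C i j * (b i - x) ^ j" for j
        using ab[OF Gi] by (simp add: D_def y_def power_divide)
      then show ?thesis using Cexp[OF Gi _ xi(2) x(2)] a0 x by simp
    qed
    then have "?g x - u x = (\<Sum>j<k. (D i j - real (e i j) / real R) * y ^ j) + rem (b i) x"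
      unfolding u_right[OF l i_def] y_def[symmetric] by (simp add: left_diff_distrib sum_subtractf)
    moreover have "0 \<le> (\<Sum>j<k. (D i j - real (e i j) / real R) * y ^ j)"
      using e1[OF Gi] y by (intro sum_nonneg mult_nonneg_nonneg) auto
    moreover have "(\<Sum>j<k. (D i j - real (e i j) / real R) * y ^ j) \<le> (\<Sum>j<k. 1 / real R * 1)"
      using e1[OF Gi] y by (intro sum_mono mult_mono power_le_one) (auto simp: algebra_simps)
    ultimately have "0 \<le> ?g x - u x" "?g x - u x \<le> real k / real R + rem (b i) x"
      using rem_nonneg[of "b i" x] by auto
    then have "(?g x - u x)\<^sup>2 \<le> (real k / real R + rem (b i) x)\<^sup>2" by (intro power_mono)
    also have "\<dots> \<le> 2 * (real k / real R)\<^sup>2 + 2 * (rem (b i) x)\<^sup>2"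
      using sum_squares_bound[of "real k / real R" "rem (b i) x"] by (simp add: power2_sum)
    also have "\<dots> \<le> 2 * (real k / real R)\<^sup>2 + 2 * (M\<^sup>2 / real N ^ (2 * k) * (x - a0) powr p
      + (real K)\<^sup>2 * indicator {a0<..<a0 + 1 / real N ^ (2 * k)} x + (\<Sum>i\<le>4 * N. (real K)\<^sup>2 * indicator (Bad i) x))"
      by (intro add_left_mono mult_left_mono rem_bound[OF x l i_def]) simp
    finally show ?thesis .
  qed
  have p1: "- 1 < p" using k1 by (simp add: p_def)
  have p1': "1 / (p + 1) = real k" using k1 by (simp add: p_def of_nat_diff field_simps)
  have Bad_meas: "Bad i \<in> sets lborel" for i by (simp add: Bad_def)
  have Bad_em: "emeasure lborel (Bad i) \<le> ennreal (1 / real L)" for i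
    using emeasure_gcell[OF L] by (simp add: Bad_def)
  have "(\<integral>\<^sup>+ x. ennreal ((?g x - u x)\<^sup>2) * indicator {a0<..<1} x \<partial>lborel)
    \<le> (\<integral>\<^sup>+ x. (ennreal (2 * (real k / real R)\<^sup>2) * indicator {0..1} x
        + ennreal (2 * (M\<^sup>2 / real N ^ (2 * k))) * (ennreal ((x - a0) powr p) * indicator {a0<..<1} x))
        + (ennreal (2 * (real K)\<^sup>2) * indicator {a0<..<a0 + 1 / real N ^ (2 * k)} x
        + (\<Sum>i\<le>4 * N. ennreal (2 * (real K)\<^sup>2) * indicator (Bad i) x)) \<partial>lborel)"
  proof (rule nn_integral_mono)
    fix x :: real
    show "ennreal ((?g x - u x)\<^sup>2) * indicator {a0<..<1} x \<le> (ennreal (2 * (real k / real R)\<^sup>2) * indicator {0..1} x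
        + ennreal (2 * (M\<^sup>2 / real N ^ (2 * k))) * (ennreal ((x - a0) powr p) * indicator {a0<..<1} x))
        + (ennreal (2 * (real K)\<^sup>2) * indicator {a0<..<a0 + 1 / real N ^ (2 * k)} x
        + (\<Sum>i\<le>4 * N. ennreal (2 * (real K)\<^sup>2) * indicator (Bad i) x))"
    proof (cases "a0 < x \<and> x < 1")
      case True
      have ind: "ennreal c * indicator A x = ennreal (c * indicator A x)" for c and A :: "real set"
        by (simp add: indicator_def)
      have "ennreal ((?g x - u x)\<^sup>2) \<le> ennreal ((2 * (real k / real R)\<^sup>2 + 2 * (M\<^sup>2 / real N ^ (2 * k)) * (x - a0) powr p)
        + (2 * (real K)\<^sup>2 * indicator {a0<..<a0 + 1 / real N ^ (2 * k)} x + (\<Sum>i\<le>4 * N. 2 * (real K)\<^sup>2 * indicator (Bad i) x)))"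
      proof (rule ennreal_leI)
        have s2: "(\<Sum>i\<le>4 * N. 2 * (real K)\<^sup>2 * indicator (Bad i) x) = 2 * (\<Sum>i\<le>4 * N. (real K)\<^sup>2 * indicator (Bad i) x)"
          by (simp only: sum_distrib_left mult.assoc)
        show "(?g x - u x)\<^sup>2 \<le> (2 * (real k / real R)\<^sup>2 + 2 * (M\<^sup>2 / real N ^ (2 * k)) * (x - a0) powr p)
          + (2 * (real K)\<^sup>2 * indicator {a0<..<a0 + 1 / real N ^ (2 * k)} x + (\<Sum>i\<le>4 * N. 2 * (real K)\<^sup>2 * indicator (Bad i) x))"
          using point[OF conjunct1[OF True] conjunct2[OF True]] unfolding s2
          by (simp only: distrib_left mult.assoc add.assoc)
      qed
      also have "\<dots> = (ennreal (2 * (real k / real R)\<^sup>2) + ennreal (2 * (M\<^sup>2 / real N ^ (2 * k)) * (x - a0) powr p))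
        + (ennreal (2 * (real K)\<^sup>2 * indicator {a0<..<a0 + 1 / real N ^ (2 * k)} x) + ennreal (\<Sum>i\<le>4 * N. 2 * (real K)\<^sup>2 * indicator (Bad i) x))"
        by (simp add: ennreal_plus sum_nonneg del: sum_ennreal)
      also have "ennreal (\<Sum>i\<le>4 * N. 2 * (real K)\<^sup>2 * indicator (Bad i) x) = (\<Sum>i\<le>4 * N. ennreal (2 * (real K)\<^sup>2 * indicator (Bad i) x))"
        by (rule sum_ennreal[symmetric]) auto
      finally have F: "ennreal ((?g x - u x)\<^sup>2)
        \<le> ennreal (2 * (real k / real R)\<^sup>2) + ennreal (2 * (M\<^sup>2 / real N ^ (2 * k)) * (x - a0) powr p)
        + (ennreal (2 * (real K)\<^sup>2 * indicator {a0<..<a0 + 1 / real N ^ (2 * k)} x)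
        + (\<Sum>i\<le>4 * N. ennreal (2 * (real K)\<^sup>2 * indicator (Bad i) x)))" .
      have em: "ennreal (2 * (M\<^sup>2 / real N ^ (2 * k)) * (x - a0) powr p)
        = ennreal (2 * (M\<^sup>2 / real N ^ (2 * k))) * ennreal ((x - a0) powr p)" by (rule ennreal_mult) auto
      have "indicator {0..1} x = (1::ennreal)" "indicator {a0<..<1} x = (1::ennreal)" using True a0 by auto
      then show ?thesis using F unfolding em by (simp only: ind[symmetric] mult_1_right)
    qed simp
  qed
  also have "\<dots> = ((\<integral>\<^sup>+ x. ennreal (2 * (real k / real R)\<^sup>2) * indicator {0..1::real} x \<partial>lborel)
        + (\<integral>\<^sup>+ x. ennreal (2 * (M\<^sup>2 / real N ^ (2 * k))) * (ennreal ((x - a0) powr p) * indicator {a0<..<1} x) \<partial>lborel))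
        + ((\<integral>\<^sup>+ x. ennreal (2 * (real K)\<^sup>2) * indicator {a0<..<a0 + 1 / real N ^ (2 * k)} x \<partial>lborel)
        + (\<integral>\<^sup>+ x. (\<Sum>i\<le>4 * N. ennreal (2 * (real K)\<^sup>2) * indicator (Bad i) x) \<partial>lborel))"
  proof (rule nn_integral_add4)
    show "(\<lambda>x. \<Sum>i\<le>4 * N. ennreal (2 * (real K)\<^sup>2) * indicator (Bad i) x) \<in> borel_measurable lborel"
      using Bad_meas by (intro borel_measurable_sum borel_measurable_times borel_measurable_indicator) auto
  qed measurable
  also have "\<dots> \<le> (ennreal (2 * (real k / real R)\<^sup>2) + ennreal (2 * (M\<^sup>2 / real N ^ (2 * k))) * ennreal (real k))
        + (ennreal (2 * (real K)\<^sup>2) * ennreal (1 / real N ^ (2 * k)) + (\<Sum>i\<le>4 * N. ennreal (2 * (real K)\<^sup>2) * ennreal (1 / real L)))"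
  proof (intro add_mono)
    show "(\<integral>\<^sup>+ x. ennreal (2 * (real k / real R)\<^sup>2) * indicator {0..1::real} x \<partial>lborel) \<le> ennreal (2 * (real k / real R)\<^sup>2)"
      by (subst nn_integral_cmult_indicator) auto
    have "(\<integral>\<^sup>+ x. ennreal (2 * (M\<^sup>2 / real N ^ (2 * k))) * (ennreal ((x - a0) powr p) * indicator {a0<..<1} x) \<partial>lborel)
      = ennreal (2 * (M\<^sup>2 / real N ^ (2 * k))) * (\<integral>\<^sup>+ x. ennreal ((x - a0) powr p) * indicator {a0<..<1} x \<partial>lborel)"
      by (rule nn_integral_cmult) measurable
    also have "\<dots> \<le> ennreal (2 * (M\<^sup>2 / real N ^ (2 * k))) * ennreal (real k)"
      using nn_integral_powr_shift[OF less_imp_le[OF a0(1)] p1] unfolding p1' by (rule mult_left_mono) simp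
    finally show "(\<integral>\<^sup>+ x. ennreal (2 * (M\<^sup>2 / real N ^ (2 * k))) * (ennreal ((x - a0) powr p) * indicator {a0<..<1} x) \<partial>lborel)
      \<le> ennreal (2 * (M\<^sup>2 / real N ^ (2 * k))) * ennreal (real k)" .
    show "(\<integral>\<^sup>+ x. ennreal (2 * (real K)\<^sup>2) * indicator {a0<..<a0 + 1 / real N ^ (2 * k)} x \<partial>lborel)
      \<le> ennreal (2 * (real K)\<^sup>2) * ennreal (1 / real N ^ (2 * k))"
      by (subst nn_integral_cmult_indicator) auto
    have "(\<integral>\<^sup>+ x. (\<Sum>i\<le>4 * N. ennreal (2 * (real K)\<^sup>2) * indicator (Bad i) x) \<partial>lborel)
      = (\<Sum>i\<le>4 * N. \<integral>\<^sup>+ x. ennreal (2 * (real K)\<^sup>2) * indicator (Bad i) x \<partial>lborel)"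
      using Bad_meas by (intro nn_integral_sum borel_measurable_times borel_measurable_indicator) auto
    also have "\<dots> = (\<Sum>i\<le>4 * N. ennreal (2 * (real K)\<^sup>2) * emeasure lborel (Bad i))"
      using Bad_meas by (simp only: nn_integral_cmult_indicator)
    also have "\<dots> \<le> (\<Sum>i\<le>4 * N. ennreal (2 * (real K)\<^sup>2) * ennreal (1 / real L))"
      by (intro sum_mono mult_left_mono Bad_em) simp
    finally show "(\<integral>\<^sup>+ x. (\<Sum>i\<le>4 * N. ennreal (2 * (real K)\<^sup>2) * indicator (Bad i) x) \<partial>lborel)
      \<le> (\<Sum>i\<le>4 * N. ennreal (2 * (real K)\<^sup>2) * ennreal (1 / real L))" .
  qed
  also have "\<dots> = ennreal (2 * (real k / real R)\<^sup>2 + 2 * (M\<^sup>2 / real N ^ (2 * k) * real k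
          + (real K)\<^sup>2 / real N ^ (2 * k) + (real K)\<^sup>2 * real (4 * N + 1) / real L))"
  proof -
    have "(\<Sum>i\<le>4 * N. ennreal (2 * (real K)\<^sup>2) * ennreal (1 / real L)) = ennreal (\<Sum>i\<le>4 * N. 2 * (real K)\<^sup>2 * (1 / real L))"
      by (subst sum_ennreal[symmetric]) (auto simp: ennreal_mult[symmetric])
    moreover have "ennreal (2 * (M\<^sup>2 / real N ^ (2 * k))) * ennreal (real k) = ennreal (2 * (M\<^sup>2 / real N ^ (2 * k)) * real k)"
      by (rule ennreal_mult[symmetric]) auto
    moreover have "ennreal (2 * (real K)\<^sup>2) * ennreal (1 / real N ^ (2 * k)) = ennreal (2 * (real K)\<^sup>2 * (1 / real N ^ (2 * k)))"
      by (rule ennreal_mult[symmetric]) auto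
    moreover have "ennreal A + ennreal B + (ennreal C + ennreal D) = ennreal (A + B + (C + D))"
      if "0 \<le> A" "0 \<le> B" "0 \<le> C" "0 \<le> D" for A B C D using that by simp
    ultimately have "(ennreal (2 * (real k / real R)\<^sup>2) + ennreal (2 * (M\<^sup>2 / real N ^ (2 * k))) * ennreal (real k))
        + (ennreal (2 * (real K)\<^sup>2) * ennreal (1 / real N ^ (2 * k)) + (\<Sum>i\<le>4 * N. ennreal (2 * (real K)\<^sup>2) * ennreal (1 / real L)))
      = ennreal (2 * (real k / real R)\<^sup>2 + 2 * (M\<^sup>2 / real N ^ (2 * k)) * real k
        + (2 * (real K)\<^sup>2 * (1 / real N ^ (2 * k)) + (\<Sum>i\<le>4 * N. 2 * (real K)\<^sup>2 * (1 / real L))))"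
      by (simp only:) (auto intro!: sum_nonneg)
    also have "\<dots> = ennreal (2 * (real k / real R)\<^sup>2 + 2 * (M\<^sup>2 / real N ^ (2 * k) * real k
          + (real K)\<^sup>2 / real N ^ (2 * k) + (real K)\<^sup>2 * real (4 * N + 1) / real L))"
      by (rule arg_cong[where f=ennreal]) (simp add: algebra_simps)
    finally show ?thesis .
  qed
  finally show ?thesis
    using cc_in u_bounds u_left left right unfolding u_def M_def
    by (intro bexI[of _ cc] exI[of _ a0]) auto
qed

end

section \<open>Prior mass\<close>

lemma sets_gamma_measure[measurable_cong, simp]: "sets (gamma_measure \<alpha>) = sets borel"
  by (simp add: gamma_measure_def)

lemma space_gamma_measure[simp]: "space (gamma_measure \<alpha>) = UNIV"
  by (simp add: gamma_measure_def)

lemma prob_space_gamma_measure: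
  assumes "0 < \<alpha>"
  shows "prob_space (gamma_measure \<alpha>)"
proof (rule prob_spaceI)
  have G: "0 < Gamma \<alpha>" using assms by (rule Gamma_real_pos)
  have "emeasure (gamma_measure \<alpha>) (space (gamma_measure \<alpha>))
      = (\<integral>\<^sup>+ x. ennreal (if 0 < x then x powr (\<alpha> - 1) * exp (- x) / Gamma \<alpha> else 0) \<partial>lborel)"
    using assms by (simp add: gamma_measure_def emeasure_density)
  also have "\<dots> = (\<integral>\<^sup>+ x. ennreal (1 / Gamma \<alpha>) * ennreal (indicator {0..} x * x powr (\<alpha> - 1) / exp x) \<partial>lborel)"
  proof (rule nn_integral_cong_AE, use AE_lborel_singleton[of 0] in eventually_elim)
    case (elim x)
    then show ?case using G by (auto simp: ennreal_mult[symmetric] indicator_def exp_minus divide_inverse)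
  qed
  also have "\<dots> = ennreal (1 / Gamma \<alpha>) * ennreal (Gamma \<alpha>)"
    using assms by (subst nn_integral_cmult) (simp_all add: Gamma_conv_nn_integral_real)
  also have "\<dots> = 1" using G by (simp add: ennreal_mult[symmetric])
  finally show "emeasure (gamma_measure \<alpha>) (space (gamma_measure \<alpha>)) = 1" .
qed

lemma AE_gamma_measure_pos:
  assumes "0 < \<alpha>"
  shows "AE x in gamma_measure \<alpha>. 0 < x"
  unfolding gamma_measure_def using assms by (auto simp: AE_density)

lemma unit_simplex_sets:
  "{y \<in> space (PiM {..<m} (\<lambda>_. borel :: real measure)). y \<in> unit_simplex m} \<in> sets (PiM {..<m} (\<lambda>_. borel))"
proof -
  have "{y \<in> space (PiM {..<m} (\<lambda>_. borel :: real measure)). (\<forall>i\<in>{..<m}. 0 \<le> y i \<and> y i \<le> 1) \<and> (\<Sum>i<m. y i) = 1} \<in> sets (PiM {..<m} (\<lambda>_. borel))"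
    by measurable
  then show ?thesis by (simp add: unit_simplex_def Ball_def)
qed

locale dirichlet_params =
  fixes m :: nat and \<alpha> :: "nat \<Rightarrow> real"
  assumes m: "1 \<le> m" and alpha: "\<And>i. i < m \<Longrightarrow> 0 < \<alpha> i"
begin

text \<open>Parameters beyond the index range are unconstrained; setting them to \<open>1\<close>
  makes every member of the family a probability measure, as the locale
  \<open>product_prob_space\<close> demands.\<close>

definition \<alpha>' :: "nat \<Rightarrow> real" where "\<alpha>' i = (if i < m then \<alpha> i else 1)"

lemma PiM_eq: "PiM {..<m} (\<lambda>i. gamma_measure (\<alpha> i)) = PiM {..<m} (\<lambda>i. gamma_measure (\<alpha>' i))"
  by (rule PiM_cong) (auto simp: \<alpha>'_def)

lemma normalise_measurable:
  "(\<lambda>y. \<lambda>i\<in>{..<m}. y i / (\<Sum>j<m. y j)) \<in> measurable (PiM {..<m} (\<lambda>i. gamma_measure (\<alpha>' i))) (PiM {..<m} (\<lambda>_. borel))"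
  by measurable

sublocale G: product_prob_space "\<lambda>i. gamma_measure (\<alpha>' i)" "{..<m}"
  by (rule product_prob_spaceI) (use alpha in \<open>auto simp: \<alpha>'_def intro!: prob_space_gamma_measure\<close>)

lemma prob_space_dirichlet: "prob_space (dirichlet m \<alpha>)"
  unfolding dirichlet_def PiM_eq
  by (rule prob_space.prob_space_distr[OF _ normalise_measurable])
     (rule prob_space_PiM, use alpha in \<open>auto simp: \<alpha>'_def intro!: prob_space_gamma_measure\<close>)

text \<open>Independent gamma variables are almost surely positive, hence so is the sum by which
  they are divided. With a vanishing sum all coordinates would be \<open>0\<close>, outside the
  simplex.\<close>

lemma AE_dirichlet_simplex: "AE y in dirichlet m \<alpha>. y \<in> unit_simplex m"
proof -
  have "AE y in PiM {..<m} (\<lambda>i. gamma_measure (\<alpha>' i)). 0 < y i" if "i < m" for i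
    using that alpha by (intro G.AE_component AE_gamma_measure_pos) (auto simp: \<alpha>'_def)
  then have "AE y in PiM {..<m} (\<lambda>i. gamma_measure (\<alpha>' i)). \<forall>i\<in>{..<m}. 0 < y i"
    by (intro AE_finite_allI) auto
  then have "AE y in PiM {..<m} (\<lambda>i. gamma_measure (\<alpha>' i)). (\<lambda>i\<in>{..<m}. y i / (\<Sum>j<m. y j)) \<in> unit_simplex m"
  proof eventually_elim
    case (elim y)
    have S: "0 < (\<Sum>j<m. y j)" using elim m by (intro sum_pos) (auto simp: lessThan_empty_iff)
    have "y i \<le> (\<Sum>j<m. y j)" if "i < m" for i using elim that by (intro member_le_sum) (auto simp: less_imp_le)
    moreover have "(\<Sum>i<m. y i / (\<Sum>j<m. y j)) = 1" using S by (simp add: sum_divide_distrib[symmetric])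
    ultimately show ?case using S elim by (auto simp: unit_simplex_def less_imp_le)
  qed
  then show ?thesis unfolding dirichlet_def PiM_eq
    by (subst AE_distr_iff[OF normalise_measurable unit_simplex_sets]) auto
qed

end

text \<open>\<open>1 / Gamma \<alpha>\<close> equals \<open>\<alpha> / Gamma (\<alpha> + 1)\<close>,
  and \<open>Gamma\<close> is bounded on \<open>[1, a + 1]\<close>. The loss as
  \<open>\<alpha>\<close> tends to \<open>0\<close> is only linear, which is affordable because the
  parameters of small cells are polynomially small.\<close>

lemma Gamma_bounded_interval:
  fixes a :: real
  assumes "0 < a"
  shows "\<exists>\<Gamma>>0. \<forall>\<alpha>. 0 < \<alpha> \<longrightarrow> \<alpha> \<le> a \<longrightarrow> \<alpha> / \<Gamma> \<le> 1 / Gamma \<alpha>"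
proof -
  have "continuous_on {1..a + 1} (Gamma :: real \<Rightarrow> real)"
    by (intro continuous_on_Gamma) (auto simp: nonpos_Ints_def)
  then obtain x where x: "x \<in> {1..a + 1}" "\<And>y. y \<in> {1..a + 1} \<Longrightarrow> Gamma y \<le> Gamma x"
    using continuous_attains_sup[of "{1..a + 1}" "Gamma :: real \<Rightarrow> real"] assms by auto
  have "\<alpha> / Gamma x \<le> 1 / Gamma \<alpha>" if "0 < \<alpha>" "\<alpha> \<le> a" for \<alpha>
  proof -
    have "Gamma (\<alpha> + 1) = \<alpha> * Gamma \<alpha>" using that by (intro Gamma_plus1) (auto simp: nonpos_Ints_def)
    moreover have "Gamma (\<alpha> + 1) \<le> Gamma x" using that by (intro x) auto
    ultimately show ?thesis using that x(1) Gamma_real_pos[of \<alpha>] Gamma_real_pos[of x]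
      by (simp add: field_simps)
  qed
  then show ?thesis using x(1) Gamma_real_pos[of x] by (intro exI[of _ "Gamma x"]) auto
qed

text \<open>The interval lies in \<open>[r, 2]\<close>, where each factor of the gamma density has a
  lower bound valid for the whole range of \<open>\<alpha>\<close>: \<open>exp (- 2)\<close>,
  \<open>\<alpha>min / \<Gamma>\<close>, and \<open>r powr a / 2\<close> for the power, whose
  exponent may have either sign.\<close>

lemma gamma_measure_interval:
  assumes "0 < \<alpha>" "\<alpha> \<le> a" "\<alpha>min \<le> \<alpha>" "0 \<le> w" "w \<le> 1" "0 < r" "r \<le> 1 / 2" "0 < \<Gamma>" "\<alpha> / \<Gamma> \<le> 1 / Gamma \<alpha>" "0 < \<alpha>min"
  shows "ennreal (exp (- 2) / (2 * \<Gamma>) * \<alpha>min * r powr (a + 1)) \<le> emeasure (gamma_measure \<alpha>) {w + r..w + 2 * r}"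
proof -
  define c where "c = (r powr a / 2) * exp (- 2) * (\<alpha>min / \<Gamma>)"
  have c0: "0 \<le> c" using assms by (simp add: c_def)
  have "ennreal (exp (- 2) / (2 * \<Gamma>) * \<alpha>min * r powr (a + 1)) = ennreal (c * r)"
    using assms by (simp add: c_def powr_add field_simps)
  also have "\<dots> = (\<integral>\<^sup>+ x. ennreal c * indicator {w + r..w + 2 * r} x \<partial>lborel)"
    using assms c0 by (simp add: nn_integral_cmult_indicator ennreal_mult)
  also have "\<dots> \<le> (\<integral>\<^sup>+ x. ennreal (if 0 < x then x powr (\<alpha> - 1) * exp (- x) / Gamma \<alpha> else 0) * indicator {w + r..w + 2 * r} x \<partial>lborel)"
  proof (rule nn_integral_mono)
    fix x :: real
    show "ennreal c * indicator {w + r..w + 2 * r} x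
       \<le> ennreal (if 0 < x then x powr (\<alpha> - 1) * exp (- x) / Gamma \<alpha> else 0) * indicator {w + r..w + 2 * r} x"
    proof (cases "x \<in> {w + r..w + 2 * r}")
      case True
      then have x: "r \<le> x" "x \<le> 2" "0 < x" using assms by auto
      have "r powr a / 2 \<le> x powr (\<alpha> - 1)"
      proof (cases "x \<le> 1")
        case True
        have "r powr a / 2 \<le> r powr a" by simp
        also have "\<dots> \<le> x powr a" using x assms by (intro powr_mono2) auto
        also have "\<dots> \<le> x powr (\<alpha> - 1)" using x True assms by (intro powr_mono') auto
        finally show ?thesis .
      next
        case False
        have "r powr a \<le> 1" using assms by (intro powr_le1) auto
        then have "r powr a / 2 \<le> 1 / 2" by simp
        also have "\<dots> \<le> x powr (- 1)" using x by (simp add: powr_minus_divide)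
        also have "\<dots> \<le> x powr (\<alpha> - 1)" using False assms by (intro powr_mono) auto
        finally show ?thesis .
      qed
      moreover have "\<alpha>min / \<Gamma> \<le> 1 / Gamma \<alpha>"
        using assms by (meson divide_right_mono less_imp_le order_trans)
      moreover have "exp (- 2) \<le> exp (- x)" using x by simp
      ultimately have "c \<le> x powr (\<alpha> - 1) * exp (- x) * (1 / Gamma \<alpha>)"
        unfolding c_def using assms by (intro mult_mono) auto
      then show ?thesis using True x by (auto intro: ennreal_leI)
    qed simp
  qed
  also have "\<dots> = emeasure (gamma_measure \<alpha>) {w + r..w + 2 * r}"
    using assms by (simp add: gamma_measure_def emeasure_density)
  finally show ?thesis .
qed

text \<open>Independent gamma variables in \<open>[w i + r, w i + 2 r]\<close> with
  \<open>r = \<rho> / (2 m)\<close> have a sum of at most \<open>1 + \<rho>\<close>, and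
  \<open>(1 - \<rho>) (1 + \<rho>) \<le> 1\<close> gives the required bounds after normalisation.
  The probability is then a product of \<open>m\<close> interval masses.\<close>

lemma dirichlet_lower_bound:
  assumes m: "1 \<le> m" and al: "\<And>i. i < m \<Longrightarrow> \<alpha>min \<le> \<alpha> i \<and> \<alpha> i \<le> a" and amin: "0 < \<alpha>min"
    and w: "\<And>i. i < m \<Longrightarrow> 0 \<le> w i" "(\<Sum>i<m. w i) \<le> 1" and rho: "0 < \<rho>" "\<rho> \<le> 1"
    and Gam: "0 < \<Gamma>" "\<And>\<alpha>. 0 < \<alpha> \<Longrightarrow> \<alpha> \<le> a \<Longrightarrow> \<alpha> / \<Gamma> \<le> 1 / Gamma \<alpha>"
  shows "ennreal ((exp (- 2) / (2 * \<Gamma>) * \<alpha>min * (\<rho> / (2 * real m)) powr (a + 1)) ^ m)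
     \<le> emeasure (dirichlet m \<alpha>) {y \<in> space (PiM {..<m} (\<lambda>_. borel)). \<forall>i<m. (1 - \<rho>) * w i \<le> y i}"
proof -
  interpret dirichlet_params m \<alpha> using m al amin by unfold_locales (auto intro: less_le_trans)
  define r where "r = \<rho> / (2 * real m)"
  have r: "0 < r" "r \<le> 1 / 2" using rho m by (auto simp: r_def divide_le_eq)
  define q where "q = exp (- 2) / (2 * \<Gamma>) * \<alpha>min * r powr (a + 1)"
  have q0: "0 \<le> q" using Gam amin by (simp add: q_def)
  let ?M = "PiM {..<m} (\<lambda>i. gamma_measure (\<alpha>' i))"
  let ?f = "\<lambda>y. \<lambda>i\<in>{..<m}. y i / (\<Sum>j<m. y j)"
  let ?E = "{y \<in> space (PiM {..<m} (\<lambda>_. borel :: real measure)). \<forall>i<m. (1 - \<rho>) * w i \<le> y i}"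
  let ?B = "PiE {..<m} (\<lambda>i. {w i + r..w i + 2 * r})"
  have wle: "w i \<le> 1" if "i < m" for i
    using member_le_sum[of i "{..<m}" w] w that by force
  have "ennreal (q ^ m) = (\<Prod>i<m. ennreal q)" using q0 by (simp add: ennreal_power)
  also have "\<dots> \<le> (\<Prod>i<m. emeasure (gamma_measure (\<alpha>' i)) {w i + r..w i + 2 * r})"
  proof (rule prod_mono_ennreal)
    fix i assume "i \<in> {..<m}"
    then have i: "i < m" by simp
    then have "0 < \<alpha> i" using alpha by simp
    then show "ennreal q \<le> emeasure (gamma_measure (\<alpha>' i)) {w i + r..w i + 2 * r}"
      unfolding q_def using i al[OF i] w(1)[OF i] wle[OF i] r Gam amin
      by (simp only: \<alpha>'_def if_True, intro gamma_measure_interval) auto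
  qed
  also have "\<dots> = emeasure ?M ?B" by (subst G.emeasure_PiM) auto
  also have "\<dots> \<le> emeasure ?M (?f -` ?E \<inter> space ?M)"
  proof (rule emeasure_mono)
    show "?B \<subseteq> ?f -` ?E \<inter> space ?M"
    proof
      fix y assume y: "y \<in> ?B"
      have yi: "w i + r \<le> y i" "y i \<le> w i + 2 * r" if "i < m" for i using y that by (auto simp: PiE_def Pi_def)
      have "(\<Sum>i<m. y i) \<le> (\<Sum>i<m. w i + 2 * r)" using yi by (intro sum_mono) auto
      also have "\<dots> = (\<Sum>i<m. w i) + real m * (2 * r)" by (simp add: sum.distrib)
      also have "\<dots> \<le> 1 + \<rho>" using w m by (simp add: r_def)
      finally have S: "(\<Sum>i<m. y i) \<le> 1 + \<rho>" .
      have "0 < y i" if "i < m" for i using yi(1)[OF that] w(1)[OF that] r by linarith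
      then have S0: "0 < (\<Sum>i<m. y i)" using m by (intro sum_pos) (auto simp: lessThan_empty_iff)
      have "(1 - \<rho>) * w i \<le> y i / (\<Sum>i<m. y i)" if "i < m" for i
      proof -
        have "(1 - \<rho>) * w i * (\<Sum>i<m. y i) \<le> (1 - \<rho>) * w i * (1 + \<rho>)" using S rho w(1)[OF that] by (intro mult_left_mono) auto
        also have "\<dots> = w i - \<rho>\<^sup>2 * w i" by (simp add: algebra_simps power2_eq_square)
        also have "\<dots> \<le> y i"
        proof -
          have "0 \<le> \<rho>\<^sup>2 * w i" using w(1)[OF that] by simp
          then show ?thesis using yi[OF that] r by linarith
        qed
        finally show ?thesis using S0 by (simp add: pos_le_divide_eq)
      qed
      then show "y \<in> ?f -` ?E \<inter> space ?M" using y by (auto simp: space_PiM PiE_def)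
    qed
    have "?E \<in> sets (PiM {..<m} (\<lambda>_. borel))" by measurable
    then show "?f -` ?E \<inter> space ?M \<in> sets ?M" by (rule measurable_sets[OF normalise_measurable])
  qed
  also have "\<dots> = emeasure (dirichlet m \<alpha>) ?E"
    unfolding dirichlet_def PiM_eq by (subst emeasure_distr[OF normalise_measurable]) measurable
  finally show ?thesis by (simp add: q_def r_def)
qed

lemma ennreal_add_le_imp_le_diff:
  assumes "a + ennreal g \<le> ennreal r" "0 \<le> g" "0 \<le> r"
  shows "a \<le> ennreal (r - g)"
proof (cases a)
  case (real x)
  then have "ennreal (x + g) \<le> ennreal r" using assms by simp
  then have "x + g \<le> r" using assms(3) by (simp only: ennreal_le_iff)
  then show ?thesis using real by (simp add: ennreal_leI)
qed (use assms in \<open>simp add: top_unique\<close>)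

text \<open>The interval starts at the midpoint and is short relative to it: \<open>gmid L l\<close>
  is at least \<open>1 / (2 L)\<close>, so every scale in the interval is at most
  \<open>1 + \<rho>\<close> times the midpoint.\<close>

definition gatom :: "nat \<Rightarrow> real \<Rightarrow> nat \<Rightarrow> real set" where
  "gatom L \<rho> l = {gmid L l..<gmid L l + \<rho> / (2 * real L)}"

lemma gatom_subset_gcell:
  assumes "1 \<le> L" "\<rho> \<le> 1"
  shows "gatom L \<rho> l \<subseteq> gcell L l"
proof
  fix x assume x: "x \<in> gatom L \<rho> l"
  have "\<rho> / (2 * real L) \<le> 1 / (2 * real L)" using assms by (intro divide_right_mono) auto
  moreover have "gmid L l + 1 / (2 * real L) = (real l + 1) / real L" "real l / real L < gmid L l"
    using assms by (auto simp: gmid_def field_simps)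
  ultimately show "x \<in> gcell L l" using x unfolding gatom_def gcell_def by auto
qed

lemma gatom_subset_unit:
  assumes "1 \<le> L" "\<rho> \<le> 1" "l < L"
  shows "gatom L \<rho> l \<subseteq> {0<..<1}"
proof
  fix x assume x: "x \<in> gatom L \<rho> l"
  have "\<rho> / (2 * real L) \<le> 1 / (2 * real L)" using assms by (intro divide_right_mono) auto
  moreover have "gmid L l + 1 / (2 * real L) = (real l + 1) / real L" using assms by (auto simp: gmid_def field_simps)
  moreover have "(real l + 1) / real L \<le> 1" using assms by (simp add: divide_le_eq)
  ultimately show "x \<in> {0<..<1}" using x gmid_bounds[OF assms(1,3)] unfolding gatom_def by auto
qed

lemma gcell_disjoint:
  assumes "1 \<le> L" "x \<in> gcell L l" "x \<in> gcell L m"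
  shows "l = m"
  using gcell_order(2)[OF assms(2,3) _ assms(1)] gcell_order(2)[OF assms(3,2) _ assms(1)]
  by (metis less_irrefl nat_neq_iff)

context mixing
begin

text \<open>The intervals are disjoint, on each of them \<open>psi_ge_right\<close> compares the
  kernel with the one at the midpoint, and the rest of \<open>Q\<close> contributes a nonnegative
  amount.\<close>

lemma integral_psi_ge_atoms:
  assumes L: "1 \<le> L" and rho: "0 < \<rho>" "\<rho> \<le> 1" and Z: "Z \<subseteq> {..<L}" and x: "0 < x"
  shows "(\<Sum>l\<in>Z. measure Q (gatom L \<rho> l) * psi k x (gmid L l)) / (1 + \<rho>) \<le> (\<integral>\<theta>. psi k x \<theta> \<partial>Q)"
proof -
  have finZ: "finite Z" using Z finite_subset by blast
  have meas: "gatom L \<rho> l \<in> sets Q" if "l \<in> Z" for l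
  proof -
    have "gatom L \<rho> l \<subseteq> {0<..<1}" using gatom_subset_unit[OF L rho(2)] Z that by auto
    then show ?thesis using Qs unfolding sets_M01
      by (auto simp: sets_restrict_space_iff gatom_def)
  qed
  have int: "integrable Q (\<lambda>\<theta>. indicator (gatom L \<rho> l) \<theta> * (psi k x (gmid L l) / (1 + \<rho>)))" if "l \<in> Z" for l
    using meas[OF that] by (intro integrable_mult_left integrable_real_indicator) (auto simp: Q.emeasure_finite less_top[symmetric])
  have "(\<Sum>l\<in>Z. measure Q (gatom L \<rho> l) * psi k x (gmid L l)) / (1 + \<rho>)
      = (\<Sum>l\<in>Z. \<integral>\<theta>. indicator (gatom L \<rho> l) \<theta> * (psi k x (gmid L l) / (1 + \<rho>)) \<partial>Q)"
    unfolding sum_divide_distrib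
  proof (intro sum.cong refl)
    fix l assume "l \<in> Z"
    then have "(\<integral>\<theta>. indicator (gatom L \<rho> l) \<theta> \<partial>Q) = measure Q (gatom L \<rho> l)"
      using meas sets.sets_into_space[OF meas] by (simp add: Int_absorb2)
    moreover have "(\<integral>\<theta>. indicator (gatom L \<rho> l) \<theta> * (psi k x (gmid L l) / (1 + \<rho>)) \<partial>Q)
      = (\<integral>\<theta>. indicator (gatom L \<rho> l) \<theta> \<partial>Q) * (psi k x (gmid L l) / (1 + \<rho>))"
      by (rule integral_mult_left_zero)
    ultimately show "measure Q (gatom L \<rho> l) * psi k x (gmid L l) / (1 + \<rho>)
      = (\<integral>\<theta>. indicator (gatom L \<rho> l) \<theta> * (psi k x (gmid L l) / (1 + \<rho>)) \<partial>Q)"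
      by simp
  qed
  also have "\<dots> = (\<integral>\<theta>. (\<Sum>l\<in>Z. indicator (gatom L \<rho> l) \<theta> * (psi k x (gmid L l) / (1 + \<rho>))) \<partial>Q)"
    using int by (rule Bochner_Integration.integral_sum[symmetric])
  also have "\<dots> \<le> (\<integral>\<theta>. psi k x \<theta> \<partial>Q)"
  proof (rule integral_mono[OF Bochner_Integration.integrable_sum[OF int] integrable_psi])
    fix \<theta>
    show "(\<Sum>l\<in>Z. indicator (gatom L \<rho> l) \<theta> * (psi k x (gmid L l) / (1 + \<rho>))) \<le> psi k x \<theta>"
    proof (cases "\<exists>l\<in>Z. \<theta> \<in> gatom L \<rho> l")
      case True
      then obtain l where l: "l \<in> Z" "\<theta> \<in> gatom L \<rho> l" by auto
      have "(\<Sum>m\<in>Z. indicator (gatom L \<rho> m) \<theta> * (psi k x (gmid L m) / (1 + \<rho>)))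
        = (\<Sum>m\<in>Z. if m = l then psi k x (gmid L m) / (1 + \<rho>) else 0)"
      proof (intro sum.cong refl)
        fix m assume "m \<in> Z"
        show "indicator (gatom L \<rho> m) \<theta> * (psi k x (gmid L m) / (1 + \<rho>)) = (if m = l then psi k x (gmid L m) / (1 + \<rho>) else 0)"
          using l gatom_subset_gcell[OF L rho(2)] gcell_disjoint[OF L, of \<theta> l m] by (auto simp: indicator_def)
      qed
      also have "\<dots> = psi k x (gmid L l) / (1 + \<rho>)" using l finZ by simp
      also have "\<dots> \<le> psi k x \<theta>"
      proof (rule psi_ge_right)
        show "0 < gmid L l" using gmid_bounds[OF L] l Z by auto
        show "gmid L l \<le> \<theta>" using l by (simp add: gatom_def)
        have "1 / (2 * real L) \<le> gmid L l" using L by (simp add: gmid_def field_simps)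
        then have "\<rho> * (1 / (2 * real L)) \<le> \<rho> * gmid L l" using rho by (intro mult_left_mono) auto
        then show "\<theta> \<le> (1 + \<rho>) * gmid L l" using l by (simp add: gatom_def algebra_simps)
      qed
      finally show ?thesis .
    next
      case False
      then show ?thesis by (simp add: psi_nonneg sum.neutral)
    qed
  qed
  finally show ?thesis .
qed

end

text \<open>\<open>g2\<close> is the true mixture with \<open>Q0\<close> replaced by the atoms. The
  draw dominates \<open>lam * g2\<close>, so its chi-square integral is at most
  \<open>1 / lam\<close> times that of \<open>g2\<close>, and the latter follows from the
  \<open>L^2\<close> error since \<open>g2 \<ge> \<beta>0 0\<close> on the unit interval.\<close>

lemma chi_square_bound:
  fixes \<beta> \<beta>0 :: "nat \<Rightarrow> real"
  assumes m0: "mixing k \<beta>0 Q0" and m1: "mixing k \<beta> Q"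
    and b: "0 < \<beta>0 0" and L: "1 \<le> L" and rho: "0 < \<rho>" "\<rho> < 1" and Z: "Z \<subseteq> {..<L}" and w: "\<forall>l\<in>Z. 0 \<le> w l"
    and mass: "\<bar>(\<Sum>l\<in>Z. w l) - 1\<bar> \<le> \<eta>" "\<eta> \<le> 1"
    and e2: "(\<integral>\<^sup>+ x. ennreal (((\<Sum>l\<in>Z. w l * psi k x (gmid L l)) - (\<integral>\<theta>. psi k x \<theta> \<partial>Q0))\<^sup>2) * indicator {0<..<1} x \<partial>lborel) \<le> ennreal e2"
    and e20: "0 \<le> e2"
    and B1: "\<And>j. j \<le> k \<Longrightarrow> (1 - \<rho>) * \<beta>0 j \<le> \<beta> j"
    and B2: "\<And>l. l \<in> Z \<Longrightarrow> (1 - \<rho>) * (w l / (1 + \<eta>)) \<le> measure Q (gatom L \<rho> l)"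
  shows "\<And>x. 0 < gmix k \<beta>0 Q0 x \<Longrightarrow> 0 < gmix k \<beta> Q x"
    and "(\<integral>\<^sup>+ x. ennreal ((gmix k \<beta>0 Q0 x)\<^sup>2 / gmix k \<beta> Q x) \<partial>lborel)
      \<le> ennreal ((1 + \<rho>) * (1 + \<eta>) / (1 - \<rho>)\<^sup>2 * (1 + \<eta> + e2 / \<beta>0 0))"
proof -
  interpret m0: mixing k \<beta>0 Q0 by fact
  interpret m1: mixing k \<beta> Q by fact
  have eta: "0 \<le> \<eta>" using mass(1) by linarith
  define pz where "pz x = (\<Sum>l\<in>Z. w l * psi k x (gmid L l))" for x
  define gp where "gp x = (\<Sum>j<k. \<beta>0 j * psi (j + 1) x 1)" for x
  define g2 where "g2 x = gp x + \<beta>0 k * pz x" for x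
  \<comment> \<open>One factor \<open>1 - \<rho>\<close> is lost for the weight of the kernel part
    and one for the atom masses, \<open>1 + \<rho>\<close> for shifting scales and
    \<open>1 + \<eta>\<close> for normalising the atom weights.\<close>
  define lam where "lam = (1 - \<rho>)\<^sup>2 / ((1 + \<rho>) * (1 + \<eta>))"
  have lam: "0 < lam" "lam \<le> 1 - \<rho>"
  proof -
    show "0 < lam" using rho eta by (simp add: lam_def)
    have "(1 - \<rho>)\<^sup>2 \<le> (1 - \<rho>) * 1" unfolding power2_eq_square using rho by (intro mult_left_mono) auto
    also have "\<dots> \<le> (1 - \<rho>) * ((1 + \<rho>) * (1 + \<eta>))"
      using rho eta mult_mono[of 1 "1 + \<rho>" 1 "1 + \<eta>"] by (intro mult_left_mono) auto
    finally show "lam \<le> 1 - \<rho>" unfolding lam_def using rho eta by (subst pos_divide_le_eq) auto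
  qed
  have pz0: "0 \<le> pz x" for x unfolding pz_def using w by (auto intro!: sum_nonneg mult_nonneg_nonneg psi_nonneg)
  have gp0: "0 \<le> gp x" for x unfolding gp_def by (auto intro!: sum_nonneg mult_nonneg_nonneg psi_nonneg m0.beta_nonneg)
  have g2_ge: "\<beta>0 0 \<le> g2 x" if "0 < x" "x < 1" for x
  proof -
    have "\<beta>0 0 = \<beta>0 0 * psi (0 + 1) x 1" using that by (simp add: psi_def)
    also have "\<dots> \<le> gp x" unfolding gp_def
      using m0.k1 by (intro member_le_sum mult_nonneg_nonneg m0.beta_nonneg psi_nonneg) auto
    finally show ?thesis unfolding g2_def using pz0[of x] m0.beta_nonneg[of k] by (simp add: add_increasing2)
  qed
  have lower: "lam * g2 x \<le> gmix k \<beta> Q x" if x: "0 < x" for x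
  proof -
    have 1: "lam * gp x \<le> (\<Sum>j<k. \<beta> j * psi (j + 1) x 1)"
      unfolding gp_def sum_distrib_left
    proof (rule sum_mono)
      fix j assume j: "j \<in> {..<k}"
      have "lam * \<beta>0 j \<le> (1 - \<rho>) * \<beta>0 j" using lam(2) j by (intro mult_right_mono m0.beta_nonneg) auto
      also have "\<dots> \<le> \<beta> j" using B1 j by simp
      finally have "lam * \<beta>0 j * psi (j + 1) x 1 \<le> \<beta> j * psi (j + 1) x 1" by (intro mult_right_mono psi_nonneg)
      then show "lam * (\<beta>0 j * psi (j + 1) x 1) \<le> \<beta> j * psi (j + 1) x 1" by (simp only: mult.assoc)
    qed
    have "(1 - \<rho>) / ((1 + \<eta>) * (1 + \<rho>)) * pz x \<le> (\<integral>\<theta>. psi k x \<theta> \<partial>Q)"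
    proof -
      have "(1 - \<rho>) / ((1 + \<eta>) * (1 + \<rho>)) * pz x = (\<Sum>l\<in>Z. (1 - \<rho>) * (w l / (1 + \<eta>)) * psi k x (gmid L l)) / (1 + \<rho>)"
        by (simp add: pz_def sum_distrib_left sum_divide_distrib field_simps)
      also have "\<dots> \<le> (\<Sum>l\<in>Z. measure Q (gatom L \<rho> l) * psi k x (gmid L l)) / (1 + \<rho>)"
        using rho B2 by (intro divide_right_mono sum_mono mult_right_mono psi_nonneg) auto
      also have "\<dots> \<le> (\<integral>\<theta>. psi k x \<theta> \<partial>Q)" using L rho Z x by (intro m1.integral_psi_ge_atoms) auto
      finally show ?thesis .
    qed
    then have "((1 - \<rho>) * \<beta>0 k) * ((1 - \<rho>) / ((1 + \<eta>) * (1 + \<rho>)) * pz x) \<le> \<beta> k * (\<integral>\<theta>. psi k x \<theta> \<partial>Q)"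
      using B1[of k] rho eta pz0 m1.beta_nonneg[of k] by (intro mult_mono) auto
    moreover have "((1 - \<rho>) * \<beta>0 k) * ((1 - \<rho>) / ((1 + \<eta>) * (1 + \<rho>)) * pz x) = lam * (\<beta>0 k * pz x)"
      by (simp add: lam_def power2_eq_square mult_ac)
    ultimately show ?thesis using 1 unfolding g2_def gmix_def by (simp add: distrib_left)
  qed
  have gpos: "0 < gmix k \<beta> Q x" if "0 < x" "x < 1" for x
  proof -
    have "0 < lam * g2 x" using lam g2_ge[OF that] b by simp
    then show ?thesis using lower[OF that(1)] by simp
  qed
  show "\<And>x. 0 < gmix k \<beta>0 Q0 x \<Longrightarrow> 0 < gmix k \<beta> Q x"
    using gpos m0.gmix_eq_0 by (metis greaterThanLessThan_iff less_irrefl)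
  let ?g0 = "gmix k \<beta>0 Q0"
  define J where "J x = (if 0 < x \<and> x < 1 then (?g0 x)\<^sup>2 / g2 x else 0)" for x
  have g2m[measurable]: "g2 \<in> borel_measurable borel" unfolding g2_def[abs_def] gp_def pz_def by measurable
  have Jm[measurable]: "J \<in> borel_measurable borel" unfolding J_def by measurable
  have J0: "0 \<le> J x" for x unfolding J_def using g2_ge[of x] b by auto
  have g20: "0 \<le> g2 x" for x using gp0 pz0 m0.beta_nonneg[of k] by (simp add: g2_def)
  \<comment> \<open>Completing the square: \<open>g0^2 / g2 = (g0 - g2)^2 / g2 + 2 g0 - g2\<close>.
    With \<open>g2\<close> on the left all integrands are nonnegative; its integral, which is only
    close to \<open>1\<close>, is subtracted at the end.\<close>
  have ptw: "J x + g2 x \<le> 1 / \<beta>0 0 * ((pz x - (\<integral>\<theta>. psi k x \<theta> \<partial>Q0))\<^sup>2 * indicator {0<..<1} x) + 2 * ?g0 x" if "x \<noteq> 1" for x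
  proof (cases "0 < x \<and> x < 1")
    case True
    have "?g0 x - g2 x = \<beta>0 k * ((\<integral>\<theta>. psi k x \<theta> \<partial>Q0) - pz x)" by (simp add: gmix_def g2_def gp_def algebra_simps)
    then have "(?g0 x - g2 x)\<^sup>2 = (\<beta>0 k)\<^sup>2 * (pz x - (\<integral>\<theta>. psi k x \<theta> \<partial>Q0))\<^sup>2"
      by (simp add: power_mult_distrib power2_commute)
    also have "\<dots> \<le> 1 * (pz x - (\<integral>\<theta>. psi k x \<theta> \<partial>Q0))\<^sup>2"
      using m0.beta_nonneg[of k] m0.beta_le[of k] by (intro mult_right_mono) (auto simp: power_le_one)
    finally have q: "(?g0 x - g2 x)\<^sup>2 \<le> (pz x - (\<integral>\<theta>. psi k x \<theta> \<partial>Q0))\<^sup>2" by simp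
    have g2p: "0 < g2 x" using g2_ge[of x] b True by simp
    then have "J x + g2 x = (?g0 x - g2 x)\<^sup>2 / g2 x + 2 * ?g0 x"
      using True by (simp add: J_def field_simps power2_eq_square)
    also have "(?g0 x - g2 x)\<^sup>2 / g2 x \<le> (pz x - (\<integral>\<theta>. psi k x \<theta> \<partial>Q0))\<^sup>2 / \<beta>0 0"
      using q g2_ge[of x] b True by (intro frac_le) auto
    finally show ?thesis using True by simp
  next
    case False
    have "g2 x = 0"
    proof -
      have "gp x = 0" unfolding gp_def using False that by (auto intro!: sum.neutral psi_eq_0)
      moreover have "pz x = 0" unfolding pz_def
      proof (intro sum.neutral ballI)
        fix l assume "l \<in> Z"
        then have "gmid L l < 1" using gmid_bounds[OF L] Z by auto
        then have "gmid L l \<le> x \<or> x \<le> 0" using False by linarith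
        then show "w l * psi k x (gmid L l) = 0" by (simp add: psi_eq_0)
      qed
      ultimately show ?thesis by (simp add: g2_def)
    qed
    then show ?thesis using False m0.gmix_nonneg by (simp add: J_def)
  qed
  have int_g2: "(\<integral>\<^sup>+ x. ennreal (g2 x) \<partial>lborel) = ennreal ((\<Sum>j<k. \<beta>0 j) + \<beta>0 k * (\<Sum>l\<in>Z. w l))"
  proof -
    have c: "(\<integral>\<^sup>+ x. ennreal (c * psi m x \<theta>) \<partial>lborel) = ennreal c" if "0 \<le> c" "0 < \<theta>" "1 \<le> m" for c m \<theta>
      using that by (simp add: ennreal_mult psi_nonneg nn_integral_cmult nn_integral_psi[OF that(2,3)])
    have "(\<integral>\<^sup>+ x. ennreal (gp x) \<partial>lborel) = (\<integral>\<^sup>+ x. (\<Sum>j<k. ennreal (\<beta>0 j * psi (j + 1) x 1)) \<partial>lborel)"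
      unfolding gp_def by (intro nn_integral_cong sum_ennreal[symmetric]) (auto simp: psi_nonneg m0.beta_nonneg)
    also have "\<dots> = (\<Sum>j<k. \<integral>\<^sup>+ x. ennreal (\<beta>0 j * psi (j + 1) x 1) \<partial>lborel)" by (rule nn_integral_sum) measurable
    also have "\<dots> = (\<Sum>j<k. ennreal (\<beta>0 j))" by (intro sum.cong refl c m0.beta_nonneg) auto
    also have "\<dots> = ennreal (\<Sum>j<k. \<beta>0 j)" by (rule sum_ennreal) (auto simp: m0.beta_nonneg)
    finally have 1: "(\<integral>\<^sup>+ x. ennreal (gp x) \<partial>lborel) = ennreal (\<Sum>j<k. \<beta>0 j)" .
    have "(\<integral>\<^sup>+ x. ennreal (pz x) \<partial>lborel) = (\<integral>\<^sup>+ x. (\<Sum>l\<in>Z. ennreal (w l * psi k x (gmid L l))) \<partial>lborel)"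
      unfolding pz_def using w by (intro nn_integral_cong sum_ennreal[symmetric]) (auto simp: psi_nonneg)
    also have "\<dots> = (\<Sum>l\<in>Z. \<integral>\<^sup>+ x. ennreal (w l * psi k x (gmid L l)) \<partial>lborel)" by (rule nn_integral_sum) measurable
    also have "\<dots> = (\<Sum>l\<in>Z. ennreal (w l))" using w gmid_bounds[OF L] Z m0.k1 by (intro sum.cong refl c) auto
    also have "\<dots> = ennreal (\<Sum>l\<in>Z. w l)" by (rule sum_ennreal) (use w in auto)
    finally have 2: "(\<integral>\<^sup>+ x. ennreal (pz x) \<partial>lborel) = ennreal (\<Sum>l\<in>Z. w l)" .
    have "gp \<in> borel_measurable borel" "pz \<in> borel_measurable borel" unfolding gp_def[abs_def] pz_def[abs_def] by measurable
    then have "(\<integral>\<^sup>+ x. ennreal (g2 x) \<partial>lborel) = (\<integral>\<^sup>+ x. ennreal (gp x) \<partial>lborel) + ennreal (\<beta>0 k) * (\<integral>\<^sup>+ x. ennreal (pz x) \<partial>lborel)"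
      using gp0 pz0 m0.beta_nonneg[of k] unfolding g2_def
      by (simp add: ennreal_mult nn_integral_add nn_integral_cmult)
    moreover have "0 \<le> (\<Sum>j<k. \<beta>0 j)" "0 \<le> (\<Sum>l\<in>Z. w l)" using m0.beta_nonneg w by (auto intro!: sum_nonneg)
    ultimately show ?thesis unfolding 1 2 using m0.beta_nonneg[of k]
      by (simp add: ennreal_plus ennreal_mult del: sum_ennreal)
  qed
  have mass2: "1 - \<eta> \<le> (\<Sum>j<k. \<beta>0 j) + \<beta>0 k * (\<Sum>l\<in>Z. w l)"
  proof -
    have "\<beta>0 k * (1 - \<eta>) \<le> \<beta>0 k * (\<Sum>l\<in>Z. w l)" using mass(1) m0.beta_nonneg[of k] by (intro mult_left_mono) auto
    moreover have "\<beta>0 k * \<eta> \<le> 1 * \<eta>" using m0.beta_le[of k] eta by (intro mult_right_mono) auto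
    ultimately show ?thesis using m0.beta_sum by (simp add: algebra_simps)
  qed
  have "(\<integral>\<^sup>+ x. ennreal (J x) \<partial>lborel) + ennreal ((\<Sum>j<k. \<beta>0 j) + \<beta>0 k * (\<Sum>l\<in>Z. w l))
     = (\<integral>\<^sup>+ x. ennreal (J x + g2 x) \<partial>lborel)"
    unfolding int_g2[symmetric] using J0 g20 by (simp add: nn_integral_add)
  also have "\<dots> \<le> (\<integral>\<^sup>+ x. ennreal (1 / \<beta>0 0) * (ennreal ((pz x - (\<integral>\<theta>. psi k x \<theta> \<partial>Q0))\<^sup>2) * indicator {0<..<1} x) + ennreal 2 * ennreal (?g0 x) \<partial>lborel)"
  proof (rule nn_integral_mono_AE, use AE_lborel_singleton[of 1] in eventually_elim)
    case (elim x)
    have "ennreal (J x + g2 x) \<le> ennreal (1 / \<beta>0 0 * ((pz x - (\<integral>\<theta>. psi k x \<theta> \<partial>Q0))\<^sup>2 * indicator {0<..<1} x) + 2 * ?g0 x)"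
      by (rule ennreal_leI[OF ptw[OF elim]])
    also have "\<dots> = ennreal (1 / \<beta>0 0 * ((pz x - (\<integral>\<theta>. psi k x \<theta> \<partial>Q0))\<^sup>2 * indicator {0<..<1} x)) + ennreal (2 * ?g0 x)"
      using b m0.gmix_nonneg by (intro ennreal_plus) auto
    also have "ennreal (2 * ?g0 x) = ennreal 2 * ennreal (?g0 x)" using m0.gmix_nonneg by (intro ennreal_mult) auto
    also have "ennreal (1 / \<beta>0 0 * ((pz x - (\<integral>\<theta>. psi k x \<theta> \<partial>Q0))\<^sup>2 * indicator {0<..<1} x))
      = ennreal (1 / \<beta>0 0) * (ennreal ((pz x - (\<integral>\<theta>. psi k x \<theta> \<partial>Q0))\<^sup>2) * indicator {0<..<1} x)"
      using b by (subst ennreal_mult) (auto simp: indicator_def)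
    finally show ?case .
  qed
  also have "\<dots> = ennreal (1 / \<beta>0 0) * (\<integral>\<^sup>+ x. ennreal ((pz x - (\<integral>\<theta>. psi k x \<theta> \<partial>Q0))\<^sup>2) * indicator {0<..<1} x \<partial>lborel) + ennreal 2 * 1"
  proof -
    have [measurable]: "(\<lambda>x. \<integral>\<theta>. psi k x \<theta> \<partial>Q0) \<in> borel_measurable borel"
    proof -
      note [measurable] = m0.measurable_snd_Q
      have "(\<lambda>p. psi k (fst p) (snd p)) \<in> borel_measurable (borel \<Otimes>\<^sub>M Q0)" by measurable
      then show ?thesis by (intro m0.Q.borel_measurable_lebesgue_integral) (auto simp: split_beta')
    qed
    have [measurable]: "pz \<in> borel_measurable borel" unfolding pz_def[abs_def] by measurable
    show ?thesis unfolding m0.nn_integral_gmix[symmetric]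
      by (subst nn_integral_add, measurable) (subst nn_integral_cmult, measurable, subst nn_integral_cmult, measurable)
  qed
  also have "\<dots> \<le> ennreal (1 / \<beta>0 0) * ennreal e2 + ennreal 2 * 1"
    using e2 unfolding pz_def by (intro add_right_mono mult_left_mono) auto
  also have "\<dots> = ennreal (e2 / \<beta>0 0 + 2)" using b e20 by (simp add: ennreal_mult[symmetric])
  finally have "(\<integral>\<^sup>+ x. ennreal (J x) \<partial>lborel) \<le> ennreal (e2 / \<beta>0 0 + 2 - ((\<Sum>j<k. \<beta>0 j) + \<beta>0 k * (\<Sum>l\<in>Z. w l)))"
    by (rule ennreal_add_le_imp_le_diff) (use mass2 mass(2) b e20 in auto)
  also have "\<dots> \<le> ennreal (1 + \<eta> + e2 / \<beta>0 0)" using mass2 by (intro ennreal_leI) auto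
  finally have IJ: "(\<integral>\<^sup>+ x. ennreal (J x) \<partial>lborel) \<le> ennreal (1 + \<eta> + e2 / \<beta>0 0)" .
  have "(\<integral>\<^sup>+ x. ennreal ((?g0 x)\<^sup>2 / gmix k \<beta> Q x) \<partial>lborel) \<le> (\<integral>\<^sup>+ x. ennreal (1 / lam) * ennreal (J x) \<partial>lborel)"
  proof (rule nn_integral_mono)
    fix x
    have "(?g0 x)\<^sup>2 / gmix k \<beta> Q x \<le> 1 / lam * J x"
    proof (cases "0 < x \<and> x < 1")
      case True
      have "(?g0 x)\<^sup>2 / gmix k \<beta> Q x \<le> (?g0 x)\<^sup>2 / (lam * g2 x)"
        using lower[of x] True lam g2_ge[of x] b by (intro divide_left_mono) (auto intro!: mult_pos_pos gpos)
      then show ?thesis using True by (simp add: J_def)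
    next
      case False
      then show ?thesis using m0.gmix_eq_0[of x] by (simp add: J_def)
    qed
    then show "ennreal ((?g0 x)\<^sup>2 / gmix k \<beta> Q x) \<le> ennreal (1 / lam) * ennreal (J x)"
      using lam J0 by (simp add: ennreal_mult[symmetric] ennreal_leI)
  qed
  also have "\<dots> = ennreal (1 / lam) * (\<integral>\<^sup>+ x. ennreal (J x) \<partial>lborel)" by (rule nn_integral_cmult) measurable
  also have "\<dots> \<le> ennreal (1 / lam) * ennreal (1 + \<eta> + e2 / \<beta>0 0)" by (intro mult_left_mono IJ) simp
  also have "\<dots> = ennreal (1 / lam * (1 + \<eta> + e2 / \<beta>0 0))" using lam eta e20 b by (intro ennreal_mult[symmetric]) auto
  also have "1 / lam = (1 + \<rho>) * (1 + \<eta>) / (1 - \<rho>)\<^sup>2" by (simp add: lam_def)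
  finally show "(\<integral>\<^sup>+ x. ennreal ((?g0 x)\<^sup>2 / gmix k \<beta> Q x) \<partial>lborel)
      \<le> ennreal ((1 + \<rho>) * (1 + \<eta>) / (1 - \<rho>)\<^sup>2 * (1 + \<eta> + e2 / \<beta>0 0))" .
qed

text \<open>For \<open>n \<ge> 2\<close> the constant is absorbed into the exponent, since
  \<open>\<kappa>\<close> is at least \<open>n\<close> to the power
  \<open>- \<bar>ln \<kappa>\<bar> / ln 2\<close>.\<close>

lemma poly_lower:
  fixes \<kappa> s :: real
  assumes "0 < \<kappa>"
  shows "\<exists>A\<ge>0. \<forall>n::nat. 2 \<le> n \<longrightarrow> real n powr (- A) \<le> \<kappa> * real n powr (- s)"
proof (intro exI[of _ "\<bar>s\<bar> + \<bar>ln \<kappa>\<bar> / ln 2"] conjI allI impI)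
  show "0 \<le> \<bar>s\<bar> + \<bar>ln \<kappa>\<bar> / ln 2" by simp
  fix n :: nat assume n: "2 \<le> n"
  have l: "ln 2 \<le> ln (real n)" using n by simp
  have "\<bar>ln \<kappa>\<bar> * ln 2 \<le> \<bar>ln \<kappa>\<bar> * ln (real n)" using l by (intro mult_left_mono) auto
  then have "\<bar>ln \<kappa>\<bar> \<le> \<bar>ln \<kappa>\<bar> / ln 2 * ln (real n)" by (simp add: field_simps)
  moreover have "s * ln (real n) \<le> \<bar>s\<bar> * ln (real n)" using l ln_gt_zero[of "2::real"] by (intro mult_right_mono) linarith+
  ultimately have "- (\<bar>s\<bar> + \<bar>ln \<kappa>\<bar> / ln 2) * ln (real n) \<le> ln \<kappa> + - s * ln (real n)"
  proof -
    assume 1: "\<bar>ln \<kappa>\<bar> \<le> \<bar>ln \<kappa>\<bar> / ln 2 * ln (real n)" "s * ln (real n) \<le> \<bar>s\<bar> * ln (real n)"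
    have "- (\<bar>s\<bar> + \<bar>ln \<kappa>\<bar> / ln 2) * ln (real n) = - (\<bar>s\<bar> * ln (real n)) - \<bar>ln \<kappa>\<bar> / ln 2 * ln (real n)"
      by (simp add: algebra_simps)
    then show ?thesis using 1 abs_ge_minus_self[of "ln \<kappa>"] by simp
  qed
  then have "exp (- (\<bar>s\<bar> + \<bar>ln \<kappa>\<bar> / ln 2) * ln (real n)) \<le> exp (ln \<kappa> + - s * ln (real n))" by simp
  then show "real n powr (- (\<bar>s\<bar> + \<bar>ln \<kappa>\<bar> / ln 2)) \<le> \<kappa> * real n powr (- s)"
    using assms n by (simp only: exp_add exp_ln powr_def) auto
qed

lemma gatom_sets_M01:
  assumes "1 \<le> L" "\<rho> \<le> 1" "l < L"
  shows "gatom L \<rho> l \<in> sets M01"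
  using gatom_subset_unit[OF assms] unfolding sets_M01
  by (auto simp: sets_restrict_space_iff gatom_def)

lemma measure_mono_M01:
  assumes "prob_space H" "sets H = sets M01" "A \<subseteq> B" "B \<in> sets M01"
  shows "measure H A \<le> measure H B"
proof -
  interpret prob_space H by fact
  show ?thesis using assms by (intro finite_measure_mono) auto
qed

text \<open>The atom intervals and their complement form a finite partition of the unit interval, on
  which the process is a Dirichlet vector. By (C2) every member, the complement included, has a
  parameter of at least \<open>\<alpha>min\<close>, which is polynomial in
  \<open>\<rho> / L\<close>.\<close>

lemma dirichlet_process_atoms_mass:
  fixes a t2 c :: real
  assumes a: "0 < a" and H: "prob_space H" "sets H = sets M01" and DP: "is_DP P a H"
    and C2: "0 < t2" "0 < c" "\<And>u v. 0 \<le> u \<Longrightarrow> u < v \<Longrightarrow> v \<le> 1 \<Longrightarrow> c * (v - u) powr t2 \<le> measure H {u<..<v}"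
    and L: "1 \<le> L" and rho: "0 < \<rho>" "\<rho> \<le> 1" and Z: "Z \<subseteq> {..<L}"
    and w: "\<And>l. l \<in> Z \<Longrightarrow> 0 \<le> w l" "(\<Sum>l\<in>Z. w l) \<le> 1"
    and Gam: "0 < \<Gamma>" "\<And>\<alpha>. 0 < \<alpha> \<Longrightarrow> \<alpha> \<le> a \<Longrightarrow> \<alpha> / \<Gamma> \<le> 1 / Gamma \<alpha>"
  shows "ennreal ((exp (- 2) / (2 * \<Gamma>) * (a * (c * (\<rho> / (2 * real L)) powr t2)) * (\<rho> / (2 * real (card Z + 1))) powr (a + 1)) ^ (card Z + 1))
    \<le> emeasure P {Q \<in> space P. \<forall>l\<in>Z. (1 - \<rho>) * w l \<le> measure Q (gatom L \<rho> l)}"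
proof -
  interpret H: prob_space H by fact
  interpret P: prob_space P using DP by (simp add: is_DP_def)
  have setsP: "sets P = sets (prob_algebra M01)" using DP by (simp add: is_DP_def)
  define m where "m = card Z"
  have finZ: "finite Z" using Z finite_subset by blast
  obtain h where h: "bij_betw h {..<m} Z" using ex_bij_betw_nat_finite[OF finZ] by (auto simp: m_def lessThan_atLeast0)
  have hZ: "h i \<in> Z" if "i < m" for i using bij_betwE[OF h] that by auto
  have hL: "h i < L" if "i < m" for i using hZ[OF that] Z by auto
  let ?U = "gatom L \<rho>"
  define A where "A i = (if i < m then ?U (h i) else {0<..<1} - (\<Union>l\<in>Z. ?U l))" for i
  have Um: "?U l \<in> sets M01" if "l \<in> Z" for l using gatom_sets_M01[OF L rho(2)] Z that by auto
  have UnM: "{0<..<1} \<in> sets M01" using sets.top[of M01] by (simp add: space_M01)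
  have Am: "A i \<in> sets M01" for i
    using Um hZ finZ UnM by (auto simp: A_def intro!: sets.Diff sets.finite_UN)
  have disjU: "l = l'" if "x \<in> ?U l" "x \<in> ?U l'" for x l l'
    using gcell_disjoint[OF L] gatom_subset_gcell[OF L rho(2)] that by blast
  have disj: "disjoint_family_on A {..<m + 1}"
    unfolding disjoint_family_on_def
  proof (intro ballI impI)
    fix i j assume ij: "i \<in> {..<m + 1}" "j \<in> {..<m + 1}" "i \<noteq> j"
    have hne: "h i \<noteq> h j" if "i < m" "j < m" using bij_betw_imp_inj_on[OF h] ij that by (auto simp: inj_on_def)
    show "A i \<inter> A j = {}"
    proof (cases "i < m \<and> j < m")
      case True
      then show ?thesis using hne disjU by (auto simp: A_def)
    next
      case False
      then show ?thesis using ij hZ by (auto simp: A_def)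
    qed
  qed
  have UNA: "(\<Union>i<m + 1. A i) = {0<..<1}"
  proof
    show "(\<Union>i<m + 1. A i) \<subseteq> {0<..<1}"
      using gatom_subset_unit[OF L rho(2) hL] by (fastforce simp: A_def split: if_splits)
    show "{0<..<1} \<subseteq> (\<Union>i<m + 1. A i)"
    proof
      fix x :: real assume x: "x \<in> {0<..<1}"
      show "x \<in> (\<Union>i<m + 1. A i)"
      proof (cases "\<exists>l\<in>Z. x \<in> ?U l")
        case True
        then obtain l where l: "l \<in> Z" "x \<in> ?U l" by auto
        then obtain i where "i < m" "h i = l" using bij_betw_imp_surj_on[OF h] by (metis imageE lessThan_iff)
        then show ?thesis using l by (intro UN_I[of i]) (auto simp: A_def)
      next
        case False
        then show ?thesis using x by (intro UN_I[of m]) (auto simp: A_def)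
      qed
    qed
  qed
  \<comment> \<open>No mass is demanded of the complement, which has the last index
    \<open>m\<close>.\<close>
  define wt where "wt i = (if i < m then w (h i) else 0)" for i
  have wt_sum: "(\<Sum>i<m + 1. wt i) \<le> 1"
  proof -
    have "(\<Sum>i<m + 1. wt i) = (\<Sum>i<m. w (h i))" by (simp add: wt_def)
    also have "\<dots> = (\<Sum>l\<in>Z. w l)" by (rule sum.reindex_bij_betw[OF h])
    finally show ?thesis using w by simp
  qed
  let ?f = "\<lambda>Q. \<lambda>i\<in>{..<m + 1}. measure Q (A i)"
  define \<alpha>min where "\<alpha>min = a * (c * (\<rho> / (2 * real L)) powr t2)"
  have rL: "0 < \<rho> / (2 * real L)" using rho L by simp
  have amin: "0 < \<alpha>min" unfolding \<alpha>min_def using a C2(1,2) rho L by (intro mult_pos_pos) auto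
  have HA: "c * (\<rho> / (2 * real L)) powr t2 \<le> measure H (A i)" if "i < m + 1" for i
  proof (cases "i < m")
    case True
    let ?z = "gmid L (h i)"
    have sub: "{?z<..<?z + \<rho> / (2 * real L)} \<subseteq> A i" using True by (auto simp: A_def gatom_def)
    have "?z + \<rho> / (2 * real L) \<le> 1"
    proof -
      have "\<rho> / (2 * real L) \<le> 1 / (2 * real L)" using rho by (intro divide_right_mono) auto
      moreover have "?z + 1 / (2 * real L) = (real (h i) + 1) / real L" using L by (simp add: gmid_def field_simps)
      moreover have "(real (h i) + 1) / real L \<le> 1" using hL[OF True] by (simp add: divide_le_eq)
      ultimately show ?thesis by linarith
    qed
    then have "c * (?z + \<rho> / (2 * real L) - ?z) powr t2 \<le> measure H {?z<..<?z + \<rho> / (2 * real L)}"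
      using gmid_bounds[OF L hL[OF True]] rL by (intro C2) auto
    also have "\<dots> \<le> measure H (A i)" by (rule measure_mono_M01[OF H sub Am])
    finally show ?thesis by simp
  next
    case False
    then have i: "i = m" using that by simp
    have half: "1 / (2 * real L) \<le> 1" using L by (simp add: field_simps)
    \<comment> \<open>All atom intervals lie to the right of \<open>1 / (2 L)\<close>, so the
      complement contains an interval of that length and (C2) applies to it.\<close>
    have sub: "{0<..<1 / (2 * real L)} \<subseteq> A i"
    proof
      fix x assume x: "x \<in> {0<..<1 / (2 * real L)}"
      have "x \<notin> ?U l" for l
      proof -
        have "1 / (2 * real L) \<le> gmid L l" using L by (simp add: gmid_def field_simps)
        then show ?thesis using x by (auto simp: gatom_def)
      qed
      then show "x \<in> A i" using x half by (auto simp: A_def i)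
    qed
    have "(\<rho> / (2 * real L)) powr t2 \<le> (1 / (2 * real L) - 0) powr t2"
      using rho C2(1) rL by (intro powr_mono2) (auto simp: divide_right_mono)
    then have "c * (\<rho> / (2 * real L)) powr t2 \<le> c * (1 / (2 * real L) - 0) powr t2" using C2 by (intro mult_left_mono) auto
    also have "\<dots> \<le> measure H {0<..<1 / (2 * real L)}" using half L by (intro C2) auto
    also have "\<dots> \<le> measure H (A i)" by (rule measure_mono_M01[OF H sub Am])
    finally show ?thesis .
  qed
  let ?E = "{y \<in> space (PiM {..<m + 1} (\<lambda>_. borel :: real measure)). \<forall>i<m + 1. (1 - \<rho>) * wt i \<le> y i}"
  have "ennreal ((exp (- 2) / (2 * \<Gamma>) * \<alpha>min * (\<rho> / (2 * real (m + 1))) powr (a + 1)) ^ (m + 1))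
     \<le> emeasure (dirichlet (m + 1) (\<lambda>i. a * measure H (A i))) ?E"
  proof (rule dirichlet_lower_bound[OF _ _ amin _ wt_sum rho Gam])
    fix i assume "i < m + 1"
    then show "\<alpha>min \<le> a * measure H (A i) \<and> a * measure H (A i) \<le> a"
      using HA[of i] a H.prob_le_1[of "A i"] by (auto simp: \<alpha>min_def intro!: mult_left_mono mult_left_le)
    show "0 \<le> wt i" using w hZ by (auto simp: wt_def)
  qed simp
  also have "dirichlet (m + 1) (\<lambda>i. a * measure H (A i)) = distr P (PiM {..<m + 1} (\<lambda>_. borel)) ?f"
    using DP Am disj UNA unfolding is_DP_def by (metis le_add2)
  also have "emeasure \<dots> ?E = emeasure P (?f -` ?E \<inter> space P)"
  proof (rule emeasure_distr)
    have "(\<lambda>Q. measure Q (A i)) \<in> borel_measurable P" for i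
      using measurable_measure_subprob_algebra[OF Am[of i]] measurable_prob_algebraD[OF measurable_ident_sets[OF setsP]]
      by (rule measurable_compose[rotated])
    then show "?f \<in> measurable P (PiM {..<m + 1} (\<lambda>_. borel))" by measurable
    show "?E \<in> sets (PiM {..<m + 1} (\<lambda>_. borel))" by measurable
  qed
  also have "emeasure P (?f -` ?E \<inter> space P) \<le> emeasure P {Q \<in> space P. \<forall>l\<in>Z. (1 - \<rho>) * w l \<le> measure Q (gatom L \<rho> l)}"
  proof (rule emeasure_mono)
  show "?f -` ?E \<inter> space P \<subseteq> {Q \<in> space P. \<forall>l\<in>Z. (1 - \<rho>) * w l \<le> measure Q (gatom L \<rho> l)}"
  proof
    fix Q assume Q: "Q \<in> ?f -` ?E \<inter> space P"
    then have all: "\<forall>i<m + 1. (1 - \<rho>) * wt i \<le> ?f Q i" by blast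
    have "(1 - \<rho>) * w l \<le> measure Q (?U l)" if "l \<in> Z" for l
    proof -
      obtain i where i: "i < m" "h i = l" using bij_betw_imp_surj_on[OF h] \<open>l \<in> Z\<close> by (metis imageE lessThan_iff)
      have "(1 - \<rho>) * wt i \<le> ?f Q i" 
      proof -
        have "i < m + 1" using i by simp
        then show ?thesis using all by blast
      qed
      then show ?thesis using i by (simp add: wt_def A_def)
    qed
    then show "Q \<in> {Q \<in> space P. \<forall>l\<in>Z. (1 - \<rho>) * w l \<le> measure Q (gatom L \<rho> l)}" using Q by auto
  qed
    have mU: "(\<lambda>Q. measure Q (?U l)) \<in> borel_measurable P" if "l \<in> Z" for l
      using measurable_measure_subprob_algebra[OF Um[OF that]] measurable_prob_algebraD[OF measurable_ident_sets[OF setsP]]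
      by (rule measurable_compose[rotated])
    have "{Q \<in> space P. (1 - \<rho>) * w l \<le> measure Q (?U l)} \<in> sets P" if "l \<in> Z" for l
      using borel_measurable_const mU[OF that] by (rule borel_measurable_le)
    then show "{Q \<in> space P. \<forall>l\<in>Z. (1 - \<rho>) * w l \<le> measure Q (gatom L \<rho> l)} \<in> sets P"
      using finZ by (rule sets.sets_Collect_finite_All)
  qed
  finally show ?thesis by (simp only: m_def \<alpha>min_def)
qed

text \<open>A nonnegative integral is measurable in its measure, so the mixture is rewritten with
  \<open>enn2real\<close> of such an integral; the two agree because \<open>psi\<close> is
  nonnegative.\<close>

lemma measurable_gmix_joint:
  assumes D: "sets D = sets (PiM {..<k + 1} (\<lambda>_. borel :: real measure))" and P: "sets P = sets (prob_algebra M01)"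
  shows "(\<lambda>(p, x). gmix k (fst p) (snd p) x) \<in> borel_measurable ((D \<Otimes>\<^sub>M P) \<Otimes>\<^sub>M borel)"
proof -
  let ?M = "(D \<Otimes>\<^sub>M P) \<Otimes>\<^sub>M (borel :: real measure)"
  have mb: "(\<lambda>q. fst (fst q) j) \<in> borel_measurable ?M" if "j < k + 1" for j
  proof -
    have "(\<lambda>\<beta>. \<beta> j) \<in> borel_measurable D"
      using measurable_component_singleton[of j "{..<k + 1}" "\<lambda>_. borel :: real measure"] that measurable_cong_sets[OF D refl, of borel] by blast
    then show ?thesis by (rule measurable_compose[OF measurable_compose[OF measurable_fst measurable_fst]])
  qed
  have mQ: "(\<lambda>q. snd (fst q)) \<in> measurable ?M (subprob_algebra M01)"
    by (rule measurable_compose[OF measurable_compose[OF measurable_fst measurable_snd]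
        measurable_prob_algebraD[OF measurable_ident_sets[OF P]]])
  have mx: "(\<lambda>q. snd q) \<in> borel_measurable ?M" by measurable
  have "(\<lambda>(q, \<theta>). ennreal (psi k (snd q) \<theta>)) \<in> borel_measurable (?M \<Otimes>\<^sub>M M01)"
  proof -
    have "(\<lambda>r. snd r) \<in> borel_measurable (?M \<Otimes>\<^sub>M M01)"
      by (rule measurable_compose[OF measurable_snd measurable_M01[OF measurable_ident, unfolded id_def]])
    moreover have "(\<lambda>r. snd (fst r)) \<in> borel_measurable (?M \<Otimes>\<^sub>M M01)"
      by (rule measurable_compose[OF measurable_fst mx])
    ultimately have "(\<lambda>r. psi k (snd (fst r)) (snd r)) \<in> borel_measurable (?M \<Otimes>\<^sub>M M01)"
      by (rule measurable_psi[rotated])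
    then show ?thesis by (simp add: split_beta')
  qed
  then have "(\<lambda>q. \<integral>\<^sup>+ \<theta>. ennreal (psi k (snd q) \<theta>) \<partial>(snd (fst q))) \<in> borel_measurable ?M"
    using mQ by (rule nn_integral_measurable_subprob_algebra2)
  then have mI: "(\<lambda>q. enn2real (\<integral>\<^sup>+ \<theta>. ennreal (psi k (snd q) \<theta>) \<partial>(snd (fst q)))) \<in> borel_measurable ?M"
    by (rule borel_measurable_enn2real)
  have "(\<lambda>q. (\<Sum>j<k. fst (fst q) j * psi (j + 1) (snd q) 1)
      + fst (fst q) k * enn2real (\<integral>\<^sup>+ \<theta>. ennreal (psi k (snd q) \<theta>) \<partial>(snd (fst q)))) \<in> borel_measurable ?M"
    using mI mx by (intro borel_measurable_add borel_measurable_sum borel_measurable_times mb measurable_psi) auto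
  also have "?this \<longleftrightarrow> (\<lambda>q. gmix k (fst (fst q)) (snd (fst q)) (snd q)) \<in> borel_measurable ?M"
  proof (rule measurable_cong)
    fix q assume "q \<in> space ?M"
    then have "snd (fst q) \<in> space P" by (auto simp: space_pair_measure)
    then have "sets (snd (fst q)) = sets M01"
      using sets_eq_imp_space_eq[OF P] by (simp add: space_prob_algebra)
    then have "psi k (snd q) \<in> borel_measurable (snd (fst q))"
      using measurable_M01[of "psi k (snd q)"] measurable_cong_sets[of "snd (fst q)" M01 borel borel] by simp
    then have "(\<integral>\<theta>. psi k (snd q) \<theta> \<partial>(snd (fst q))) = enn2real (\<integral>\<^sup>+ \<theta>. ennreal (psi k (snd q) \<theta>) \<partial>(snd (fst q)))"
      by (intro integral_eq_nn_integral) (auto simp: psi_nonneg)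
    then show "(\<Sum>j<k. fst (fst q) j * psi (j + 1) (snd q) 1)
      + fst (fst q) k * enn2real (\<integral>\<^sup>+ \<theta>. ennreal (psi k (snd q) \<theta>) \<partial>(snd (fst q))) = gmix k (fst (fst q)) (snd (fst q)) (snd q)"
      by (simp add: gmix_def)
  qed
  finally show ?thesis by (simp add: split_beta')
qed

section \<open>A finite family of tests\<close>

context mixing
begin

text \<open>Grid and coefficient resolution are both \<open>n\<close>, so discretisation adds an
  error of order \<open>N / n\<close>. The family depends on the truth and on the codes alone, and
  every mixture that is far enough away is rejected by one of its members.\<close>

lemma test_family:
  fixes a b G :: real and K N n :: nat
  assumes b: "0 < b" "b \<le> 1" and ball_bG: "\<forall>x\<in>{0<..<1}. b \<le> gmix k \<beta> Q x \<and> gmix k \<beta> Q x \<le> G"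
    and K: "1 \<le> K" "2 * G \<le> real K" and N: "1 \<le> N" and n: "1 \<le> n"
  shows "\<exists>(C :: (nat \<Rightarrow> nat \<times> nat \<times> (nat \<Rightarrow> nat)) set) F. finite C
    \<and> card C \<le> ((n + 1)\<^sup>2 * (K * n + 1) ^ k) ^ (4 * N + 2)
    \<and> (\<forall>c\<in>C. F c \<in> borel_measurable borel \<and> (\<forall>x. 0 < F c x)
         \<and> (\<integral>\<^sup>+ x. ennreal (gmix k \<beta> Q x * F c x) \<partial>lborel) \<le> ennreal (exp (- a)))
    \<and> (\<forall>\<beta>' Q'. mixing k \<beta>' Q' \<longrightarrow>
         2 * a \<le> b / (256 * real K) * (hellinger (gmix k \<beta>' Q') (gmix k \<beta> Q))\<^sup>2
            - (2 * (real k / real n)\<^sup>2 + 2 * (((4 ^ k) ^ (k - 1) * real K)\<^sup>2 / real N ^ (2 * k) * real k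
              + (real K)\<^sup>2 / real N ^ (2 * k) + (real K)\<^sup>2 * real (4 * N + 1) / real n) + (real K)\<^sup>2 * (1 / real n)) \<longrightarrow>
         (\<exists>c\<in>C. (\<integral>\<^sup>+ x. ennreal (gmix k \<beta>' Q' x / F c x) \<partial>lborel) \<le> ennreal (exp (- a))))"
proof -
  note bG = ball_bG[rule_format]
  let ?g0 = "gmix k \<beta> Q"
  let ?codes = "PiE {..<4 * N + 2} (\<lambda>_. piece_codes k n n K)"
  let ?u = "pieces_sum (4 * N + 2) k n n"
  define s where "s = 1 / (16 * real K)"
  have sp: "0 < s" "s * real K = 1 / 16" using K by (auto simp: s_def)
  define f where "f c x = (if x \<in> {0<..<1} then s * (?u c x - ?g0 x) else 0)" for c x
  \<comment> \<open>Only codes with values in \<open>[0, K]\<close> are kept, which makes the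
    statistic bounded by \<open>1\<close> as the exponential moment bounds require.\<close>
  define C where "C = {c \<in> ?codes. \<forall>x. 0 \<le> ?u c x \<and> ?u c x \<le> real K}"
  define E0 where "E0 c = (LINT x|lborel. ?g0 x * exp (f c x))" for c
  \<comment> \<open>\<open>test_product\<close> bounds only a product of two moments. Scaling by
    \<open>exp (- a) / E0 c\<close> splits a joint bound \<open>exp (- (2 * a))\<close> into the
    error \<open>exp (- a)\<close> on each side.\<close>
  define F where "F c x = exp (f c x) * (exp (- a) / E0 c)" for c x
  have fin: "finite ?codes" by (intro finite_PiE finite_piece_codes) auto
  have fm[measurable]: "f c \<in> borel_measurable borel" for c
    unfolding f_def[abs_def] by measurable
  have f1: "\<bar>f c x\<bar> \<le> 1" if "c \<in> C" for c x
  proof (cases "x \<in> {0<..<1}")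
    case True
    have "0 \<le> ?u c x" "?u c x \<le> real K" using that by (auto simp: C_def)
    then have "\<bar>?u c x - ?g0 x\<bar> \<le> real K" using bG[OF True] K b by linarith
    then have "s * \<bar>?u c x - ?g0 x\<bar> \<le> s * real K" using sp by (intro mult_left_mono) auto
    then show ?thesis using True sp by (simp add: f_def abs_mult)
  qed (auto simp: f_def)
  have int0: "integrable lborel (\<lambda>x. ?g0 x * exp (f c x))" if "c \<in> C" for c
    by (rule integral_exp_le(1)) (use f1[OF that] gmix_nonneg nn_integral_gmix in auto)
  have E0: "0 < E0 c" if c: "c \<in> C" for c
  proof -
    have gi: "integrable lborel ?g0" "(LINT x|lborel. ?g0 x) = 1"
      using integrable_density_function[OF borel_measurable_gmix gmix_nonneg nn_integral_gmix] by auto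
    have "exp (- 1) = (LINT x|lborel. ?g0 x * exp (- 1))" using gi by simp
    also have "\<dots> \<le> E0 c" unfolding E0_def
    proof (rule integral_mono[OF _ int0[OF c]])
      show "integrable lborel (\<lambda>x. ?g0 x * exp (- 1))" using gi by simp
      show "?g0 x * exp (- 1) \<le> ?g0 x * exp (f c x)" for x
        using f1[OF c, of x] gmix_nonneg by (intro mult_left_mono) (auto simp: abs_le_iff)
    qed
    finally show ?thesis using exp_gt_zero[of "- 1 :: real"] by linarith
  qed
  have cardC: "card C \<le> ((n + 1)\<^sup>2 * (K * n + 1) ^ k) ^ (4 * N + 2)"
  proof -
    have "card C \<le> card ?codes" using fin by (intro card_mono) (auto simp: C_def)
    also have "\<dots> = ((n + 1)\<^sup>2 * (K * n + 1) ^ k) ^ (4 * N + 2)"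
      by (subst card_PiE) (auto simp only: finite_lessThan card_piece_codes prod_constant card_lessThan)
    finally show ?thesis .
  qed
  have Fpos: "0 < F c x" if "c \<in> C" for c x using E0[OF that] by (simp add: F_def)
  have test0: "(\<integral>\<^sup>+ x. ennreal (?g0 x * F c x) \<partial>lborel) \<le> ennreal (exp (- a))" if c: "c \<in> C" for c
  proof -
    have "(\<integral>\<^sup>+ x. ennreal (?g0 x * F c x) \<partial>lborel) = ennreal (LINT x|lborel. ?g0 x * F c x)"
    proof (rule nn_integral_eq_integral)
      show "integrable lborel (\<lambda>x. ?g0 x * F c x)"
        using integrable_mult_left[OF int0[OF c], of "exp (- a) / E0 c"] by (simp add: F_def mult.assoc)
      show "AE x in lborel. 0 \<le> ?g0 x * F c x" using Fpos[OF c] gmix_nonneg by (intro AE_I2) (auto simp: less_imp_le)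
    qed
    also have "(LINT x|lborel. ?g0 x * F c x) = E0 c * (exp (- a) / E0 c)"
      unfolding E0_def F_def mult.assoc[symmetric] by (rule integral_mult_left_zero)
    also have "\<dots> = exp (- a)" using E0[OF c] by simp
    finally show ?thesis by simp
  qed
  have test1: "\<exists>c\<in>C. (\<integral>\<^sup>+ x. ennreal (gmix k \<beta>' Q' x / F c x) \<partial>lborel) \<le> ennreal (exp (- a))"
    if m: "mixing k \<beta>' Q'" and
      h: "2 * a \<le> b / (256 * real K) * (hellinger (gmix k \<beta>' Q') ?g0)\<^sup>2
            - (2 * (real k / real n)\<^sup>2 + 2 * (((4 ^ k) ^ (k - 1) * real K)\<^sup>2 / real N ^ (2 * k) * real k
              + (real K)\<^sup>2 / real N ^ (2 * k) + (real K)\<^sup>2 * real (4 * N + 1) / real n) + (real K)\<^sup>2 * (1 / real n))" for \<beta>' Q'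
  proof -
    interpret m: mixing k \<beta>' Q' by fact
    let ?gt = "gmix k \<beta>' Q'"
    define e2 where "e2 = 2 * (real k / real n)\<^sup>2 + 2 * (((4 ^ k) ^ (k - 1) * real K)\<^sup>2 / real N ^ (2 * k) * real k
              + (real K)\<^sup>2 / real N ^ (2 * k) + (real K)\<^sup>2 * real (4 * N + 1) / real n)"
    have e20: "0 \<le> e2" unfolding e2_def by (intro add_nonneg_nonneg mult_nonneg_nonneg divide_nonneg_nonneg) auto
    obtain c a0 where c: "c \<in> ?codes" and
      u: "\<forall>x. 0 \<le> ?u c x \<and> ?u c x \<le> real K" "\<forall>x. 0 < x \<longrightarrow> x \<le> a0 \<longrightarrow> ?u c x = real K"
      "\<forall>x. 0 < x \<longrightarrow> x < a0 - 1 / real n \<longrightarrow> real K \<le> ?gt x" "\<forall>x. a0 < x \<longrightarrow> ?gt x \<le> real K"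
      "(\<integral>\<^sup>+ x. ennreal ((?gt x - ?u c x)\<^sup>2) * indicator {a0<..<1} x \<partial>lborel) \<le> ennreal e2"
      using m.cover_function[OF N n n K(1)] unfolding e2_def by blast
    have cC: "c \<in> C" using c u by (simp add: C_def)
    have fc: "f c = (\<lambda>x. if x \<in> {0<..<1} then s * (?u c x - ?g0 x) else 0)" by (rule ext) (rule f_def)
    have "(LINT x|lborel. ?g0 x * exp (f c x)) * (LINT x|lborel. ?gt x * exp (- f c x))
      \<le> exp (- (s * b / 16) * (hellinger ?gt ?g0)\<^sup>2 + e2 + (real K)\<^sup>2 * (1 / real n))"
    proof (rule test_product[where u="?u c" and ?a0.0=a0 and G=G])
      show "f c = (\<lambda>x. if x \<in> {0<..<1} then s * (?u c x - ?g0 x) else 0)" by (rule fc)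
      show "s = 1 / (16 * real K)" by (simp add: s_def)
      show "x \<in> {0<..<1} \<Longrightarrow> b \<le> ?g0 x \<and> ?g0 x \<le> G" for x by (rule bG)
      show "x \<notin> {0<..<1} \<Longrightarrow> ?gt x = 0" for x by (rule m.gmix_eq_0)
      show "x \<notin> {0<..<1} \<Longrightarrow> ?g0 x = 0" for x by (rule gmix_eq_0)
      show "(\<integral>\<^sup>+ x. ennreal ((?gt x - ?u c x)\<^sup>2) * indicator {a0<..<1} x \<partial>lborel) \<le> ennreal e2" by (rule u)
    qed (use u b K e20 m.gmix_nonneg gmix_nonneg m.nn_integral_gmix nn_integral_gmix in auto)
    also have "\<dots> \<le> exp (- (2 * a))"
    proof -
      have "s * b / 16 = b / (256 * real K)" by (simp add: s_def)
      then show ?thesis using h by (simp add: e2_def)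
    qed
    finally have EE: "E0 c * (LINT x|lborel. ?gt x * exp (- f c x)) \<le> exp (- (2 * a))" by (simp add: E0_def)
    have int1: "integrable lborel (\<lambda>x. ?gt x * exp (- f c x))"
      by (rule integral_exp_le(1)) (use f1[OF cC] m.gmix_nonneg m.nn_integral_gmix in auto)
    have e: "?gt x / F c x = ?gt x * exp (- f c x) * (exp a * E0 c)" for x
      using E0[OF cC] by (simp add: F_def exp_minus field_simps)
    have "(\<integral>\<^sup>+ x. ennreal (?gt x / F c x) \<partial>lborel) = ennreal (LINT x|lborel. ?gt x * exp (- f c x) * (exp a * E0 c))"
      unfolding e using E0[OF cC] m.gmix_nonneg
      by (intro nn_integral_eq_integral integrable_mult_left int1 AE_I2) auto
    also have "(LINT x|lborel. ?gt x * exp (- f c x) * (exp a * E0 c)) = (LINT x|lborel. ?gt x * exp (- f c x)) * (exp a * E0 c)"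
      by (rule integral_mult_left_zero)
    also have "\<dots> = exp a * (E0 c * (LINT x|lborel. ?gt x * exp (- f c x)))" by simp
    also have "ennreal \<dots> \<le> ennreal (exp a * exp (- (2 * a)))" using EE by (intro ennreal_leI mult_left_mono) auto
    also have "exp a * exp (- (2 * a)) = exp (- a)" by (simp add: exp_add[symmetric])
    finally show ?thesis using cC by blast
  qed
  have finC: "finite C" using fin by (simp add: C_def)
  have mF: "F c \<in> borel_measurable borel" for c unfolding F_def[abs_def] by measurable
  show ?thesis
    by (intro exI[of _ C] exI[of _ F] conjI ballI allI impI finC cardC mF Fpos test0 test1)
qed

end

section \<open>A prior neighbourhood of the truth\<close>

lemma sets_dirichlet: "sets (dirichlet m \<alpha>) = sets (PiM {..<m} (\<lambda>_. borel))"
  by (simp add: dirichlet_def)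

lemma space_prior_mixing:
  assumes "1 \<le> k" "sets P = sets (prob_algebra M01)" "p \<in> space (D \<Otimes>\<^sub>M P)" "fst p \<in> unit_simplex (k + 1)"
  shows "mixing k (fst p) (snd p)"
proof -
  have "snd p \<in> space P" using assms(3) by (auto simp: space_pair_measure)
  then have "snd p \<in> space (prob_algebra M01)" unfolding sets_eq_imp_space_eq[OF assms(2)] .
  then have "prob_space (snd p)" "sets (snd p) = sets M01" unfolding space_prob_algebra by blast+
  then show ?thesis using assms(1,4) by (intro mixing.intro)
qed

text \<open>The null set comes from the weights alone: they lie in the simplex almost surely,
  whereas every point of the space of \<open>P\<close> is a probability measure.\<close>

lemma AE_prior_mixing:
  assumes k: "1 \<le> k" and as: "\<forall>j\<le>k. 0 < as j" and P: "prob_space P" "sets P = sets (prob_algebra M01)"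
  shows "AE p in dirichlet (k + 1) as \<Otimes>\<^sub>M P. mixing k (fst p) (snd p)"
proof -
  interpret D: dirichlet_params "k + 1" as using as by unfold_locales auto
  interpret P: prob_space P by fact
  let ?D = "dirichlet (k + 1) as"
  interpret PD: prob_space ?D by (rule D.prob_space_dirichlet)
  obtain N where N: "{\<beta> \<in> space ?D. \<not> \<beta> \<in> unit_simplex (k + 1)} \<subseteq> N" "emeasure ?D N = 0" "N \<in> sets ?D"
    using D.AE_dirichlet_simplex by (rule AE_E)
  show ?thesis
  proof (rule AE_I)
    show "{p \<in> space (?D \<Otimes>\<^sub>M P). \<not> mixing k (fst p) (snd p)} \<subseteq> N \<times> space P"
    proof
      fix p assume p: "p \<in> {p \<in> space (?D \<Otimes>\<^sub>M P). \<not> mixing k (fst p) (snd p)}"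
      then have "fst p \<notin> unit_simplex (k + 1)" using space_prior_mixing[OF k P(2), of p ?D] by auto
      then show "p \<in> N \<times> space P" using p N(1) by (auto simp: space_pair_measure)
    qed
    show "emeasure (?D \<Otimes>\<^sub>M P) (N \<times> space P) = 0"
      using N by (subst P.emeasure_pair_measure_Times) auto
    show "N \<times> space P \<in> sets (?D \<Otimes>\<^sub>M P)" using N by auto
  qed
qed

text \<open>\<open>1 / (1 - \<rho>)\<close> is at most \<open>exp (2 * \<rho>)\<close> for
  \<open>\<rho> \<le> 1 / 2\<close>, and every other factor has the form
  \<open>1 + y \<le> exp y\<close>.\<close>

lemma chi_factor_le_exp:
  fixes \<rho> \<eta> e :: real
  assumes "0 < \<rho>" "\<rho> \<le> 1 / 2" "0 \<le> \<eta>" "0 \<le> e"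
  shows "(1 + \<rho>) * (1 + \<eta>) / (1 - \<rho>)\<^sup>2 * (1 + \<eta> + e) \<le> exp (5 * \<rho> + 2 * \<eta> + e)"
proof -
  have "1 \<le> exp (2 * \<rho>) * (1 - \<rho>)"
  proof -
    have "1 \<le> (1 + 2 * \<rho>) * (1 - \<rho>)"
    proof -
      have "\<rho> * \<rho> \<le> (1 / 2) * \<rho>" using assms by (intro mult_right_mono) auto
      then show ?thesis by (simp add: algebra_simps)
    qed
    also have "\<dots> \<le> exp (2 * \<rho>) * (1 - \<rho>)" using assms by (intro mult_right_mono exp_ge_add_one_self) auto
    finally show ?thesis .
  qed
  then have "1 / (1 - \<rho>) \<le> exp (2 * \<rho>)" using assms by (subst pos_divide_le_eq) auto
  then have "(1 / (1 - \<rho>))\<^sup>2 \<le> (exp (2 * \<rho>))\<^sup>2" using assms by (intro power_mono) auto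
  then have inv: "1 / (1 - \<rho>)\<^sup>2 \<le> exp (4 * \<rho>)" by (simp add: power_divide exp_double[symmetric] power2_eq_square exp_add[symmetric])
  have "(1 + \<rho>) * (1 + \<eta>) * (1 / (1 - \<rho>)\<^sup>2) * (1 + (\<eta> + e)) \<le> exp \<rho> * exp \<eta> * exp (4 * \<rho>) * exp (\<eta> + e)"
    using assms inv by (intro mult_mono exp_ge_add_one_self mult_nonneg_nonneg) auto
  also have "\<dots> = exp (5 * \<rho> + 2 * \<eta> + e)" by (simp add: exp_add[symmetric])
  finally show ?thesis by (simp add: add.assoc)
qed

lemma powr_neg_le_power:
  assumes "2 \<le> (n::nat)" "0 \<le> A" "real n powr (- A) \<le> x" "real m \<le> y"
  shows "real n powr (- (A * y)) \<le> x ^ m"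
proof -
  have "real n powr (- (A * y)) \<le> real n powr (- A * real m)"
    using assms by (intro powr_mono) (auto intro: mult_left_mono)
  also have "\<dots> = (real n powr (- A)) ^ m" 
  proof -
    have "(real n powr (- A)) ^ m = (real n powr (- A)) powr real m"
      using assms(1) by (intro powr_realpow[symmetric]) simp
    then show ?thesis by (simp only: powr_powr)
  qed
  also have "\<dots> \<le> x ^ m" using assms by (intro power_mono) auto
  finally show ?thesis .
qed

text \<open>With \<open>\<rho> = 1 / n\<close> and a grid of \<open>n\<close> cells, each of the
  \<open>O(N)\<close> coordinates to be controlled costs a factor polynomial in
  \<open>1 / n\<close>, which gives \<open>n\<close> to the power \<open>- A * N\<close>. The
  constants do not depend on \<open>N\<close>, which is tuned to \<open>n\<close>
  afterwards.\<close>

lemma prior_neighbourhood: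
  fixes a t2 c :: real
  assumes m0: "mixing k \<beta>0 Q0" and Vint: "integrable Q0 (\<lambda>\<theta>. 1 / \<theta> ^ k)" and b: "0 < \<beta>0 0"
    and as: "\<forall>j\<le>k. 0 < as j" and a: "0 < a" and H: "prob_space H" "sets H = sets M01" and DP: "is_DP P a H"
    and C2: "0 < t2" "0 < c" "\<forall>u v. 0 \<le> u \<longrightarrow> u < v \<longrightarrow> v \<le> 1 \<longrightarrow> c * (v - u) powr t2 \<le> measure H {u<..<v}"
  shows "\<exists>A CB n0. 0 \<le> A \<and> 0 \<le> CB \<and> (\<forall>n\<ge>n0. \<forall>N. 1 \<le> N \<longrightarrow> N \<le> n \<longrightarrow>
     (\<exists>B\<in>sets (dirichlet (k + 1) as \<Otimes>\<^sub>M P). ennreal (real n powr (- (A * real N))) \<le> emeasure (dirichlet (k + 1) as \<Otimes>\<^sub>M P) B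
       \<and> (\<forall>p\<in>B. (\<forall>x. 0 < gmix k \<beta>0 Q0 x \<longrightarrow> 0 < gmix k (fst p) (snd p) x) \<and>
            (\<integral>\<^sup>+ x. ennreal ((gmix k \<beta>0 Q0 x)\<^sup>2 / gmix k (fst p) (snd p) x) \<partial>lborel)
              \<le> ennreal (exp (CB * (1 / real N ^ (2 * k) + 1 / real n))))))"
proof -
  interpret m0: mixing k \<beta>0 Q0 by fact
  interpret D: dirichlet_params "k + 1" as using as by unfold_locales auto
  interpret P: prob_space P using DP by (simp add: is_DP_def)
  have setsP: "sets P = sets (prob_algebra M01)" using DP by (simp add: is_DP_def)
  let ?D = "dirichlet (k + 1) as"
  interpret PD: prob_space ?D by (rule D.prob_space_dirichlet)
  define V where "V = (\<integral>\<theta>. 1 / \<theta> ^ k \<partial>Q0)"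
  have V0: "0 \<le> V" unfolding V_def
    by (intro Bochner_Integration.integral_nonneg_AE AE_I2) (auto simp: m0.space_Q)
  define amax where "amax = Max (as ` {..k})"
  define amin where "amin = Min (as ` {..k})"
  have amm: "amin \<le> as i \<and> as i \<le> amax" if "i < k + 1" for i
    unfolding amin_def amax_def using that by auto
  have "amin \<in> as ` {..k}" unfolding amin_def by (intro Min_in) auto
  then have amin0: "0 < amin" using as by auto
  have amax0: "0 < amax" using amin0 amm[of 0] by auto
  obtain G1 where G1: "0 < G1" "\<And>\<alpha>. 0 < \<alpha> \<Longrightarrow> \<alpha> \<le> a \<Longrightarrow> \<alpha> / G1 \<le> 1 / Gamma \<alpha>"
    using Gamma_bounded_interval[OF a] by blast
  obtain G2 where G2: "0 < G2" "\<And>\<alpha>. 0 < \<alpha> \<Longrightarrow> \<alpha> \<le> amax \<Longrightarrow> \<alpha> / G2 \<le> 1 / Gamma \<alpha>"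
    using Gamma_bounded_interval[OF amax0] by blast
  \<comment> \<open>The constants that remain when \<open>\<rho> = 1 / n\<close>,
    \<open>L = n\<close> and at most \<open>6 (k + 1) n\<close> Dirichlet cells are inserted in the
    mass bounds; the powers of \<open>n\<close> go into the exponents for \<open>A1\<close> and
    \<open>A2\<close>.\<close>
  define \<kappa>1 where "\<kappa>1 = exp (- 2) / (2 * G1) * (a * (c * (1 / 2) powr t2)) * (1 / (12 * (real k + 1))) powr (a + 1)"
  define \<kappa>2 where "\<kappa>2 = exp (- 2) / (2 * G2) * amin * (1 / (2 * (real k + 1))) powr (amax + 1)"
  have k12: "0 < \<kappa>1" "0 < \<kappa>2" unfolding \<kappa>1_def \<kappa>2_def using a C2(1,2) G1 G2 amin0 by (auto intro!: mult_pos_pos divide_pos_pos)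
  obtain A1 where A1: "0 \<le> A1" "\<And>n. 2 \<le> n \<Longrightarrow> real n powr (- A1) \<le> \<kappa>1 * real n powr (- (2 * t2 + 2 * (a + 1)))"
    using poly_lower[OF k12(1)] by blast
  obtain A2 where A2: "0 \<le> A2" "\<And>n. 2 \<le> n \<Longrightarrow> real n powr (- A2) \<le> \<kappa>2 * real n powr (- (amax + 1))"
    using poly_lower[OF k12(2)] by blast
  define A where "A = A1 * (6 * (real k + 1)) + A2 * (real k + 1)"
  define CB where "CB = 5 + 2 * (real k * V) + 3 * (real k)\<^sup>2 * V\<^sup>2 * ((real k)\<^sup>2 + 1) / \<beta>0 0"
  \<comment> \<open>\<open>n \<ge> k * V\<close> makes the mass defect \<open>\<eta>\<close> at most
    \<open>1\<close>, and \<open>n \<ge> 2\<close> makes \<open>\<rho>\<close> at most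
    \<open>1 / 2\<close>.\<close>
  define n0 where "n0 = max 2 (nat \<lceil>real k * V\<rceil>)"
  have A0: "0 \<le> A" using A1 A2 by (simp add: A_def)
  have CB0: "0 \<le> CB" using V0 b by (simp add: CB_def)
  have main: "\<exists>B\<in>sets (?D \<Otimes>\<^sub>M P). ennreal (real n powr (- (A * real N))) \<le> emeasure (?D \<Otimes>\<^sub>M P) B
       \<and> (\<forall>p\<in>B. (\<forall>x. 0 < gmix k \<beta>0 Q0 x \<longrightarrow> 0 < gmix k (fst p) (snd p) x) \<and>
            (\<integral>\<^sup>+ x. ennreal ((gmix k \<beta>0 Q0 x)\<^sup>2 / gmix k (fst p) (snd p) x) \<partial>lborel)
              \<le> ennreal (exp (CB * (1 / real N ^ (2 * k) + 1 / real n))))"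
    if n: "n0 \<le> n" and N: "1 \<le> N" "N \<le> n" for n N
  proof -
    have n2: "2 \<le> n" and nkV: "real k * V \<le> real n" using n by (auto simp: n0_def)
    have n1: "1 \<le> n" and np: "0 < real n" using n2 by auto
    define \<rho> where "\<rho> = 1 / real n"
    have rho: "0 < \<rho>" "\<rho> \<le> 1" "\<rho> \<le> 1 / 2" "\<rho> < 1" using n2 by (auto simp: \<rho>_def)
    define \<eta> where "\<eta> = real k * V / real n"
    have eta: "0 \<le> \<eta>" "\<eta> \<le> 1" using V0 nkV np by (auto simp: \<eta>_def)
    define e2 where "e2 = 3 * (real k)\<^sup>2 * V\<^sup>2 * ((real k)\<^sup>2 / real n + 1 / real N ^ (2 * k) + 1 / real n)"
    have e20: "0 \<le> e2" by (simp add: e2_def)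
    obtain Z w where Z: "Z \<subseteq> {..<n}" "card Z \<le> (4 * N + 1) * (k + 1)" "\<forall>l\<in>Z. 0 \<le> w l"
      "\<bar>(\<Sum>l\<in>Z. w l) - 1\<bar> \<le> \<eta>"
      "(\<integral>\<^sup>+ x. ennreal (((\<Sum>l\<in>Z. w l * psi k x (gmid n l)) - (\<integral>\<theta>. psi k x \<theta> \<partial>Q0))\<^sup>2) * indicator {0<..<1} x \<partial>lborel) \<le> ennreal e2"
      using m0.finite_mixture_approximation[OF Vint V_def N(1) n1] unfolding \<eta>_def e2_def by blast
    define B2 where "B2 = {Q \<in> space P. \<forall>l\<in>Z. (1 - \<rho>) * (w l / (1 + \<eta>)) \<le> measure Q (gatom n \<rho> l)}"
    define B1 where "B1 = {y \<in> space (PiM {..<k + 1} (\<lambda>_. borel :: real measure)). \<forall>i<k + 1. (1 - \<rho>) * \<beta>0 i \<le> y i}"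
    define S where "S = {y \<in> space (PiM {..<k + 1} (\<lambda>_. borel :: real measure)). y \<in> unit_simplex (k + 1)}"
    \<comment> \<open>The atom weights sum to at most \<open>1 + \<eta>\<close>; division by it
      makes their sum at most \<open>1\<close>, as the Dirichlet bound requires.\<close>
    have sumw: "(\<Sum>l\<in>Z. w l / (1 + \<eta>)) \<le> 1"
      unfolding sum_divide_distrib[symmetric] using Z(4) eta by (subst pos_divide_le_eq) auto
    have massP: "real n powr (- (A1 * (6 * (real k + 1) * real N))) \<le>
        (exp (- 2) / (2 * G1) * (a * (c * (\<rho> / (2 * real n)) powr t2)) * (\<rho> / (2 * real (card Z + 1))) powr (a + 1)) ^ (card Z + 1)"
    proof (rule powr_neg_le_power[OF n2 A1(1)])
      have "card Z + 1 \<le> (4 * N + 1) * (k + 1) + N * (k + 1)" using Z(2) N(1) by (intro add_mono) auto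
      also have "\<dots> \<le> 6 * (k + 1) * N" using N(1) mult_right_mono[of 1 N "k + 1"] by (simp add: algebra_simps)
      finally have cz: "card Z + 1 \<le> 6 * (k + 1) * N" .
      then have "real (card Z + 1) \<le> real (6 * (k + 1) * N)" by (simp only: of_nat_le_iff)
      then show cz': "real (card Z + 1) \<le> 6 * (real k + 1) * real N" by (simp add: algebra_simps)
      have cz'': "real (card Z + 1) \<le> 6 * (real k + 1) * real n"
      proof -
        have "6 * (real k + 1) * real N \<le> 6 * (real k + 1) * real n" using N(2) by (intro mult_left_mono) auto
        then show ?thesis using cz' by linarith
      qed
      have "1 / (12 * (real k + 1)) * real n powr (- 2) \<le> \<rho> / (2 * real (card Z + 1))"
      proof -
        have "1 / (12 * (real k + 1)) * real n powr (- 2) = \<rho> / (2 * (6 * (real k + 1) * real n))"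
          using np by (simp add: \<rho>_def powr_minus_divide powr_numeral power2_eq_square)
        also have "\<dots> \<le> \<rho> / (2 * real (card Z + 1))" using cz'' rho np by (intro divide_left_mono mult_left_mono) auto
        finally show ?thesis .
      qed
      then have "(1 / (12 * (real k + 1)) * real n powr (- 2)) powr (a + 1) \<le> (\<rho> / (2 * real (card Z + 1))) powr (a + 1)"
        using a by (intro powr_mono2) auto
      moreover have "(1 / (12 * (real k + 1)) * real n powr (- 2)) powr (a + 1)
          = (1 / (12 * (real k + 1))) powr (a + 1) * real n powr (- (2 * (a + 1)))"
        by (subst powr_mult) (auto simp: powr_powr)
      ultimately have p1: "(1 / (12 * (real k + 1))) powr (a + 1) * real n powr (- (2 * (a + 1))) \<le> (\<rho> / (2 * real (card Z + 1))) powr (a + 1)"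
        by simp
      have p2: "(\<rho> / (2 * real n)) powr t2 = (1 / 2) powr t2 * real n powr (- (2 * t2))"
      proof -
        have "\<rho> / (2 * real n) = 1 / 2 * real n powr (- 2)"
          using np by (simp add: \<rho>_def powr_minus_divide powr_numeral power2_eq_square)
        then have "(\<rho> / (2 * real n)) powr t2 = (1 / 2 * real n powr (- 2)) powr t2" by (rule arg_cong)
        also have "\<dots> = (1 / 2) powr t2 * real n powr (- (2 * t2))" by (subst powr_mult) (auto simp: powr_powr)
        finally show ?thesis .
      qed
      have "\<kappa>1 * real n powr (- (2 * t2 + 2 * (a + 1)))
        = exp (- 2) / (2 * G1) * (a * (c * (\<rho> / (2 * real n)) powr t2)) * ((1 / (12 * (real k + 1))) powr (a + 1) * real n powr (- (2 * (a + 1))))"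
        unfolding p2 \<kappa>1_def by (simp add: powr_add[symmetric] minus_add_distrib mult_ac)
      also have "\<dots> \<le> exp (- 2) / (2 * G1) * (a * (c * (\<rho> / (2 * real n)) powr t2)) * (\<rho> / (2 * real (card Z + 1))) powr (a + 1)"
        using p1 G1 a C2(1,2) by (intro mult_left_mono) auto
      finally show "real n powr (- A1) \<le> exp (- 2) / (2 * G1) * (a * (c * (\<rho> / (2 * real n)) powr t2)) * (\<rho> / (2 * real (card Z + 1))) powr (a + 1)"
        using A1(2)[OF n2] by simp
    qed
    have massD: "real n powr (- (A2 * ((real k + 1) * real N))) \<le> (exp (- 2) / (2 * G2) * amin * (\<rho> / (2 * real (k + 1))) powr (amax + 1)) ^ (k + 1)"
    proof (rule powr_neg_le_power[OF n2 A2(1)])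
      have "(\<rho> / (2 * real (k + 1))) powr (amax + 1) = (1 / (2 * (real k + 1))) powr (amax + 1) * real n powr (- (amax + 1))"
      proof -
        have "\<rho> / (2 * real (k + 1)) = 1 / (2 * (real k + 1)) * real n powr (- 1)"
          using np by (simp add: \<rho>_def powr_minus_divide)
        then have "(\<rho> / (2 * real (k + 1))) powr (amax + 1) = (1 / (2 * (real k + 1)) * real n powr (- 1)) powr (amax + 1)" by (rule arg_cong)
        also have "\<dots> = (1 / (2 * (real k + 1))) powr (amax + 1) * (real n powr (- 1)) powr (amax + 1)"
          by (rule powr_mult)
        also have "(real n powr (- 1)) powr (amax + 1) = real n powr (- (amax + 1))"
          by (simp only: powr_powr mult_minus1)
        finally show ?thesis .
      qed
      then show "real n powr (- A2) \<le> exp (- 2) / (2 * G2) * amin * (\<rho> / (2 * real (k + 1))) powr (amax + 1)"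
        using A2(2)[OF n2] by (simp add: \<kappa>2_def mult_ac)
      have "(real k + 1) * 1 \<le> (real k + 1) * real N" using N by (intro mult_left_mono) auto
      then show "real (k + 1) \<le> (real k + 1) * real N" by (simp only: of_nat_add of_nat_1 mult_1_right)
    qed
    have eP: "ennreal (real n powr (- (A1 * (6 * (real k + 1) * real N)))) \<le> emeasure P B2"
    proof -
      have "ennreal ((exp (- 2) / (2 * G1) * (a * (c * (\<rho> / (2 * real n)) powr t2)) * (\<rho> / (2 * real (card Z + 1))) powr (a + 1)) ^ (card Z + 1)) \<le> emeasure P B2"
        unfolding B2_def
        by (rule dirichlet_process_atoms_mass[OF a H DP C2(1,2) C2(3)[rule_format] n1 rho(1,2) Z(1) _ sumw G1]) (use Z eta in auto)
      then show ?thesis using massP by (meson ennreal_leI order_trans)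
    qed
    have eD: "ennreal (real n powr (- (A2 * ((real k + 1) * real N)))) \<le> emeasure ?D B1"
    proof -
      have "ennreal ((exp (- 2) / (2 * G2) * amin * (\<rho> / (2 * real (k + 1))) powr (amax + 1)) ^ (k + 1)) \<le> emeasure ?D B1"
        unfolding B1_def
      proof (rule dirichlet_lower_bound[OF _ amm amin0 _ _ rho(1,2) G2])
        show "0 \<le> \<beta>0 i" if "i < k + 1" for i using m0.beta_nonneg[of i] that by simp
        show "(\<Sum>i<k + 1. \<beta>0 i) \<le> 1" using m0.beta_sum by simp
      qed auto
      then show ?thesis using massD by (meson ennreal_leI order_trans)
    qed
    have B1s: "B1 \<in> sets ?D" unfolding B1_def sets_dirichlet by measurable
    have Ss: "S \<in> sets ?D" unfolding S_def sets_dirichlet by (rule unit_simplex_sets)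
    have B2s: "B2 \<in> sets P"
    proof -
      have "{Q \<in> space P. (1 - \<rho>) * (w l / (1 + \<eta>)) \<le> measure Q (gatom n \<rho> l)} \<in> sets P" if "l \<in> Z" for l
      proof (rule borel_measurable_le[OF borel_measurable_const])
        have "gatom n \<rho> l \<in> sets M01" using Z(1) that rho n1 by (intro gatom_sets_M01) auto
        from measurable_compose[OF measurable_prob_algebraD[OF measurable_ident_sets[OF setsP]] measurable_measure_subprob_algebra[OF this]]
        show "(\<lambda>Q. measure Q (gatom n \<rho> l)) \<in> borel_measurable P" .
      qed
      then show ?thesis unfolding B2_def
        by (rule sets.sets_Collect_finite_All) (assumption | rule finite_subset[OF Z(1) finite_lessThan])+
    qed
    have spD: "space ?D = space (PiM {..<k + 1} (\<lambda>_. borel :: real measure))" using sets_eq_imp_space_eq[OF sets_dirichlet] .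
    \<comment> \<open>Intersecting with the simplex costs no probability and lets every point of the
      neighbourhood, not just almost every one, be treated as a mixture.\<close>
    have eDS: "emeasure ?D (B1 \<inter> S) = emeasure ?D B1"
    proof (rule emeasure_eq_AE)
      show "AE x in ?D. x \<in> B1 \<inter> S \<longleftrightarrow> x \<in> B1"
        using D.AE_dirichlet_simplex by eventually_elim (auto simp: S_def B1_def)
    qed (use B1s Ss in auto)
    let ?B = "(B1 \<inter> S) \<times> B2"
    have "ennreal (real n powr (- (A * real N)))
        = ennreal (real n powr (- (A2 * ((real k + 1) * real N)))) * ennreal (real n powr (- (A1 * (6 * (real k + 1) * real N))))"
      by (simp add: ennreal_mult[symmetric] powr_add[symmetric] A_def algebra_simps)
    also have "\<dots> \<le> emeasure ?D (B1 \<inter> S) * emeasure P B2" unfolding eDS by (intro mult_mono eD eP) auto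
    also have "\<dots> = emeasure (?D \<Otimes>\<^sub>M P) ?B" using B1s Ss B2s by (intro P.emeasure_pair_measure_Times[symmetric]) auto
    finally have mass: "ennreal (real n powr (- (A * real N))) \<le> emeasure (?D \<Otimes>\<^sub>M P) ?B" .
    have mixB: "mixing k (fst p) (snd p)" if p: "p \<in> ?B" for p
    proof (rule space_prior_mixing[OF m0.k1 setsP])
      show "p \<in> space (?D \<Otimes>\<^sub>M P)" unfolding space_pair_measure spD using p by (auto simp: B1_def B2_def)
      show "fst p \<in> unit_simplex (k + 1)" using p by (auto simp: S_def)
    qed
    have good: "(\<forall>x. 0 < gmix k \<beta>0 Q0 x \<longrightarrow> 0 < gmix k (fst p) (snd p) x) \<and>
            (\<integral>\<^sup>+ x. ennreal ((gmix k \<beta>0 Q0 x)\<^sup>2 / gmix k (fst p) (snd p) x) \<partial>lborel)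
              \<le> ennreal (exp (CB * (1 / real N ^ (2 * k) + 1 / real n)))" if p: "p \<in> ?B" for p
    proof -
      have p1: "(1 - \<rho>) * \<beta>0 j \<le> fst p j" if "j \<le> k" for j using p that by (auto simp: B1_def)
      have p2: "(1 - \<rho>) * (w l / (1 + \<eta>)) \<le> measure (snd p) (gatom n \<rho> l)" if "l \<in> Z" for l
        using p that by (auto simp: B2_def)
      note cs = chi_square_bound[OF m0 mixB[OF p] b n1 rho(1,4) Z(1,3,4) eta(2) Z(5) e20 p1 p2]
      have "(1 + \<rho>) * (1 + \<eta>) / (1 - \<rho>)\<^sup>2 * (1 + \<eta> + e2 / \<beta>0 0) \<le> exp (5 * \<rho> + 2 * \<eta> + e2 / \<beta>0 0)"
        using rho eta e20 b by (intro chi_factor_le_exp) auto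
      also have "\<dots> \<le> exp (CB * (1 / real N ^ (2 * k) + 1 / real n))"
      proof (subst exp_le_cancel_iff)
        define E where "E = 1 / real N ^ (2 * k) + 1 / real n"
        have E: "1 / real n \<le> E" "0 \<le> 1 / real N ^ (2 * k)" by (auto simp: E_def)
        have 1: "5 * \<rho> \<le> 5 * E" using E by (simp add: \<rho>_def)
        have "(real k * V) * (1 / real n) \<le> (real k * V) * E" using E V0 by (intro mult_left_mono) auto
        then have 2: "2 * \<eta> \<le> 2 * (real k * V) * E" by (simp add: \<eta>_def)
        have "(real k)\<^sup>2 * (1 / real n) + E \<le> (real k)\<^sup>2 * E + E" using E by (intro add_right_mono mult_left_mono) auto
        then have "(real k)\<^sup>2 / real n + 1 / real N ^ (2 * k) + 1 / real n \<le> ((real k)\<^sup>2 + 1) * E"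
        proof -
          assume "(real k)\<^sup>2 * (1 / real n) + E \<le> (real k)\<^sup>2 * E + E"
          moreover have "(real k)\<^sup>2 / real n + 1 / real N ^ (2 * k) + 1 / real n = (real k)\<^sup>2 * (1 / real n) + E"
            by (simp add: E_def)
          ultimately show ?thesis by (simp only: distrib_right mult_1)
        qed
        then have "3 * (real k)\<^sup>2 * V\<^sup>2 * ((real k)\<^sup>2 / real n + 1 / real N ^ (2 * k) + 1 / real n) \<le> 3 * (real k)\<^sup>2 * V\<^sup>2 * (((real k)\<^sup>2 + 1) * E)"
          by (intro mult_left_mono) auto
        then have "e2 / \<beta>0 0 \<le> 3 * (real k)\<^sup>2 * V\<^sup>2 * (((real k)\<^sup>2 + 1) * E) / \<beta>0 0"
          unfolding e2_def using b by (intro divide_right_mono) auto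
        then show "5 * \<rho> + 2 * \<eta> + e2 / \<beta>0 0 \<le> CB * (1 / real N ^ (2 * k) + 1 / real n)"
          unfolding E_def[symmetric] CB_def using 1 2 by (simp add: distrib_right mult.assoc)
      qed
      finally show ?thesis using cs by (meson ennreal_leI order_trans)
    qed
    show ?thesis using mass mixB good B1s Ss B2s by (intro bexI[of _ ?B]) auto
  qed
  show ?thesis using A0 CB0 main by blast
qed

section \<open>The contraction rate\<close>

text \<open>If \<open>\<beta>0 k = 0\<close>, the derivative condition says nothing about
  \<open>Q0\<close>, but then the mixing measure does not affect the density and may be replaced by
  a point mass, here at \<open>1 / 2\<close>.\<close>

lemma exists_integrable_mixing:
  assumes m: "mixing k \<beta>0 Q0" and lim: "\<exists>L. (iter_rderiv (k - 1) (gmix k \<beta>0 Q0) \<longlongrightarrow> L) (at_right 0)"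
  shows "\<exists>Q1. mixing k \<beta>0 Q1 \<and> gmix k \<beta>0 Q1 = gmix k \<beta>0 Q0 \<and> integrable Q1 (\<lambda>\<theta>. 1 / \<theta> ^ k)"
proof (cases "\<beta>0 k = 0")
  case False
  then show ?thesis using m lim mixing.integrable_inverse_power[OF m] by blast
next
  case True
  interpret mixing k \<beta>0 Q0 by fact
  have half: "(1 / 2 :: real) \<in> space M01" by (simp add: space_M01)
  have "mixing k \<beta>0 (return M01 (1 / 2))"
    using k1 beta half by (intro mixing.intro prob_space_return) auto
  moreover have "gmix k \<beta>0 (return M01 (1 / 2)) = gmix k \<beta>0 Q0" using True by (simp add: gmix_def fun_eq_iff)
  moreover have "integrable (return M01 (1 / 2)) (\<lambda>\<theta>::real. 1 / \<theta> ^ k)"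
  proof (rule integrableI_bounded)
    have meas: "(\<lambda>\<theta>::real. 1 / \<theta> ^ k) \<in> borel_measurable M01" by (intro measurable_M01) measurable
    then show "(\<lambda>\<theta>::real. 1 / \<theta> ^ k) \<in> borel_measurable (return M01 (1 / 2))" by simp
    have "(\<lambda>\<theta>::real. ennreal (norm (1 / \<theta> ^ k))) \<in> borel_measurable M01" by (intro measurable_M01) measurable
    then show "(\<integral>\<^sup>+ \<theta>. ennreal (norm (1 / \<theta> ^ k)) \<partial>return M01 (1 / 2 :: real)) < \<infinity>"
      using half by (subst nn_integral_return) auto
  qed
  ultimately show ?thesis by blast
qed

text \<open>With \<open>x = n / ln n\<close>, both quantities are powers of \<open>x\<close>
  satisfying \<open>T^(2k) * \<epsilon>^2 = 1\<close> and \<open>x * \<epsilon>^2 = T\<close>: the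
  squared approximation error \<open>N^(-2k)\<close> balances the cost \<open>N ln n / n\<close> of
  \<open>N\<close> parameters. The condition \<open>n \<ge> 3\<close> ensures
  \<open>ln n \<ge> 1\<close>.\<close>

lemma rate_facts:
  fixes k n :: nat
  assumes k: "1 \<le> k" and n: "3 \<le> n"
  defines "T \<equiv> (real n / ln (real n)) powr (1 / (2 * real k + 1))"
    and "\<epsilon> \<equiv> (real n / ln (real n)) powr (- (real k / (2 * real k + 1)))"
  shows "1 \<le> T" "1 \<le> nat \<lceil>T\<rceil>" "nat \<lceil>T\<rceil> \<le> n" "real (nat \<lceil>T\<rceil>) \<le> 2 * T"
    "1 / real (nat \<lceil>T\<rceil>) ^ (2 * k) \<le> \<epsilon>\<^sup>2" "real (nat \<lceil>T\<rceil>) / real n \<le> 2 * \<epsilon>\<^sup>2" "real n * \<epsilon>\<^sup>2 = T * ln (real n)" "0 < \<epsilon>"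
proof -
  define x where "x = real n / ln (real n)"
  have e3: "exp 1 \<le> (3::real)" using exp_le by simp
  have ln1: "1 \<le> ln (real n)"
  proof -
    have "exp 1 \<le> real n" using e3 n by linarith
    then show ?thesis using n by (subst ln_ge_iff) auto
  qed
  then have lnp: "0 < ln (real n)" by linarith
  have np: "0 < real n" using n by simp
  have "ln (real n) \<le> real n - 1" using np by (rule ln_le_minus_one)
  then have x1: "1 \<le> x" using ln1 unfolding x_def by (subst pos_le_divide_eq[OF lnp]) auto
  have xn: "x \<le> real n" unfolding x_def using ln1 np by (subst pos_divide_le_eq[OF lnp]) (auto simp: mult_le_cancel_left1)
  have T: "T = x powr (1 / (2 * real k + 1))" by (simp add: T_def x_def)
  have eps: "\<epsilon> = x powr (- (real k / (2 * real k + 1)))" by (simp add: \<epsilon>_def x_def)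
  show T1: "1 \<le> T" unfolding T using x1 by (intro ge_one_powr_ge_zero) auto
  have "T \<le> x powr 1" unfolding T using x1 by (intro powr_mono) auto
  then have Tn: "T \<le> real n" using x1 xn by simp
  let ?N = "nat \<lceil>T\<rceil>"
  show N1: "1 \<le> ?N" using T1 by linarith
  show "?N \<le> n" using Tn by (simp add: nat_le_iff ceiling_le_iff)
  show N2: "real ?N \<le> 2 * T" using T1 by linarith
  have TN: "T \<le> real ?N" by linarith
  show "0 < \<epsilon>" unfolding eps using x1 by simp
  have eps2: "\<epsilon>\<^sup>2 = x powr (- (2 * real k / (2 * real k + 1)))"
    unfolding eps power2_eq_square by (simp add: powr_add[symmetric] add_divide_distrib[symmetric])
  have T2k: "T ^ (2 * k) = x powr (2 * real k / (2 * real k + 1))"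
    using x1 unfolding T by (simp add: powr_realpow[symmetric] powr_powr)
  have "1 / real ?N ^ (2 * k) \<le> 1 / T ^ (2 * k)" using T1 TN by (intro divide_left_mono power_mono mult_pos_pos zero_less_power) auto
  also have "\<dots> = \<epsilon>\<^sup>2" unfolding eps2 T2k by (simp add: powr_minus_divide)
  finally show "1 / real ?N ^ (2 * k) \<le> \<epsilon>\<^sup>2" .
  show ne: "real n * \<epsilon>\<^sup>2 = T * ln (real n)"
  proof -
    have "x powr 1 * \<epsilon>\<^sup>2 = T"
    proof -
      have "1 + - (2 * real k / (2 * real k + 1)) = 1 / (2 * real k + 1)" by (simp add: field_simps)
      then show ?thesis unfolding eps2 T powr_add[symmetric] by simp
    qed
    then have "x * \<epsilon>\<^sup>2 = T" using x1 by simp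
    moreover have "real n = x * ln (real n)" using ln1 by (simp add: x_def)
    ultimately show ?thesis by (metis mult.assoc mult.commute)
  qed
  have "real ?N \<le> 2 * (T * ln (real n))"
  proof -
    have "T * 1 \<le> T * ln (real n)" using T1 ln1 by (intro mult_left_mono) auto
    then show ?thesis using N2 by linarith
  qed
  also have "\<dots> = 2 * \<epsilon>\<^sup>2 * real n" by (simp only: ne[symmetric] mult_ac)
  finally show "real ?N / real n \<le> 2 * \<epsilon>\<^sup>2" using np by (subst pos_divide_le_eq) auto
qed

text \<open>Every factor is at most a fixed power of \<open>n\<close>, since
  \<open>n \<ge> 2\<close> absorbs constants: \<open>n + 1 \<le> n^2\<close> and
  \<open>K + 1 \<le> 2^K \<le> n^K\<close>.\<close>

lemma cover_cardinality:
  fixes n K k N :: nat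
  assumes n: "2 \<le> n" and N: "1 \<le> N"
  shows "real (((n + 1)\<^sup>2 * (K * n + 1) ^ k) ^ (4 * N + 2)) \<le> exp (6 * (4 + real k * (real K + 2)) * (real N * ln (real n)))"
proof -
  have "n + 1 \<le> n ^ 2" using n by (cases n) (auto simp: power2_eq_square)
  then have 1: "(n + 1)\<^sup>2 \<le> n ^ 4" using power_mono[of "n + 1" "n ^ 2" 2] by (simp add: power_mult[symmetric])
  have "K * n + 1 \<le> n ^ (K + 2)"
  proof -
    have "K < 2 ^ K" by (rule less_exp)
    then have "K + 1 \<le> n ^ K" using power_mono[OF n, of K] by linarith
    then have "(K + 1) * n \<le> n ^ K * n" by (rule mult_right_mono) simp
    moreover have "K * n + 1 \<le> (K + 1) * n" using n by simp
    moreover have "n ^ K * n \<le> n ^ (K + 2)" using n by (simp add: power2_eq_square)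
    ultimately show ?thesis by linarith
  qed
  then have "(K * n + 1) ^ k \<le> (n ^ (K + 2)) ^ k" by (intro power_mono) auto
  then have "(K * n + 1) ^ k \<le> n ^ ((K + 2) * k)" by (simp only: power_mult)
  then have "(n + 1)\<^sup>2 * (K * n + 1) ^ k \<le> n ^ 4 * n ^ ((K + 2) * k)"
    by (rule mult_mono[OF 1]) simp_all
  then have "(n + 1)\<^sup>2 * (K * n + 1) ^ k \<le> n ^ (4 + (K + 2) * k)" by (simp only: power_add)
  then have "((n + 1)\<^sup>2 * (K * n + 1) ^ k) ^ (4 * N + 2) \<le> (n ^ (4 + (K + 2) * k)) ^ (4 * N + 2)"
    by (rule power_mono) simp
  also have "\<dots> = n ^ ((4 + (K + 2) * k) * (4 * N + 2))" by (simp only: power_mult)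
  also have "\<dots> \<le> n ^ ((4 + (K + 2) * k) * (6 * N))" using n N by (intro power_increasing mult_left_mono) auto
  finally have "real (((n + 1)\<^sup>2 * (K * n + 1) ^ k) ^ (4 * N + 2)) \<le> real (n ^ ((4 + (K + 2) * k) * (6 * N)))"
    by (simp only: of_nat_le_iff)
  also have "\<dots> = real n powr real ((4 + (K + 2) * k) * (6 * N))" using n by (simp only: of_nat_power) (subst powr_realpow, auto)
  also have "\<dots> = exp (6 * (4 + real k * (real K + 2)) * (real N * ln (real n)))"
    using n by (simp add: powr_def algebra_simps)
  finally show ?thesis .
qed

text \<open>The evidence threshold \<open>d\<close> is the prior mass of \<open>B\<close> times
  \<open>exp (- n \<eta> - w)\<close>. The slack \<open>w\<close> reduces the contribution of a too
  small evidence to \<open>4 * exp (- w)\<close> and inflates the testing term only by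
  \<open>exp w\<close>.\<close>

lemma posterior_bound_fixed_n:
  fixes g0 :: "real \<Rightarrow> real"
  assumes k: "1 \<le> k" and m0: "mixing k \<beta>0 Q0" and as: "\<forall>j\<le>k. 0 < as j" and P: "prob_space P" "sets P = sets (prob_algebra M01)"
    and g0: "g0 = gmix k \<beta>0 Q0"
    and C: "finite (C :: 'c set)" and F: "\<forall>c\<in>C. F c \<in> borel_measurable borel \<and> (\<forall>x. 0 < F c x)
         \<and> (\<integral>\<^sup>+ x. ennreal (g0 x * F c x) \<partial>lborel) \<le> ennreal (exp (- a))"
    and cover: "\<And>\<beta>' Q'. mixing k \<beta>' Q' \<Longrightarrow> e \<le> hellinger (gmix k \<beta>' Q') g0 \<Longrightarrow>
         \<exists>c\<in>C. (\<integral>\<^sup>+ x. ennreal (gmix k \<beta>' Q' x / F c x) \<partial>lborel) \<le> ennreal (exp (- a))"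
    and B: "B \<in> sets (dirichlet (k + 1) as \<Otimes>\<^sub>M P)" "ennreal \<pi>0 \<le> emeasure (dirichlet (k + 1) as \<Otimes>\<^sub>M P) B" "0 < \<pi>0"
    and Bgood: "\<forall>p\<in>B. (\<forall>x. 0 < g0 x \<longrightarrow> 0 < gmix k (fst p) (snd p) x) \<and>
            (\<integral>\<^sup>+ x. ennreal ((g0 x)\<^sup>2 / gmix k (fst p) (snd p) x) \<partial>lborel) \<le> ennreal (exp \<eta>)"
    and card: "real (card C) \<le> exp \<gamma>"
    and w: "0 \<le> w" "0 \<le> \<eta>"
  shows "(\<integral>\<^sup>+ X. posterior (dirichlet (k + 1) as \<Otimes>\<^sub>M P) k n {p. e \<le> hellinger (gmix k (fst p) (snd p)) g0} X
            \<partial>(PiM {..<n} (\<lambda>_. density lborel g0)))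
     \<le> ennreal (2 * exp (\<gamma> - real n * a + real n * \<eta> + w) / \<pi>0 + 4 * exp (- w))"
proof -
  interpret m0: mixing k \<beta>0 Q0 by fact
  interpret D: dirichlet_params "k + 1" as using as by unfold_locales auto
  interpret P: prob_space P by fact
  let ?D = "dirichlet (k + 1) as"
  interpret PD: prob_space ?D by (rule D.prob_space_dirichlet)
  let ?Pr = "?D \<Otimes>\<^sub>M P"
  interpret pair: pair_prob_space ?D P ..
  have Prp: "prob_space ?Pr" by (rule pair.prob_space_axioms)
  \<comment> \<open>Clipping at \<open>0\<close> does not change the likelihood, where
    \<open>ennreal\<close> clips already, and makes the family nonnegative for all parameters, also
    off the simplex.\<close>
  define g where "g p x = max 0 (gmix k (fst p) (snd p) x)" for p :: "(nat \<Rightarrow> real) \<times> real measure" and x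
  define \<pi> where "\<pi> = measure ?Pr B"
  have Bpi: "emeasure ?Pr B = ennreal \<pi>" unfolding \<pi>_def by (rule pair.emeasure_eq_measure)
  have pi: "\<pi>0 \<le> \<pi>" "\<pi> \<le> 1" "0 < \<pi>"
  proof -
    show "\<pi> \<le> 1" unfolding \<pi>_def by (rule pair.prob_le_1)
    have "0 \<le> \<pi>" by (simp add: \<pi>_def)
    then show "\<pi>0 \<le> \<pi>" using B(2) unfolding Bpi by (simp only: ennreal_le_iff)
    then show "0 < \<pi>" using B(3) by simp
  qed
  define q where "q = ennreal (exp (- a))"
  define r where "r = ennreal (exp \<eta>)"
  define d where "d = \<pi> * exp (- (real n * \<eta>) - w)"
  have d: "0 < d" "d \<le> 1"
  proof -
    show "0 < d" using pi by (simp add: d_def)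
    have "0 \<le> real n * \<eta>" using w by simp
    then have "exp (- (real n * \<eta>) - w) \<le> 1" using w(1) unfolding exp_le_one_iff by linarith
    then have "\<pi> * exp (- (real n * \<eta>) - w) \<le> 1 * 1" using pi by (intro mult_mono) auto
    then show "d \<le> 1" by (simp add: d_def)
  qed
  have mg: "(\<lambda>(p, x). g p x) \<in> borel_measurable (?Pr \<Otimes>\<^sub>M borel)"
    using measurable_gmix_joint[OF sets_dirichlet P(2), of k as] unfolding g_def split_beta' by measurable
  define S where "S c = {p \<in> space ?Pr. (\<integral>\<^sup>+ x. ennreal (g p x / F c x) \<partial>lborel) \<le> q}" for c
  have Sm: "S c \<in> sets ?Pr" if c: "c \<in> C" for c
  proof -
    have Fc: "F c \<in> borel_measurable borel" using F c by blast
    have mg': "(\<lambda>z. g (fst z) (snd z)) \<in> borel_measurable (?Pr \<Otimes>\<^sub>M lborel)"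
      using mg unfolding split_beta' by (simp add: measurable_cong_sets[OF sets_pair_measure_cong[OF refl sets_lborel] refl])
    have "(\<lambda>(p, x). ennreal (g p x / F c x)) \<in> borel_measurable (?Pr \<Otimes>\<^sub>M lborel)"
      unfolding split_beta' using mg' measurable_compose[OF measurable_snd, of "F c" lborel borel ?Pr] Fc
      by (intro measurable_compose[OF _ measurable_ennreal] borel_measurable_divide) auto
    then have "(\<lambda>p. \<integral>\<^sup>+ x. ennreal (g p x / F c x) \<partial>lborel) \<in> borel_measurable ?Pr"
      by (rule lborel.borel_measurable_nn_integral)
    then show ?thesis unfolding S_def by (intro borel_measurable_le) auto
  qed
  have g_mix: "g p = gmix k (fst p) (snd p)" if "mixing k (fst p) (snd p)" for p
    using mixing.gmix_nonneg[OF that] by (simp add: g_def fun_eq_iff)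
  let ?A = "{p. e \<le> hellinger (gmix k (fst p) (snd p)) g0}"
  have AEc: "AE p in ?Pr. p \<in> ?A \<longrightarrow> (\<exists>c\<in>C. p \<in> S c)"
    using AE_prior_mixing[OF k as P] AE_space
  proof eventually_elim
    case (elim p)
    then show ?case using cover[OF elim(1)] by (auto simp: S_def q_def g_mix)
  qed
  have eq: "posterior ?Pr k n ?A X = (\<integral>\<^sup>+ p. indicator ?A p * (\<Prod>i<n. ennreal (g p (X i))) \<partial>?Pr)
              / (\<integral>\<^sup>+ p. (\<Prod>i<n. ennreal (g p (X i))) \<partial>?Pr)" for X
    unfolding posterior_def likelihood_def g_def ennreal_max_0' by simp
  have Bg: "p \<in> B \<Longrightarrow> 0 < g0 x \<Longrightarrow> 0 < g p x" for p x using Bgood by (auto simp: g_def)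
  have "(\<integral>\<^sup>+ X. posterior ?Pr k n ?A X \<partial>(PiM {..<n} (\<lambda>_. density lborel g0)))
    \<le> of_nat (card C) * (q ^ n + q ^ n / ennreal d) + ennreal (4 * d / \<pi>) * r ^ n"
    unfolding eq
  proof (rule posterior_expectation_bound[where S=S and F=F and B=B])
    show "prob_space ?Pr" by (rule Prp)
    show "(\<lambda>(p, x). g p x) \<in> borel_measurable (?Pr \<Otimes>\<^sub>M borel)" by (rule mg)
    show "AE p in ?Pr. p \<in> ?A \<longrightarrow> (\<exists>c\<in>C. p \<in> S c)" by (rule AEc)
    show "c \<in> C \<Longrightarrow> S c \<in> sets ?Pr" for c by (rule Sm)
    show "emeasure ?Pr B = ennreal \<pi>" by (rule Bpi)
    show "p \<in> B \<Longrightarrow> (\<integral>\<^sup>+ x. ennreal ((g0 x)\<^sup>2 / g p x) \<partial>lborel) \<le> r" for p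
    proof -
      assume p: "p \<in> B"
      have "(\<integral>\<^sup>+ x. ennreal ((g0 x)\<^sup>2 / g p x) \<partial>lborel) \<le> (\<integral>\<^sup>+ x. ennreal ((g0 x)\<^sup>2 / gmix k (fst p) (snd p) x) \<partial>lborel)"
      proof (rule nn_integral_mono)
        fix x
        show "ennreal ((g0 x)\<^sup>2 / g p x) \<le> ennreal ((g0 x)\<^sup>2 / gmix k (fst p) (snd p) x)"
        proof (cases "0 < g0 x")
          case True
          then have "0 < gmix k (fst p) (snd p) x" using Bgood p by blast
          then show ?thesis by (simp add: g_def)
        next
          case False
          then have "g0 x = 0" using m0.gmix_nonneg[of x] by (simp add: g0)
          then show ?thesis by simp
        qed
      qed
      also have "\<dots> \<le> r" using Bgood p by (simp add: r_def)
      finally show ?thesis .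
    qed
  qed (use F B(1) C pi d Bg m0.gmix_nonneg m0.nn_integral_gmix m0.borel_measurable_gmix in \<open>auto simp: g0 g_def q_def S_def\<close>)
  also have "\<dots> \<le> ennreal (2 * exp (\<gamma> - real n * a + real n * \<eta> + w) / \<pi>0 + 4 * exp (- w))"
  proof -
    have qn: "q ^ n = ennreal (exp (- (real n * a)))" unfolding q_def by (simp add: ennreal_power exp_of_nat_mult[symmetric])
    have rn: "r ^ n = ennreal (exp (real n * \<eta>))" unfolding r_def by (simp add: ennreal_power exp_of_nat_mult[symmetric])
    have "of_nat (card C) * (q ^ n + q ^ n / ennreal d) + ennreal (4 * d / \<pi>) * r ^ n
      = ennreal (real (card C) * (exp (- (real n * a)) + exp (- (real n * a)) / d) + 4 * d / \<pi> * exp (real n * \<eta>))"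
    proof -
      have "of_nat (card C) * (q ^ n + q ^ n / ennreal d)
        = ennreal (real (card C) * (exp (- (real n * a)) + exp (- (real n * a)) / d))"
        unfolding qn using d
        by (simp add: divide_ennreal ennreal_mult ennreal_of_nat_eq_real_of_nat)
      moreover have "ennreal (4 * d / \<pi>) * r ^ n = ennreal (4 * d / \<pi> * exp (real n * \<eta>))"
        unfolding rn using d pi by (intro ennreal_mult[symmetric]) auto
      ultimately show ?thesis using d pi by (subst ennreal_plus) auto
    qed
    also have "\<dots> \<le> ennreal (2 * exp (\<gamma> - real n * a + real n * \<eta> + w) / \<pi>0 + 4 * exp (- w))"
    proof (intro ennreal_leI add_mono)
      have "4 * d / \<pi> * exp (real n * \<eta>) = 4 * exp (- w)"
        using pi by (simp add: d_def exp_diff exp_minus field_simps)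
      then show "4 * d / \<pi> * exp (real n * \<eta>) \<le> 4 * exp (- w)" by simp
      have "exp (- (real n * a)) * 1 \<le> exp (- (real n * a)) * (1 / d)" using d by (intro mult_left_mono) (auto simp: le_divide_eq)
      then have "exp (- (real n * a)) + exp (- (real n * a)) / d \<le> 2 * (exp (- (real n * a)) / d)" by simp
      also have "1 / d \<le> exp (real n * \<eta> + w) / \<pi>0"
      proof -
        have "1 / d = exp (real n * \<eta> + w) / \<pi>" using pi by (simp add: d_def exp_diff exp_minus exp_add field_simps)
        also have "\<dots> \<le> exp (real n * \<eta> + w) / \<pi>0" using pi B(3) by (intro divide_left_mono) auto
        finally show ?thesis .
      qed
      then have "2 * (exp (- (real n * a)) / d) \<le> 2 * (exp (- (real n * a)) * (exp (real n * \<eta> + w) / \<pi>0))"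
        by (simp add: divide_inverse mult_left_mono)
      finally have "exp (- (real n * a)) + exp (- (real n * a)) / d \<le> 2 * (exp (- (real n * a)) * (exp (real n * \<eta> + w) / \<pi>0))" .
      then have "real (card C) * (exp (- (real n * a)) + exp (- (real n * a)) / d)
        \<le> exp \<gamma> * (2 * (exp (- (real n * a)) * (exp (real n * \<eta> + w) / \<pi>0)))"
        using card d by (intro mult_mono) auto
      also have "\<dots> = 2 * exp (\<gamma> - real n * a + real n * \<eta> + w) / \<pi>0"
        by (simp add: exp_add exp_diff exp_minus field_simps)
      finally show "real (card C) * (exp (- (real n * a)) + exp (- (real n * a)) / d) \<le> 2 * exp (\<gamma> - real n * a + real n * \<eta> + w) / \<pi>0" .
    qed
    finally show ?thesis .
  qed
  finally show ?thesis .
qed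

theorem mainTheorem3:
  fixes k :: nat and \<beta>0 :: "nat \<Rightarrow> real" and Q0 :: "real measure" and g0 :: "real \<Rightarrow> real"
    and as :: "nat \<Rightarrow> real" and a :: real and H :: "real measure" and P :: "real measure measure"
    and M :: "nat \<Rightarrow> real"
  assumes k: "1 \<le> k"
    and beta0: "\<beta>0 \<in> unit_simplex (k + 1)" and beta00: "\<beta>0 0 > 0"
    and Q0: "prob_space Q0" "sets Q0 = sets M01"
    and g0: "g0 = gmix k \<beta>0 Q0"
    and deriv0: "\<exists>L. (iter_rderiv (k - 1) g0 \<longlongrightarrow> L) (at_right 0)"
    and as_pos: "\<forall>j\<le>k. 0 < as j" and a_pos: "0 < a"
    and H: "prob_space H" "sets H = sets M01"
    and C1: "\<exists>pH :: real \<Rightarrow> real. pH \<in> borel_measurable lborel \<and> (\<forall>x. 0 \<le> pH x) \<and>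
               H = density (restrict_space lborel {0<..<1}) (\<lambda>x. ennreal (pH x)) \<and>
               (\<exists>t1>0. \<exists>C>0. \<exists>\<delta>>0. \<forall>\<theta>\<in>{0<..<\<delta>}. pH \<theta> \<le> C * \<theta> powr t1)"
    and C2: "\<exists>t2>0. \<exists>c>0. \<forall>u v. 0 \<le> u \<longrightarrow> u < v \<longrightarrow> v \<le> 1 \<longrightarrow>
               c * (v - u) powr t2 \<le> measure H {u<..<v}"
    and DP: "is_DP P a H"
    and M: "filterlim M at_top sequentially"
  shows "(\<lambda>n. \<integral>\<^sup>+ X. posterior (dirichlet (k + 1) as \<Otimes>\<^sub>M P) k n
              {p. M n * (real n / ln (real n)) powr (- (real k / (2 * real k + 1)))
                    \<le> hellinger (gmix k (fst p) (snd p)) g0} X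
            \<partial>(PiM {..<n} (\<lambda>_. density lborel g0))) \<longlonglongrightarrow> 0"
proof -
  have "mixing k \<beta>0 Q0" using k beta0 Q0 by (intro mixing.intro)
  then obtain Q1 where m1: "mixing k \<beta>0 Q1" and gQ: "gmix k \<beta>0 Q1 = gmix k \<beta>0 Q0" and Vint: "integrable Q1 (\<lambda>\<theta>. 1 / \<theta> ^ k)"
    using exists_integrable_mixing[of k \<beta>0 Q0] deriv0 unfolding g0 by blast
  interpret mixing k \<beta>0 Q1 by (rule m1)
  have g1: "g0 = gmix k \<beta>0 Q1" using g0 gQ by simp
  define b where "b = \<beta>0 0"
  have b: "0 < b" "b \<le> 1" using beta00 beta_le[of 0] by (auto simp: b_def)
  define G where "G = real k + real k * (\<integral>\<theta>. 1 / \<theta> ^ k \<partial>Q1)"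
  define K where "K = nat \<lceil>max 1 (2 * G)\<rceil>"
  have K: "1 \<le> K" "2 * G \<le> real K" unfolding K_def by linarith+
  have bG: "\<forall>x\<in>{0<..<1}. b \<le> gmix k \<beta>0 Q1 x \<and> gmix k \<beta>0 Q1 x \<le> G"
    using gmix_ge_beta0 gmix_le[OF Vint] by (simp add: b_def G_def)
  obtain t2 c where C2': "0 < t2" "0 < c" "\<forall>u v. 0 \<le> u \<longrightarrow> u < v \<longrightarrow> v \<le> 1 \<longrightarrow> c * (v - u) powr t2 \<le> measure H {u<..<v}"
    using C2 by blast
  have P: "prob_space P" "sets P = sets (prob_algebra M01)" using DP unfolding is_DP_def by blast+
  obtain A CB n0 where pn: "0 \<le> A \<and> 0 \<le> CB \<and> (\<forall>n\<ge>n0. \<forall>N. 1 \<le> N \<longrightarrow> N \<le> n \<longrightarrow>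
     (\<exists>B\<in>sets (dirichlet (k + 1) as \<Otimes>\<^sub>M P). ennreal (real n powr (- (A * real N))) \<le> emeasure (dirichlet (k + 1) as \<Otimes>\<^sub>M P) B
       \<and> (\<forall>p\<in>B. (\<forall>x. 0 < gmix k \<beta>0 Q1 x \<longrightarrow> 0 < gmix k (fst p) (snd p) x) \<and>
            (\<integral>\<^sup>+ x. ennreal ((gmix k \<beta>0 Q1 x)\<^sup>2 / gmix k (fst p) (snd p) x) \<partial>lborel)
              \<le> ennreal (exp (CB * (1 / real N ^ (2 * k) + 1 / real n))))))"
    using prior_neighbourhood[OF m1 Vint beta00 as_pos a_pos H DP C2'] by (elim exE) (rule that)
  note A = conjunct1[OF pn] and CB = conjunct1[OF conjunct2[OF pn]] and prior = conjunct2[OF conjunct2[OF pn], rule_format]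
  define cb where "cb = b / (256 * real K)"
  define D where "D = ((4 ^ k) ^ (k - 1) * real K)\<^sup>2"
  define CA where "CA = 4 * (real k)\<^sup>2 + 2 * (D * real k) + 24 * (real K)\<^sup>2"
  define CC where "CC = 12 * (4 + real k * (real K + 2))"
  \<comment> \<open>All that \<open>cb * (M n)^2\<close> has to exceed: twice the approximation
    error of the tests, and four times the sum of the entropy exponent \<open>CC\<close>, the
    chi-square exponent \<open>3 * CB\<close>, the prior mass exponent \<open>2 * A\<close>, and
    \<open>2\<close> for the evidence slack and the final decay \<open>exp (- w)\<close>.\<close>
  define R where "R = 2 * CA + 4 * (CC + 3 * CB + 2 + 2 * A)"
  have cb: "0 < cb" using b K by (simp add: cb_def)
  have const0: "0 \<le> CA" "0 \<le> CC" "0 \<le> D" by (simp_all add: CA_def CC_def D_def)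
  let ?I = "\<lambda>n. \<integral>\<^sup>+ X. posterior (dirichlet (k + 1) as \<Otimes>\<^sub>M P) k n
              {p. M n * (real n / ln (real n)) powr (- (real k / (2 * real k + 1)))
                    \<le> hellinger (gmix k (fst p) (snd p)) g0} X
            \<partial>(PiM {..<n} (\<lambda>_. density lborel g0))"
  have bound: "?I n \<le> ennreal (6 / real n)" if n: "max 3 n0 \<le> n" and Mn: "max 1 (R / cb) \<le> M n" for n
  proof -
    have n3: "3 \<le> n" and nn0: "n0 \<le> n" and n2: "2 \<le> n" and n1: "1 \<le> n" and np: "0 < real n" using n by auto
    define T where "T = (real n / ln (real n)) powr (1 / (2 * real k + 1))"
    define \<epsilon> where "\<epsilon> = (real n / ln (real n)) powr (- (real k / (2 * real k + 1)))"
    define N where "N = nat \<lceil>T\<rceil>"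
    define \<delta> where "\<delta> = \<epsilon>\<^sup>2"
    define w where "w = T * ln (real n)"
    note rf = rate_facts[OF k n3, folded T_def \<epsilon>_def, folded N_def \<delta>_def w_def]
    have \<delta>0: "0 \<le> \<delta>" by (simp add: \<delta>_def)
    have ln0: "0 \<le> ln (real n)" using n1 by simp
    have lnw: "ln (real n) \<le> w" unfolding w_def using mult_right_mono[OF rf(1) ln0] by simp
    have w0: "0 \<le> w" using lnw ln0 by linarith
    have Nw: "real N * ln (real n) \<le> 2 * w" unfolding w_def using mult_right_mono[OF rf(4) ln0] by (simp add: mult.assoc)
    have n\<delta>: "1 / real n \<le> 2 * \<delta>"
    proof -
      have "1 / real n \<le> real N / real n" using rf(2) np by (intro divide_right_mono) auto
      then show ?thesis using rf(6) by linarith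
    qed
    have M1: "1 \<le> M n" "R / cb \<le> M n" using Mn by auto
    have MR: "R \<le> cb * (M n)\<^sup>2"
    proof -
      have "R \<le> cb * M n" using M1(2) cb by (simp add: pos_divide_le_eq mult.commute)
      also have "\<dots> \<le> cb * (M n)\<^sup>2" using M1(1) cb by (intro mult_left_mono) (auto simp: power2_eq_square)
      finally show ?thesis .
    qed
    \<comment> \<open>Half of the separation \<open>cb * (M n)^2 * \<delta>\<close> is spent on the
      approximation error; the other half is shared equally by the two kinds of test error.\<close>
    define a' where "a' = cb * (M n)\<^sup>2 * \<delta> / 4"
    define \<eta> where "\<eta> = CB * (1 / real N ^ (2 * k) + 1 / real n)"
    define \<gamma> where "\<gamma> = 6 * (4 + real k * (real K + 2)) * (real N * ln (real n))"
    define \<pi>0 where "\<pi>0 = real n powr (- (A * real N))"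
    obtain C :: "(nat \<Rightarrow> nat \<times> nat \<times> (nat \<Rightarrow> nat)) set" and F where C: "finite C"
      "card C \<le> ((n + 1)\<^sup>2 * (K * n + 1) ^ k) ^ (4 * N + 2)"
      and F: "\<forall>c\<in>C. F c \<in> borel_measurable borel \<and> (\<forall>x. 0 < F c x)
         \<and> (\<integral>\<^sup>+ x. ennreal (gmix k \<beta>0 Q1 x * F c x) \<partial>lborel) \<le> ennreal (exp (- a'))"
      and tests: "\<forall>\<beta>' Q'. mixing k \<beta>' Q' \<longrightarrow>
         2 * a' \<le> b / (256 * real K) * (hellinger (gmix k \<beta>' Q') (gmix k \<beta>0 Q1))\<^sup>2
            - (2 * (real k / real n)\<^sup>2 + 2 * (((4 ^ k) ^ (k - 1) * real K)\<^sup>2 / real N ^ (2 * k) * real k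
              + (real K)\<^sup>2 / real N ^ (2 * k) + (real K)\<^sup>2 * real (4 * N + 1) / real n) + (real K)\<^sup>2 * (1 / real n)) \<longrightarrow>
         (\<exists>c\<in>C. (\<integral>\<^sup>+ x. ennreal (gmix k \<beta>' Q' x / F c x) \<partial>lborel) \<le> ennreal (exp (- a')))"
      using test_family[OF b bG K rf(2) n1, of a'] by (elim exE conjE) (rule that)
    have err: "2 * (real k / real n)\<^sup>2 + 2 * (D / real N ^ (2 * k) * real k
              + (real K)\<^sup>2 / real N ^ (2 * k) + (real K)\<^sup>2 * real (4 * N + 1) / real n) + (real K)\<^sup>2 * (1 / real n) \<le> CA * \<delta>"
    proof -
      have e1: "(real k / real n)\<^sup>2 \<le> (real k)\<^sup>2 * (2 * \<delta>)"
      proof -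
        have "1 / (real n)\<^sup>2 \<le> 1 / real n" using n1 by (intro divide_left_mono) (auto simp: power2_eq_square)
        then have "(real k)\<^sup>2 * (1 / (real n)\<^sup>2) \<le> (real k)\<^sup>2 * (2 * \<delta>)" using n\<delta> by (intro mult_left_mono) auto
        then show ?thesis by (simp add: power_divide)
      qed
      have e2: "D / real N ^ (2 * k) * real k \<le> D * real k * \<delta>"
        using mult_left_mono[OF rf(5), of "D * real k"] const0 by simp
      have e3: "(real K)\<^sup>2 / real N ^ (2 * k) \<le> (real K)\<^sup>2 * \<delta>" using mult_left_mono[OF rf(5), of "(real K)\<^sup>2"] by simp
      have e4: "(real K)\<^sup>2 * real (4 * N + 1) / real n \<le> (real K)\<^sup>2 * (10 * \<delta>)"
      proof -
        have "real (4 * N + 1) / real n = 4 * (real N / real n) + 1 / real n" by (simp add: add_divide_distrib)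
        also have "\<dots> \<le> 10 * \<delta>" using rf(6) n\<delta> by linarith
        finally have "(real K)\<^sup>2 * (real (4 * N + 1) / real n) \<le> (real K)\<^sup>2 * (10 * \<delta>)" by (intro mult_left_mono) auto
        then show ?thesis by simp
      qed
      have e5: "(real K)\<^sup>2 * (1 / real n) \<le> (real K)\<^sup>2 * (2 * \<delta>)" using n\<delta> by (intro mult_left_mono) auto
      have rhs: "2 * ((real k)\<^sup>2 * (2 * \<delta>)) + 2 * (D * real k * \<delta> + (real K)\<^sup>2 * \<delta> + (real K)\<^sup>2 * (10 * \<delta>)) + (real K)\<^sup>2 * (2 * \<delta>) = CA * \<delta>"
        by (simp add: CA_def algebra_simps)
      show ?thesis unfolding rhs[symmetric]
        by (intro add_mono mult_left_mono e1 e2 e3 e4 e5) simp_all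
    qed
    have cover: "\<exists>c\<in>C. (\<integral>\<^sup>+ x. ennreal (gmix k \<beta>' Q' x / F c x) \<partial>lborel) \<le> ennreal (exp (- a'))"
      if m: "mixing k \<beta>' Q'" and h: "M n * \<epsilon> \<le> hellinger (gmix k \<beta>' Q') g0" for \<beta>' Q'
    proof -
      have "(M n * \<epsilon>)\<^sup>2 \<le> (hellinger (gmix k \<beta>' Q') g0)\<^sup>2" using h M1 rf(8) by (intro power_mono) auto
      then have "cb * ((M n)\<^sup>2 * \<delta>) \<le> cb * (hellinger (gmix k \<beta>' Q') g0)\<^sup>2"
        using cb by (intro mult_left_mono) (auto simp: power_mult_distrib \<delta>_def)
      moreover have "2 * CA * \<delta> \<le> cb * (M n)\<^sup>2 * \<delta>"
      proof (rule mult_right_mono[OF _ \<delta>0])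
        show "2 * CA \<le> cb * (M n)\<^sup>2" using MR const0 CB A by (simp add: R_def)
      qed
      moreover have "2 * a' = cb * ((M n)\<^sup>2 * \<delta>) / 2" "cb * (M n)\<^sup>2 * \<delta> = cb * ((M n)\<^sup>2 * \<delta>)"
        "2 * CA * \<delta> = 2 * (CA * \<delta>)" by (simp_all add: a'_def)
      ultimately have "2 * a' \<le> cb * (hellinger (gmix k \<beta>' Q') g0)\<^sup>2 - CA * \<delta>" by linarith
      then have "2 * a' \<le> b / (256 * real K) * (hellinger (gmix k \<beta>' Q') (gmix k \<beta>0 Q1))\<^sup>2
            - (2 * (real k / real n)\<^sup>2 + 2 * (((4 ^ k) ^ (k - 1) * real K)\<^sup>2 / real N ^ (2 * k) * real k
              + (real K)\<^sup>2 / real N ^ (2 * k) + (real K)\<^sup>2 * real (4 * N + 1) / real n) + (real K)\<^sup>2 * (1 / real n))"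
        using err unfolding cb_def[symmetric] D_def[symmetric] g1[symmetric] by linarith
      then show ?thesis using tests m by blast
    qed
    obtain B where B: "B \<in> sets (dirichlet (k + 1) as \<Otimes>\<^sub>M P)" "ennreal \<pi>0 \<le> emeasure (dirichlet (k + 1) as \<Otimes>\<^sub>M P) B"
      "\<forall>p\<in>B. (\<forall>x. 0 < gmix k \<beta>0 Q1 x \<longrightarrow> 0 < gmix k (fst p) (snd p) x) \<and>
            (\<integral>\<^sup>+ x. ennreal ((gmix k \<beta>0 Q1 x)\<^sup>2 / gmix k (fst p) (snd p) x) \<partial>lborel) \<le> ennreal (exp \<eta>)"
      using prior[OF nn0 rf(2,3)] unfolding \<pi>0_def[symmetric] \<eta>_def[symmetric] by (elim bexE conjE) (rule that)
    have \<pi>0: "0 < \<pi>0" using np by (simp add: \<pi>0_def)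
    have card: "real (card C) \<le> exp \<gamma>"
      using C(2) cover_cardinality[OF n2 rf(2), of K k] unfolding \<gamma>_def by (meson of_nat_le_iff order_trans)
    have \<eta>0: "0 \<le> \<eta>" using CB by (simp add: \<eta>_def)
    have "?I n \<le> ennreal (2 * exp (\<gamma> - real n * a' + real n * \<eta> + w) / \<pi>0 + 4 * exp (- w))"
      unfolding \<epsilon>_def[symmetric]
      by (rule posterior_bound_fixed_n[OF k m1 as_pos P g1 C(1) F[folded g1] _ B(1,2) \<pi>0 B(3)[folded g1] card w0 \<eta>0])
         (rule cover)
    also have "\<dots> \<le> ennreal (6 / real n)"
    proof (rule ennreal_leI)
      have g: "\<gamma> \<le> CC * w"
      proof -
        have "\<gamma> \<le> 6 * (4 + real k * (real K + 2)) * (2 * w)"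
          unfolding \<gamma>_def using Nw by (intro mult_left_mono) auto
        also have "\<dots> = CC * w" by (simp add: CC_def algebra_simps)
        finally show ?thesis .
      qed
      have na: "real n * a' = cb * (M n)\<^sup>2 * w / 4" using rf(7) by (simp add: a'_def mult.assoc[symmetric] mult.commute)
      have ne: "real n * \<eta> \<le> 3 * CB * w"
      proof -
        have "\<eta> \<le> CB * (3 * \<delta>)" unfolding \<eta>_def using rf(5) n\<delta> CB by (intro mult_left_mono) auto
        then have "real n * \<eta> \<le> real n * (CB * (3 * \<delta>))" by (intro mult_left_mono) auto
        also have "\<dots> = 3 * CB * (real n * \<delta>)" by simp
        finally show ?thesis unfolding rf(7) .
      qed
      have p: "1 / \<pi>0 \<le> exp (2 * A * w)"
      proof -
        have "1 / \<pi>0 = exp (A * (real N * ln (real n)))" using np by (simp add: \<pi>0_def powr_def exp_minus field_simps)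
        also have "\<dots> \<le> exp (A * (2 * w))" using Nw A by (simp add: mult_left_mono)
        finally show ?thesis by (simp add: mult_ac)
      qed
      have MRw: "(CC + 3 * CB + 2 + 2 * A) * w \<le> cb * (M n)\<^sup>2 * w / 4"
      proof -
        have "4 * (CC + 3 * CB + 2 + 2 * A) \<le> cb * (M n)\<^sup>2" using MR const0 by (simp add: R_def)
        from mult_right_mono[OF this w0] have "4 * ((CC + 3 * CB + 2 + 2 * A) * w) \<le> cb * (M n)\<^sup>2 * w"
          by (simp only: mult.assoc)
        then show ?thesis by simp
      qed
      have "2 * exp (\<gamma> - real n * a' + real n * \<eta> + w) / \<pi>0 = 2 * (exp (\<gamma> - real n * a' + real n * \<eta> + w) * (1 / \<pi>0))" by simp
      also have "\<dots> \<le> 2 * (exp (\<gamma> - real n * a' + real n * \<eta> + w) * exp (2 * A * w))"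
        using p by (intro mult_left_mono) auto
      also have "\<dots> = 2 * exp (\<gamma> - real n * a' + real n * \<eta> + w + 2 * A * w)" by (simp only: exp_add)
      also have "\<dots> \<le> 2 * exp (- w)"
      proof -
        have "\<gamma> - real n * a' + real n * \<eta> + w + 2 * A * w \<le> - w"
          using g ne MRw unfolding na by (simp add: distrib_right)
        then show ?thesis by simp
      qed
      finally have "2 * exp (\<gamma> - real n * a' + real n * \<eta> + w) / \<pi>0 + 4 * exp (- w) \<le> 6 * exp (- w)" by simp
      also have "\<dots> \<le> 6 * exp (- ln (real n))" using lnw by simp
      also have "\<dots> = 6 / real n" using np by (simp add: exp_minus divide_inverse)
      finally show "2 * exp (\<gamma> - real n * a' + real n * \<eta> + w) / \<pi>0 + 4 * exp (- w) \<le> 6 / real n" .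
    qed
    finally show ?thesis .
  qed
  have "\<forall>\<^sub>F n in sequentially. max 1 (R / cb) \<le> M n" 
    using M[unfolded filterlim_at_top, rule_format] .
  then have ev: "\<forall>\<^sub>F n in sequentially. ?I n \<le> ennreal (6 / real n)"
    using eventually_ge_at_top[of "max 3 n0"] by eventually_elim (rule bound)
  have "(\<lambda>n. 6 / real n) \<longlonglongrightarrow> 0" by (rule lim_const_over_n)
  then have lim: "(\<lambda>n. ennreal (6 / real n)) \<longlonglongrightarrow> 0" using tendsto_ennrealI[of "\<lambda>n. 6 / real n" 0] by simp
  show ?thesis
    by (rule tendsto_sandwich[OF _ ev tendsto_const lim]) simp
qed

end
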